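(* Let $1/2\le\theta\le1$, $\delta=\theta\tau$ with $0<\delta\le1$, and assume the approximation estimate $$\|Y-\Pi_hY\|_\Omega+h\|G(Y-\Pi_hY)\|_\Omega\lesssim h^r\|Y\|_{H^r(\Omega)}$$ for $Y=U(t),\partial_tU(t),\partial_t^2U(t)$, and that $U$ is regular enough that the norms below are finite. Let $U_h^n\in\mathcal V_h$ satisfy $U_h^0=\Pi_hU(0)$ and $(A_\tau U_h^n,T_\delta W)_\Omega=(\mathcal M_\theta F(t^n),T_\delta W)_\Omega$ for all $W\in\mathcal V_h$, $1\le n\le N$. Then $$\begin{aligned}\max_{1\le n\le N}\|T_\delta(U_h^n-U(t^n))\|_\Omega\lesssim{}&(h^r+\delta h^{r-1})\|U\|_{L^\infty(0,T;H^r(\Omega))}\\&+\bigl((1+T^{1/2})\delta^{1/2}h^{r-1}+\delta^{-1/2}h^r\bigr)\mathcal N_{r,2}(U)\\&+(1+T^{1/2})\tau^\nu\mathcal C^\sharp_{T,\nu+2}(U,F)\\&+\tau^{1/2}(h^r+\tau h^{r-1})\|\partial_tU\|_{L^2(0,T;H^r(\Omega))}\\&+\tau^{1/2}h^{r-1}\|U\|_{L^2(0,T;H^r(\Omega))}+\tau^{\nu+1/2}\mathcal C^\sharp_{T,\nu+2}(U,F),\end{aligned}$$ with $\nu=1$ for fixed $\theta>1/2$, and with $\nu=2$ for $\theta=1/2$ or $\theta=1/2+O(\tau)$.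
   Context: Setting. $\Omega\subset\mathbb R^d$ is a Lipschitz domain, $\mathcal H=[L^2(\Omega)]^{n_{\rm sys}}$ with inner product $(\cdot,\cdot)_\Omega$ and norm $\|\cdot\|_\Omega$; $\mathcal V\subset[H^1(\Omega)]^{n_{\rm sys}}$ is dense in $\mathcal H$; $G:\mathcal V\to\mathcal H$ is a time-independent linear first-order differential operator with $(GU,V)_\Omega=-(U,GV)_\Omega$ for all $U,V\in\mathcal V$. $U$ is the exact solution of $\partial_tU+GU=F$ on $(0,T)$, $U(0)=U_0$. $\mathcal V_h\subset\mathcal V$ is a conforming finite element space of componentwise polynomial degree at most $k$ on a shape-regular mesh of mesh size $h$; $\Pi_h:\mathcal H\to\mathcal V_h$ is the $L^2$-orthogonal projection; $s\ge1$ is the spatial Sobolev regularity index, $r=\min(s,k+1)$. $\tau>0$, $t^n=n\tau$ ($0\le n\le N$), $t^N\le T$. $D_\tau^-V^n=\tau^{-1}(V^n-V^{n-1})$, $\mathcal M_\theta V^n=\theta V^n+(1-\theta)V^{n-1}$ (also for sampled functions), $T_\delta=\mathrm{Id}+\delta G$, $A_\tau=D_\tau^-+G\mathcal M_\theta$. $$\mathcal N_{r,2}(U)=\sum_{j=0}^2\|\partial_t^jU\|_{L^2(0,T;H^r(\Omega))}+\sum_{j=0}^1\|\partial_t^jU\|_{L^\infty(0,T;H^r(\Omega))}.$$ $\mathcal C^\sharp_{T,\nu+2}(U,F)$ is the regularity quantity containing the norms $\|\partial_t^2U\|$ and $\|\partial_t^3U\|$ in both $L^2(0,T;\mathcal H)$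 and $L^\infty(0,T;\mathcal H)$, and $\|\partial_t^4U\|_{L^2(0,T;\mathcal H)}$ (take their sum). Convention: $a\lesssim b$ means $a\le Cb$ with $C>0$ independent of $h$, $\tau$ and $N$; when $\theta=1/2+O(\tau)$, $C$ may depend on the constant in $O(\tau)$. *)

theory Defs
  imports "HOL-Analysis.Analysis" "HOL-Probability.Essential_Supremum"
begin

text \<open>
  Elements of the Hilbert space of square integrable fields on \<open>\<Omega>\<close> are represented by
  functions \<open>real^'d \<Rightarrow> real^'m\<close> (\<open>'d\<close> indexes the space coordinates, \<open>'m\<close> the components of
  the system); only their values on \<open>\<Omega>\<close> up to null sets matter, so identities between elements
  of that space are stated almost everywhere.
\<close>

type_synonym ('d, 'm) vfield = "real^'d \<Rightarrow> real^'m"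


section \<open>Lipschitz domains\<close>

text \<open>
  Near every boundary point the domain is the set of points strictly above the graph of a
  Lipschitz function \<open>\<gamma>\<close> of the component orthogonal to some unit vector \<open>e\<close>.
\<close>

definition lipschitz_domain :: "(real^'d) set \<Rightarrow> bool" where
  "lipschitz_domain \<Omega> \<longleftrightarrow>
     open \<Omega> \<and> connected \<Omega> \<and> bounded \<Omega> \<and> \<Omega> \<noteq> {} \<and>
     (\<forall>x\<in>frontier \<Omega>. \<exists>e \<rho> L (\<gamma> :: real^'d \<Rightarrow> real).
        norm e = 1 \<and> 0 < \<rho> \<and> L-lipschitz_on UNIV \<gamma> \<and>
        \<Omega> \<inter> ball x \<rho> = {y \<in> ball x \<rho>. \<gamma> (y - (y \<bullet> e) *\<^sub>R e) < y \<bullet> e})"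


section \<open>The space of square integrable fields\<close>

definition L2_space :: "(real^'d) set \<Rightarrow> ('d::finite, 'm::finite) vfield set" where
  "L2_space \<Omega> = {u. u \<in> borel_measurable (lebesgue_on \<Omega>) \<and>
                    integrable (lebesgue_on \<Omega>) (\<lambda>x. (norm (u x))\<^sup>2)}"

definition l2_inner :: "(real^'d) set \<Rightarrow> ('d::finite, 'm::finite) vfield \<Rightarrow> ('d, 'm) vfield \<Rightarrow> real" where
  "l2_inner \<Omega> u v = (\<integral>x. u x \<bullet> v x \<partial>lebesgue_on \<Omega>)"

definition l2_norm :: "(real^'d) set \<Rightarrow> ('d::finite, 'm::finite) vfield \<Rightarrow> real" where
  "l2_norm \<Omega> u = sqrt (l2_inner \<Omega> u u)"

definition field_subspace :: "('d::finite, 'm::finite) vfield set \<Rightarrow> bool" where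
  "field_subspace V \<longleftrightarrow> (\<lambda>x. 0) \<in> V \<and>
     (\<forall>u\<in>V. \<forall>v\<in>V. \<forall>a b. (\<lambda>x. a *\<^sub>R u x + b *\<^sub>R v x) \<in> V)"

definition dense_in_L2 :: "(real^'d) set \<Rightarrow> ('d::finite, 'm::finite) vfield set \<Rightarrow> bool" where
  "dense_in_L2 \<Omega> V \<longleftrightarrow>
     (\<forall>u\<in>L2_space \<Omega>. \<forall>\<epsilon>>0. \<exists>v\<in>V. l2_norm \<Omega> (\<lambda>x. u x - v x) < \<epsilon>)"


section \<open>Weak derivatives and Sobolev norms\<close>

text \<open>A list of indices encodes an iterated partial derivative.\<close>

primrec partials :: "'d list \<Rightarrow> (real^'d \<Rightarrow> real) \<Rightarrow> real^'d \<Rightarrow> real" where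
  "partials [] \<phi> = \<phi>"
| "partials (i # is) \<phi> = (\<lambda>x. frechet_derivative (partials is \<phi>) (at x) (axis i 1))"

definition test_function :: "(real^'d) set \<Rightarrow> (real^'d \<Rightarrow> real) \<Rightarrow> bool" where
  "test_function \<Omega> \<phi> \<longleftrightarrow>
     (\<forall>is x. partials is \<phi> differentiable at x) \<and>
     compact (closure {x. \<phi> x \<noteq> 0}) \<and> closure {x. \<phi> x \<noteq> 0} \<subseteq> \<Omega>"

definition has_weak_partials ::
    "(real^'d) set \<Rightarrow> 'd list \<Rightarrow> ('d::finite, 'm::finite) vfield \<Rightarrow> ('d, 'm) vfield \<Rightarrow> bool" where
  "has_weak_partials \<Omega> is u w \<longleftrightarrow> w \<in> L2_space \<Omega> \<and>
     (\<forall>\<phi>. test_function \<Omega> \<phi> \<longrightarrow>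
        (\<integral>x. partials is \<phi> x *\<^sub>R u x \<partial>lebesgue_on \<Omega>) =
        (-1) ^ length is *\<^sub>R (\<integral>x. \<phi> x *\<^sub>R w x \<partial>lebesgue_on \<Omega>))"

text \<open>Unique up to null sets whenever it exists.\<close>

definition weak_partials :: "(real^'d) set \<Rightarrow> 'd list \<Rightarrow> ('d::finite, 'm::finite) vfield \<Rightarrow> ('d, 'm) vfield" where
  "weak_partials \<Omega> is u = (SOME w. has_weak_partials \<Omega> is u w)"

text \<open>
  For a non-integer order \<open>r = m + \<sigma>\<close> with \<open>0 < \<sigma> < 1\<close> the Sobolev--Slobodeckij (Gagliardo)
  seminorms of the derivatives of order \<open>m\<close> are added. Summing over index lists rather than
  multi-indices means that the j-th derivative is measured in the Frobenius norm.
\<close>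

definition gagliardo :: "real \<Rightarrow> ('d::finite, 'm::finite) vfield \<Rightarrow> (real^'d) \<times> (real^'d) \<Rightarrow> real" where
  "gagliardo \<sigma> w = (\<lambda>(x, y). (norm (w x - w y))\<^sup>2 / norm (x - y) powr (real CARD('d) + 2 * \<sigma>))"

definition sobolev_space :: "(real^'d) set \<Rightarrow> real \<Rightarrow> ('d::finite, 'm::finite) vfield set" where
  "sobolev_space \<Omega> r = {u \<in> L2_space \<Omega>.
     (\<forall>is. length is \<le> nat \<lfloor>r\<rfloor> \<longrightarrow> (\<exists>w. has_weak_partials \<Omega> is u w)) \<and>
     (frac r \<noteq> 0 \<longrightarrow> (\<forall>is. length is = nat \<lfloor>r\<rfloor> \<longrightarrow>
        integrable (lebesgue_on \<Omega> \<Otimes>\<^sub>M lebesgue_on \<Omega>) (gagliardo (frac r) (weak_partials \<Omega> is u))))}"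

definition sobolev_norm :: "(real^'d) set \<Rightarrow> real \<Rightarrow> ('d::finite, 'm::finite) vfield \<Rightarrow> real" where
  "sobolev_norm \<Omega> r u = sqrt
     ((\<Sum>is | length is \<le> nat \<lfloor>r\<rfloor>. (l2_norm \<Omega> (weak_partials \<Omega> is u))\<^sup>2) +
      (if frac r = 0 then 0 else
         (\<Sum>is | length is = nat \<lfloor>r\<rfloor>.
            \<integral>z. gagliardo (frac r) (weak_partials \<Omega> is u) z
              \<partial>(lebesgue_on \<Omega> \<Otimes>\<^sub>M lebesgue_on \<Omega>))))"


section \<open>The operator\<close>

definition first_order_operator ::
    "(real^'d) set \<Rightarrow> ('d::finite, 'm::finite) vfield set \<Rightarrow> (('d, 'm) vfield \<Rightarrow> ('d, 'm) vfield) \<Rightarrow> bool" where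
  "first_order_operator \<Omega> V G \<longleftrightarrow>
     (\<exists>(A :: 'd \<Rightarrow> real^'d \<Rightarrow> real^'m^'m) B.
        (\<forall>i. A i \<in> borel_measurable (lebesgue_on \<Omega>)) \<and> B \<in> borel_measurable (lebesgue_on \<Omega>) \<and>
        (\<forall>u\<in>V. AE x in lebesgue_on \<Omega>.
           G u x = (\<Sum>i\<in>UNIV. A i x *v weak_partials \<Omega> [i] u x) + B x *v u x))"

definition linear_into_L2 ::
    "(real^'d) set \<Rightarrow> ('d::finite, 'm::finite) vfield set \<Rightarrow> (('d, 'm) vfield \<Rightarrow> ('d, 'm) vfield) \<Rightarrow> bool" where
  "linear_into_L2 \<Omega> V G \<longleftrightarrow> (\<forall>u\<in>V. G u \<in> L2_space \<Omega>) \<and>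
     (\<forall>u\<in>V. \<forall>v\<in>V. \<forall>a b. AE x in lebesgue_on \<Omega>.
        G (\<lambda>y. a *\<^sub>R u y + b *\<^sub>R v y) x = a *\<^sub>R G u x + b *\<^sub>R G v x)"

definition skew_symmetric ::
    "(real^'d) set \<Rightarrow> ('d::finite, 'm::finite) vfield set \<Rightarrow> (('d, 'm) vfield \<Rightarrow> ('d, 'm) vfield) \<Rightarrow> bool" where
  "skew_symmetric \<Omega> V G \<longleftrightarrow> (\<forall>u\<in>V. \<forall>v\<in>V. l2_inner \<Omega> (G u) v = - l2_inner \<Omega> u (G v))"


section \<open>Vector-valued functions of time\<close>

text \<open>
  Bochner spaces on \<open>(0, T)\<close> with values in a space \<open>X\<close> of fields that carries the norm \<open>\<nu>X\<close>.
  Strong measurability is approximability by simple functions almost everywhere.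
\<close>

definition strongly_measurable ::
    "real \<Rightarrow> ('d::finite, 'm::finite) vfield set \<Rightarrow> (('d, 'm) vfield \<Rightarrow> real) \<Rightarrow> (real \<Rightarrow> ('d, 'm) vfield) \<Rightarrow> bool" where
  "strongly_measurable T X \<nu>X f \<longleftrightarrow>
     (\<exists>S :: nat \<Rightarrow> real \<Rightarrow> ('d, 'm) vfield.
        (\<forall>n. simple_function (lebesgue_on {0<..<T}) (S n) \<and> (\<forall>t\<in>{0<..<T}. S n t \<in> X)) \<and>
        (AE t in lebesgue_on {0<..<T}.
           f t \<in> X \<and> (\<lambda>n. \<nu>X (\<lambda>x. S n t x - f t x)) \<longlonglongrightarrow> 0))"

definition in_L2_time ::
    "real \<Rightarrow> ('d::finite, 'm::finite) vfield set \<Rightarrow> (('d, 'm) vfield \<Rightarrow> real) \<Rightarrow> (real \<Rightarrow> ('d, 'm) vfield) \<Rightarrow> bool" where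
  "in_L2_time T X \<nu>X f \<longleftrightarrow>
     strongly_measurable T X \<nu>X f \<and> integrable (lebesgue_on {0<..<T}) (\<lambda>t. (\<nu>X (f t))\<^sup>2)"

definition L2_time_norm ::
    "real \<Rightarrow> (('d::finite, 'm::finite) vfield \<Rightarrow> real) \<Rightarrow> (real \<Rightarrow> ('d, 'm) vfield) \<Rightarrow> real" where
  "L2_time_norm T \<nu>X f = sqrt (\<integral>t. (\<nu>X (f t))\<^sup>2 \<partial>lebesgue_on {0<..<T})"

definition in_Linf_time ::
    "real \<Rightarrow> ('d::finite, 'm::finite) vfield set \<Rightarrow> (('d, 'm) vfield \<Rightarrow> real) \<Rightarrow> (real \<Rightarrow> ('d, 'm) vfield) \<Rightarrow> bool" where
  "in_Linf_time T X \<nu>X f \<longleftrightarrow>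
     strongly_measurable T X \<nu>X f \<and> esssup (lebesgue_on {0<..<T}) (\<lambda>t. ereal (\<nu>X (f t))) < \<infinity>"

definition Linf_time_norm ::
    "real \<Rightarrow> (('d::finite, 'm::finite) vfield \<Rightarrow> real) \<Rightarrow> (real \<Rightarrow> ('d, 'm) vfield) \<Rightarrow> real" where
  "Linf_time_norm T \<nu>X f = real_of_ereal (esssup (lebesgue_on {0<..<T}) (\<lambda>t. ereal (\<nu>X (f t))))"

text \<open>
  \<open>g\<close> is the time derivative of \<open>f\<close>, where \<open>f\<close> is taken to be the continuous representative on
  \<open>[0, T]\<close>: \<open>f b - f a\<close> is the Bochner integral of \<open>g\<close> over \<open>[a, b]\<close>. Since \<open>g\<close> is Bochner square
  integrable, this identity may be tested with the elements of the Hilbert space.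
\<close>

definition has_time_derivative ::
    "(real^'d) set \<Rightarrow> real \<Rightarrow> (real \<Rightarrow> ('d::finite, 'm::finite) vfield) \<Rightarrow> (real \<Rightarrow> ('d, 'm) vfield) \<Rightarrow> bool" where
  "has_time_derivative \<Omega> T f g \<longleftrightarrow>
     (\<forall>t\<in>{0..T}. f t \<in> L2_space \<Omega>) \<and> in_L2_time T (L2_space \<Omega>) (l2_norm \<Omega>) g \<and>
     (\<forall>a b. 0 \<le> a \<and> a \<le> b \<and> b \<le> T \<longrightarrow> (\<forall>v\<in>L2_space \<Omega>.
        l2_inner \<Omega> (f b) v - l2_inner \<Omega> (f a) v = (\<integral>t. l2_inner \<Omega> (g t) v \<partial>lebesgue_on {a..b})))"

text \<open>
  The equation is understood at every point of the closed interval because the scheme samples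
  \<open>F\<close> at the nodes, which include \<open>0\<close> and possibly \<open>T\<close>. \<open>U'\<close> stands for the time derivative
  of \<open>U\<close>.
\<close>

definition exact_solution ::
    "(real^'d) set \<Rightarrow> ('d::finite, 'm::finite) vfield set \<Rightarrow> (('d, 'm) vfield \<Rightarrow> ('d, 'm) vfield) \<Rightarrow> real \<Rightarrow>
     (real \<Rightarrow> ('d, 'm) vfield) \<Rightarrow> ('d, 'm) vfield \<Rightarrow>
     (real \<Rightarrow> ('d, 'm) vfield) \<Rightarrow> (real \<Rightarrow> ('d, 'm) vfield) \<Rightarrow> bool" where
  "exact_solution \<Omega> V G T F U0 U U' \<longleftrightarrow>
     has_time_derivative \<Omega> T U U' \<and>
     (\<forall>t\<in>{0..T}. U t \<in> V \<and> (AE x in lebesgue_on \<Omega>. U' t x + G (U t) x = F t x)) \<and>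
     (AE x in lebesgue_on \<Omega>. U 0 x = U0 x)"

text \<open>In the following \<open>dU j\<close> is the j-th time derivative of \<open>dU 0\<close>.\<close>

definition finite_norms ::
    "(real^'d) set \<Rightarrow> real \<Rightarrow> real \<Rightarrow> (nat \<Rightarrow> real \<Rightarrow> ('d::finite, 'm::finite) vfield) \<Rightarrow> bool" where
  "finite_norms \<Omega> T r dU \<longleftrightarrow>
     (\<forall>j\<le>2. in_L2_time T (sobolev_space \<Omega> r) (sobolev_norm \<Omega> r) (dU j)) \<and>
     (\<forall>j\<le>1. in_Linf_time T (sobolev_space \<Omega> r) (sobolev_norm \<Omega> r) (dU j)) \<and>
     (\<forall>j\<in>{2, 3, 4}. in_L2_time T (L2_space \<Omega>) (l2_norm \<Omega>) (dU j)) \<and>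
     (\<forall>j\<in>{2, 3}. in_Linf_time T (L2_space \<Omega>) (l2_norm \<Omega>) (dU j))"

definition norm_N2 ::
    "(real^'d) set \<Rightarrow> real \<Rightarrow> real \<Rightarrow> (nat \<Rightarrow> real \<Rightarrow> ('d::finite, 'm::finite) vfield) \<Rightarrow> real" where
  "norm_N2 \<Omega> T r dU =
     (\<Sum>j\<le>2. L2_time_norm T (sobolev_norm \<Omega> r) (dU j)) +
     (\<Sum>j\<le>1. Linf_time_norm T (sobolev_norm \<Omega> r) (dU j))"

text \<open>The regularity quantity is taken to be the full sum in both regimes, so it depends neither on
the order \<open>\<nu>\<close> nor explicitly on the right-hand side of the equation.\<close>

definition C_sharp :: "(real^'d) set \<Rightarrow> real \<Rightarrow> (nat \<Rightarrow> real \<Rightarrow> ('d::finite, 'm::finite) vfield) \<Rightarrow> real" where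
  "C_sharp \<Omega> T dU =
     L2_time_norm T (l2_norm \<Omega>) (dU 2) + Linf_time_norm T (l2_norm \<Omega>) (dU 2) +
     L2_time_norm T (l2_norm \<Omega>) (dU 3) + Linf_time_norm T (l2_norm \<Omega>) (dU 3) +
     L2_time_norm T (l2_norm \<Omega>) (dU 4)"


section \<open>Meshes and finite element spaces\<close>

text \<open>
  A mesh is a finite set of closed cells, each the closure of a Lipschitz domain, with
  disjoint interiors, covering the closure of \<open>\<Omega>\<close>. It is shape-regular with constant \<open>\<sigma>\<close> if each
  cell contains a ball whose radius is at least the cell diameter divided by \<open>\<sigma>\<close>.
\<close>

definition is_mesh :: "(real^'d) set \<Rightarrow> (real^'d) set set \<Rightarrow> bool" where
  "is_mesh \<Omega> M \<longleftrightarrow> finite M \<and> \<Union>M = closure \<Omega> \<and>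
     (\<forall>K\<in>M. lipschitz_domain (interior K) \<and> K = closure (interior K)) \<and>
     (\<forall>K\<in>M. \<forall>L\<in>M. K \<noteq> L \<longrightarrow> interior K \<inter> interior L = {})"

definition shape_regular :: "real \<Rightarrow> (real^'d) set set \<Rightarrow> bool" where
  "shape_regular \<sigma> M \<longleftrightarrow>
     (\<forall>K\<in>M. \<exists>x \<rho>. 0 < \<rho> \<and> ball x \<rho> \<subseteq> K \<and> diameter K \<le> \<sigma> * \<rho>)"

definition mesh_size :: "(real^'d) set set \<Rightarrow> real" where
  "mesh_size M = (MAX K\<in>M. diameter K)"

text \<open>Each component is a polynomial of total degree at most \<open>k\<close>; \<open>c \<alpha>\<close> collects the
  coefficients of the monomial with multi-index \<open>\<alpha>\<close>.\<close>

definition polynomial_field :: "nat \<Rightarrow> ('d::finite, 'm::finite) vfield \<Rightarrow> bool" where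
  "polynomial_field k p \<longleftrightarrow>
     (\<exists>c :: ('d \<Rightarrow> nat) \<Rightarrow> real^'m.
        \<forall>x. p x = (\<Sum>\<alpha> | (\<Sum>i\<in>UNIV. \<alpha> i) \<le> k. (\<Prod>i\<in>UNIV. (x $ i) ^ \<alpha> i) *\<^sub>R c \<alpha>))"

text \<open>The span, inside \<open>V\<close>, of finitely many piecewise polynomial basis functions.\<close>

definition fe_space ::
    "('d::finite, 'm::finite) vfield set \<Rightarrow> (real^'d) set set \<Rightarrow> nat \<Rightarrow> ('d, 'm) vfield set \<Rightarrow> bool" where
  "fe_space V M k Vh \<longleftrightarrow> Vh \<subseteq> V \<and>
     (\<exists>B. finite B \<and> Vh = {v. \<exists>c. v = (\<lambda>x. \<Sum>b\<in>B. c b *\<^sub>R b x)} \<and>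
        (\<forall>b\<in>B. \<forall>K\<in>M. \<exists>p. polynomial_field k p \<and> (\<forall>x\<in>interior K. b x = p x)))"

definition l2_projection ::
    "(real^'d) set \<Rightarrow> ('d::finite, 'm::finite) vfield set \<Rightarrow> ('d, 'm) vfield \<Rightarrow> ('d, 'm) vfield" where
  "l2_projection \<Omega> Vh u =
     (SOME p. p \<in> Vh \<and> (\<forall>w\<in>Vh. l2_inner \<Omega> (\<lambda>x. u x - p x) w = 0))"


section \<open>The discrete operators\<close>

definition D_minus :: "real \<Rightarrow> (nat \<Rightarrow> ('d::finite, 'm::finite) vfield) \<Rightarrow> nat \<Rightarrow> ('d, 'm) vfield" where
  "D_minus \<tau> v n = (\<lambda>x. (1 / \<tau>) *\<^sub>R (v n x - v (n - 1) x))"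

definition M_theta :: "real \<Rightarrow> (nat \<Rightarrow> ('d::finite, 'm::finite) vfield) \<Rightarrow> nat \<Rightarrow> ('d, 'm) vfield" where
  "M_theta \<theta> v n = (\<lambda>x. \<theta> *\<^sub>R v n x + (1 - \<theta>) *\<^sub>R v (n - 1) x)"

definition T_delta ::
    "(('d::finite, 'm::finite) vfield \<Rightarrow> ('d, 'm) vfield) \<Rightarrow> real \<Rightarrow> ('d, 'm) vfield \<Rightarrow> ('d, 'm) vfield" where
  "T_delta G \<delta> v = (\<lambda>x. v x + \<delta> *\<^sub>R G v x)"

definition A_tau ::
    "(('d::finite, 'm::finite) vfield \<Rightarrow> ('d, 'm) vfield) \<Rightarrow> real \<Rightarrow> real \<Rightarrow> (nat \<Rightarrow> ('d, 'm) vfield) \<Rightarrow>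
     nat \<Rightarrow> ('d, 'm) vfield" where
  "A_tau G \<tau> \<theta> v n = (\<lambda>x. D_minus \<tau> v n x + G (M_theta \<theta> v n) x)"

end

theory Submission
  imports Defs
begin

text \<open>
  Write \<open>\<eta> = U - \<Pi>\<^sub>h U\<close> for the projection error, \<open>e\<^sup>n = U\<^sub>h\<^sup>n - \<Pi>\<^sub>h U(t\<^sup>n)\<close> for the discrete error, \<open>D\<close> for the
  backward difference quotient and \<open>M\<close> for the \<open>\<theta>\<close>-weighted mean of two consecutive values. Since
  \<open>U\<close> solves the equation at the nodes, subtracting the scheme gives
  \<open>(A e\<^sup>n, T W) = (A \<eta>\<^sup>n, T W) - (R\<^sup>n, T W)\<close> for all discrete \<open>W\<close>, where
  \<open>R\<^sup>n = D U(t\<^sup>n) - M \<partial>\<^sub>tU(t\<^sup>n)\<close> is the consistency error in time.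

  The decisive choice is \<open>W = 2 M e\<^sup>n - e\<^sup>n\<^sup>-\<^sup>1\<close>. Because \<open>\<delta> = \<theta>\<tau>\<close>, it satisfies
  \<open>T W = M e\<^sup>n + \<delta> A e\<^sup>n + \<delta>\<^sup>2 G D e\<^sup>n\<close>. By skew symmetry and \<open>\<theta> \<ge> 1/2\<close> the left-hand side
  then controls \<open>\<delta> \<parallel>A e\<^sup>n\<parallel>\<^sup>2\<close> and the increment of \<open>\<parallel>T e\<^sup>n\<parallel>\<^sup>2 = \<parallel>e\<^sup>n\<parallel>\<^sup>2 + \<delta>\<^sup>2 \<parallel>G e\<^sup>n\<parallel>\<^sup>2\<close>. On the right,
  orthogonality of \<open>\<eta>\<close> to the discrete space yields \<open>(A \<eta>, M e) = - (M \<eta>, A e)\<close>, hence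
  \<open>(A \<eta>, T W) = (\<delta> A \<eta> - M \<eta>, A e) + \<delta>\<^sup>2 (A \<eta>, G D e)\<close>
  (lemma \<open>one_step_energy\<close>). The first term is absorbed by \<open>\<delta> \<parallel>A e\<parallel>\<^sup>2\<close> and leaves
  \<open>\<delta>\<^sup>1\<^sup>/\<^sup>2 h\<^sup>r\<^sup>-\<^sup>1\<close> and \<open>\<delta>\<^sup>-\<^sup>1\<^sup>/\<^sup>2 h\<^sup>r\<close> without any power of \<open>T\<close>. The second is summed by parts in time,
  so that only \<open>\<delta> G e\<close>, which \<open>T e\<close> controls, and \<open>A \<eta>\<close> and its time differences remain; here
  \<open>\<partial>\<^sub>t\<^sup>2U\<close> enters and, as in the sum of the consistency errors, a factor \<open>T\<^sup>1\<^sup>/\<^sup>2\<close>. The outcome is a quadratic inequality for \<open>max \<parallel>T e\<^sup>n\<parallel>\<close>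
  (lemma \<open>discrete_stability\<close>) with absolute constants, so no exponential growth in \<open>T\<close> appears.

  It remains to bound \<open>\<eta>\<close>, \<open>G \<eta>\<close> and \<open>R\<close> at the nodes. All time derivatives are handled weakly, by
  testing with the dense space \<open>V\<close>: the projection and \<open>G\<close> can both be moved onto the test field, so
  \<open>\<eta>\<close> and \<open>G \<eta>\<close> have weak derivatives, and increments, second differences and the trapezoidal error
  reduce to integrals of scalar functions of time. A value at a node is compared with one at a
  nearby good time, where the function is below its mean square (lemma \<open>sampled_norm_le\<close>); thus
  sums over the nodes are bounded by \<open>L\<^sup>2\<close> norms in time. Finally, the mesh size is at most the diameter of the domain, which allows
  \<open>h\<^sup>r\<close> to be replaced by a multiple of \<open>h\<^sup>r\<^sup>-\<^sup>1\<close> where needed.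
\<close>

section \<open>The Hilbert space of square integrable fields\<close>

lemma L2_space_inner_integrable:
  assumes "u \<in> L2_space \<Omega>" "v \<in> L2_space \<Omega>"
  shows "integrable (lebesgue_on \<Omega>) (\<lambda>x. u x \<bullet> v x)"
proof (rule Bochner_Integration.integrable_bound)
  show "integrable (lebesgue_on \<Omega>) (\<lambda>x. (norm (u x))\<^sup>2 + (norm (v x))\<^sup>2)"
    using assms by (simp add: L2_space_def)
  show "(\<lambda>x. u x \<bullet> v x) \<in> borel_measurable (lebesgue_on \<Omega>)"
    using assms by (auto simp: L2_space_def)
  show "AE x in lebesgue_on \<Omega>. norm (u x \<bullet> v x) \<le> norm ((norm (u x))\<^sup>2 + (norm (v x))\<^sup>2)"
  proof (rule AE_I2)
    fix x
    have "\<bar>u x \<bullet> v x\<bar> \<le> norm (u x) * norm (v x)" by (rule Cauchy_Schwarz_ineq2)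
    also have "\<dots> \<le> (norm (u x))\<^sup>2 + (norm (v x))\<^sup>2"
      using sum_squares_bound[of "norm (u x)" "norm (v x)"] mult_nonneg_nonneg[OF norm_ge_zero[of "u x"] norm_ge_zero[of "v x"]]
      by linarith
    finally show "norm (u x \<bullet> v x) \<le> norm ((norm (u x))\<^sup>2 + (norm (v x))\<^sup>2)"
      by simp
  qed
qed

lemma L2_space_scaleR [simp]:
  assumes "u \<in> L2_space \<Omega>"
  shows "(\<lambda>x. a *\<^sub>R u x) \<in> L2_space \<Omega>"
  using assms by (auto simp: L2_space_def power_mult_distrib)

lemma L2_space_zero [simp]: "(\<lambda>x. 0) \<in> L2_space \<Omega>"
  by (simp add: L2_space_def)

lemma L2_space_add [simp]:
  assumes "u \<in> L2_space \<Omega>" "v \<in> L2_space \<Omega>"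
  shows "(\<lambda>x. u x + v x) \<in> L2_space \<Omega>"
proof -
  have "(\<lambda>x. (norm (u x + v x))\<^sup>2) = (\<lambda>x. (norm (u x))\<^sup>2 + 2 * (u x \<bullet> v x) + (norm (v x))\<^sup>2)"
    by (auto simp: power2_norm_eq_inner inner_add inner_commute)
  then show ?thesis
    using assms L2_space_inner_integrable[OF assms] by (auto simp: L2_space_def)
qed

lemma L2_space_minus [simp]: "u \<in> L2_space \<Omega> \<Longrightarrow> (\<lambda>x. - u x) \<in> L2_space \<Omega>"
  using L2_space_scaleR[of u \<Omega> "-1"] by simp

lemma L2_space_diff [simp]:
  assumes "u \<in> L2_space \<Omega>" "v \<in> L2_space \<Omega>"
  shows "(\<lambda>x. u x - v x) \<in> L2_space \<Omega>"
  using L2_space_add[OF assms(1) L2_space_minus[OF assms(2)]] by simp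

lemma L2_space_sum [simp]:
  "(\<And>b. b \<in> B \<Longrightarrow> u b \<in> L2_space \<Omega>) \<Longrightarrow> (\<lambda>x. \<Sum>b\<in>B. u b x) \<in> L2_space \<Omega>"
  by (induction B rule: infinite_finite_induct) auto

lemma l2_inner_commute: "l2_inner \<Omega> u v = l2_inner \<Omega> v u"
  by (simp add: l2_inner_def inner_commute)

lemma l2_inner_zero [simp]: "l2_inner \<Omega> (\<lambda>x. 0) v = 0" "l2_inner \<Omega> v (\<lambda>x. 0) = 0"
  by (simp_all add: l2_inner_def)

lemma l2_inner_add_left [simp]:
  assumes "u \<in> L2_space \<Omega>" "v \<in> L2_space \<Omega>" "w \<in> L2_space \<Omega>"
  shows "l2_inner \<Omega> (\<lambda>x. u x + v x) w = l2_inner \<Omega> u w + l2_inner \<Omega> v w"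
  using assms by (simp add: l2_inner_def inner_add_left L2_space_inner_integrable)

lemma l2_inner_diff_left [simp]:
  assumes "u \<in> L2_space \<Omega>" "v \<in> L2_space \<Omega>" "w \<in> L2_space \<Omega>"
  shows "l2_inner \<Omega> (\<lambda>x. u x - v x) w = l2_inner \<Omega> u w - l2_inner \<Omega> v w"
  using assms by (simp add: l2_inner_def inner_diff_left L2_space_inner_integrable)

lemma l2_inner_scaleR_left [simp]: "l2_inner \<Omega> (\<lambda>x. a *\<^sub>R u x) w = a * l2_inner \<Omega> u w"
  by (simp add: l2_inner_def)

lemma l2_inner_add_right [simp]:
  assumes "u \<in> L2_space \<Omega>" "v \<in> L2_space \<Omega>" "w \<in> L2_space \<Omega>"
  shows "l2_inner \<Omega> w (\<lambda>x. u x + v x) = l2_inner \<Omega> w u + l2_inner \<Omega> w v"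
  using assms by (simp add: l2_inner_commute[of _ w])

lemma l2_inner_diff_right [simp]:
  assumes "u \<in> L2_space \<Omega>" "v \<in> L2_space \<Omega>" "w \<in> L2_space \<Omega>"
  shows "l2_inner \<Omega> w (\<lambda>x. u x - v x) = l2_inner \<Omega> w u - l2_inner \<Omega> w v"
  using assms by (simp add: l2_inner_commute[of _ w])

lemma l2_inner_scaleR_right [simp]: "l2_inner \<Omega> w (\<lambda>x. a *\<^sub>R u x) = a * l2_inner \<Omega> w u"
  by (simp add: l2_inner_commute[of _ w])

lemma l2_inner_sum_left:
  assumes "\<And>b. b \<in> B \<Longrightarrow> u b \<in> L2_space \<Omega>" "w \<in> L2_space \<Omega>"
  shows "l2_inner \<Omega> (\<lambda>x. \<Sum>b\<in>B. u b x) w = (\<Sum>b\<in>B. l2_inner \<Omega> (u b) w)"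
  using assms by (induction B rule: infinite_finite_induct) auto

lemma l2_inner_nonneg [simp]: "0 \<le> l2_inner \<Omega> u u"
  by (simp add: l2_inner_def)

lemma l2_norm_nonneg [simp]: "0 \<le> l2_norm \<Omega> u"
  by (simp add: l2_norm_def)

lemma l2_norm_power2: "(l2_norm \<Omega> u)\<^sup>2 = l2_inner \<Omega> u u"
  by (simp add: l2_norm_def)

lemma l2_norm_scaleR: "l2_norm \<Omega> (\<lambda>x. a *\<^sub>R u x) = \<bar>a\<bar> * l2_norm \<Omega> u"
  by (simp add: l2_norm_def real_sqrt_mult flip: power2_eq_square mult.assoc)

lemma l2_norm_minus [simp]: "l2_norm \<Omega> (\<lambda>x. - u x) = l2_norm \<Omega> u"
  using l2_norm_scaleR[of \<Omega> "-1" u] by simp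

lemma l2_norm_zero [simp]: "l2_norm \<Omega> (\<lambda>x. 0) = 0"
  by (simp add: l2_norm_def)

lemma l2_Cauchy_Schwarz:
  assumes u: "u \<in> L2_space \<Omega>" and v: "v \<in> L2_space \<Omega>"
  shows "\<bar>l2_inner \<Omega> u v\<bar> \<le> l2_norm \<Omega> u * l2_norm \<Omega> v"
proof -
  have q: "0 \<le> l2_inner \<Omega> u u + 2 * t * l2_inner \<Omega> u v + t\<^sup>2 * l2_inner \<Omega> v v" for t
  proof -
    have "0 \<le> l2_inner \<Omega> (\<lambda>x. u x + t *\<^sub>R v x) (\<lambda>x. u x + t *\<^sub>R v x)" by simp
    also have "\<dots> = l2_inner \<Omega> u u + 2 * t * l2_inner \<Omega> u v + t\<^sup>2 * l2_inner \<Omega> v v"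
      using u v by (simp add: l2_inner_commute[of _ v u] power2_eq_square algebra_simps)
    finally show ?thesis .
  qed
  have "(l2_inner \<Omega> u v)\<^sup>2 \<le> l2_inner \<Omega> u u * l2_inner \<Omega> v v"
  proof (cases "l2_inner \<Omega> v v = 0")
    case True
    have "l2_inner \<Omega> u v = 0"
    proof (rule ccontr)
      assume n: "l2_inner \<Omega> u v \<noteq> 0"
      show False
        using q[of "- (l2_inner \<Omega> u u + 1) / (2 * l2_inner \<Omega> u v)"] n True by (simp add: field_simps)
    qed
    then show ?thesis using True by simp
  next
    case False
    then have p: "0 < l2_inner \<Omega> v v"
      using l2_inner_nonneg[of \<Omega> v] by linarith
    show ?thesis
      using q[of "- l2_inner \<Omega> u v / l2_inner \<Omega> v v"] p
      by (simp add: power2_eq_square field_simps)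
  qed
  then have "sqrt ((l2_inner \<Omega> u v)\<^sup>2) \<le> sqrt (l2_inner \<Omega> u u * l2_inner \<Omega> v v)"
    by (rule real_sqrt_le_mono)
  then show ?thesis
    by (simp add: l2_norm_def real_sqrt_mult)
qed

lemma l2_norm_triangle:
  assumes u: "u \<in> L2_space \<Omega>" and v: "v \<in> L2_space \<Omega>"
  shows "l2_norm \<Omega> (\<lambda>x. u x + v x) \<le> l2_norm \<Omega> u + l2_norm \<Omega> v"
proof (rule power2_le_imp_le)
  have "(l2_norm \<Omega> (\<lambda>x. u x + v x))\<^sup>2 = (l2_norm \<Omega> u)\<^sup>2 + 2 * l2_inner \<Omega> u v + (l2_norm \<Omega> v)\<^sup>2"
    using u v by (simp add: l2_norm_power2 l2_inner_commute[of _ v u])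
  then show "(l2_norm \<Omega> (\<lambda>x. u x + v x))\<^sup>2 \<le> (l2_norm \<Omega> u + l2_norm \<Omega> v)\<^sup>2"
    using l2_Cauchy_Schwarz[OF u v] by (simp add: power2_sum)
qed simp

lemma l2_norm_triangle_diff:
  assumes "u \<in> L2_space \<Omega>" "v \<in> L2_space \<Omega>"
  shows "l2_norm \<Omega> (\<lambda>x. u x - v x) \<le> l2_norm \<Omega> u + l2_norm \<Omega> v"
  using l2_norm_triangle[OF assms(1) L2_space_minus[OF assms(2)]] by simp

lemma l2_norm_lincomb_le:
  assumes "u \<in> L2_space \<Omega>" "v \<in> L2_space \<Omega>"
  shows "l2_norm \<Omega> (\<lambda>x. a *\<^sub>R u x + b *\<^sub>R v x) \<le> \<bar>a\<bar> * l2_norm \<Omega> u + \<bar>b\<bar> * l2_norm \<Omega> v"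
  using l2_norm_triangle[OF L2_space_scaleR[OF assms(1), of a] L2_space_scaleR[OF assms(2), of b]]
  by (simp add: l2_norm_scaleR)

text \<open>Lebesgue measure is complete, so a function that agrees almost everywhere with a measurable one
  is measurable. This serves in particular the right-hand side of the equation, which is known only
  through its almost everywhere identity with the exact solution.\<close>

lemma borel_measurable_lebesgue_on_AE:
  fixes f g :: "'a::euclidean_space \<Rightarrow> 'b::euclidean_space"
  assumes S: "S \<in> sets lebesgue" and f: "f \<in> borel_measurable (lebesgue_on S)"
    and ae: "AE x in lebesgue_on S. f x = g x"
  shows "g \<in> borel_measurable (lebesgue_on S)"
proof -
  have "(\<lambda>x. if x \<in> S then f x else 0) \<in> borel_measurable lebesgue"
    using f S by (simp add: borel_measurable_if)
  moreover have "AE x in lebesgue. (if x \<in> S then f x else 0) = (if x \<in> S then g x else 0)"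
    using ae S by (auto simp: AE_restrict_space_iff elim!: eventually_mono)
  ultimately have "(\<lambda>x. if x \<in> S then g x else 0) \<in> borel_measurable lebesgue"
    by (rule borel_measurable_AE)
  then show ?thesis
    using S by (simp add: borel_measurable_if)
qed

lemma L2_space_cong_AE:
  assumes S: "\<Omega> \<in> sets lebesgue" and u: "u \<in> L2_space \<Omega>" and ae: "AE x in lebesgue_on \<Omega>. u x = v x"
  shows "v \<in> L2_space \<Omega>"
proof -
  have v: "v \<in> borel_measurable (lebesgue_on \<Omega>)"
    using borel_measurable_lebesgue_on_AE[OF S _ ae] u by (simp add: L2_space_def)
  have "integrable (lebesgue_on \<Omega>) (\<lambda>x. (norm (u x))\<^sup>2) = integrable (lebesgue_on \<Omega>) (\<lambda>x. (norm (v x))\<^sup>2)"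
    by (rule integrable_cong_AE) (use u v ae in \<open>auto simp: L2_space_def elim!: eventually_mono\<close>)
  then show ?thesis
    using u v by (simp add: L2_space_def)
qed

lemma l2_inner_cong_AE:
  assumes S: "\<Omega> \<in> sets lebesgue" and u: "u \<in> L2_space \<Omega>" and w: "w \<in> L2_space \<Omega>"
    and ae: "AE x in lebesgue_on \<Omega>. u x = v x"
  shows "l2_inner \<Omega> v w = l2_inner \<Omega> u w"
proof -
  have v: "v \<in> L2_space \<Omega>" by (rule L2_space_cong_AE[OF S u ae])
  show ?thesis
    unfolding l2_inner_def
    by (rule integral_cong_AE)
      (use L2_space_inner_integrable[OF v w] L2_space_inner_integrable[OF u w] ae in
        \<open>auto elim!: eventually_mono\<close>)
qed

lemma l2_norm_cong_AE:
  assumes S: "\<Omega> \<in> sets lebesgue" and u: "u \<in> L2_space \<Omega>"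
    and ae: "AE x in lebesgue_on \<Omega>. u x = v x"
  shows "l2_norm \<Omega> v = l2_norm \<Omega> u"
proof -
  have v: "v \<in> L2_space \<Omega>" by (rule L2_space_cong_AE[OF S u ae])
  show ?thesis
    unfolding l2_norm_def
    by (simp add: l2_inner_cong_AE[OF S u v ae] l2_inner_commute[of \<Omega> u v] l2_inner_cong_AE[OF S u u ae])
qed

text \<open>A dense set of test fields determines the norm. This replaces pointwise arguments for weak
  derivatives that are known only after testing with \<open>V\<close>.\<close>

lemma l2_norm_le_dense:
  assumes dense: "dense_in_L2 \<Omega> V" and VL: "V \<subseteq> L2_space \<Omega>" and u: "u \<in> L2_space \<Omega>" and c: "0 \<le> c"
    and le: "\<And>v. v \<in> V \<Longrightarrow> l2_inner \<Omega> u v \<le> c * l2_norm \<Omega> v"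
  shows "l2_norm \<Omega> u \<le> c"
proof -
  let ?n = "l2_norm \<Omega> u"
  have "?n * ?n \<le> c * ?n"
  proof (rule field_le_epsilon)
    fix e :: real assume e: "0 < e"
    \<comment> \<open>the test field within \<open>\<epsilon>\<close> of \<open>u\<close> costs at most \<open>(?n + c) * \<epsilon>\<close>\<close>
    define \<epsilon> where "\<epsilon> = e / (?n + c + 1)"
    have \<epsilon>: "0 < \<epsilon>" using e c by (simp add: \<epsilon>_def add_nonneg_pos)
    obtain v where v: "v \<in> V" and close: "l2_norm \<Omega> (\<lambda>x. u x - v x) < \<epsilon>"
      using dense u \<epsilon> unfolding dense_in_L2_def by blast
    have vL: "v \<in> L2_space \<Omega>" using v VL by blast
    have "l2_norm \<Omega> (\<lambda>x. u x - (u x - v x)) \<le> ?n + l2_norm \<Omega> (\<lambda>x. u x - v x)"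
      using u vL by (intro l2_norm_triangle_diff) auto
    then have nv: "l2_norm \<Omega> v \<le> ?n + \<epsilon>" using close by simp
    have "?n * ?n = l2_inner \<Omega> u u"
      using l2_norm_power2[of \<Omega> u] by (simp add: power2_eq_square)
    also have "\<dots> = l2_inner \<Omega> u (\<lambda>x. u x - v x) + l2_inner \<Omega> u v"
      using u vL by simp
    also have "\<dots> \<le> ?n * l2_norm \<Omega> (\<lambda>x. u x - v x) + c * l2_norm \<Omega> v"
      using l2_Cauchy_Schwarz[OF u L2_space_diff[OF u vL]] le[OF v] by linarith
    also have "\<dots> \<le> ?n * \<epsilon> + c * (?n + \<epsilon>)"
      using close nv c by (intro add_mono mult_left_mono) auto
    also have "\<dots> = c * ?n + (?n + c) * \<epsilon>" by (simp add: algebra_simps)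
    also have "\<dots> \<le> c * ?n + (?n + c + 1) * \<epsilon>" using \<epsilon> by (simp add: mult_right_mono)
    also have "(?n + c + 1) * \<epsilon> = e" using c by (simp add: \<epsilon>_def add_nonneg_pos less_imp_neq[symmetric])
    finally show "?n * ?n \<le> c * ?n + e" .
  qed
  then show ?thesis
    using c l2_norm_nonneg[of \<Omega> u] by (metis mult_le_cancel_right order_antisym_conv not_le)
qed

section \<open>Orthogonal projection onto finite element spaces\<close>

text \<open>Gram--Schmidt on a finite generating set. A new generator is first made orthogonal to the old
  ones; if nothing but a null field is left, it adds no condition.\<close>

lemma ex_l2_projection_span:
  assumes "finite B" "B \<subseteq> L2_space \<Omega>" "u \<in> L2_space \<Omega>"
  shows "\<exists>c. \<forall>b\<in>B. l2_inner \<Omega> (\<lambda>x. u x - (\<Sum>b\<in>B. c b *\<^sub>R b x)) b = 0"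
  using assms
proof (induction B arbitrary: u rule: finite_induct)
  case empty
  then show ?case by simp
next
  case (insert a B)
  have BL: "B \<subseteq> L2_space \<Omega>" and a: "a \<in> L2_space \<Omega>" using insert by auto
  obtain c where c: "\<forall>b\<in>B. l2_inner \<Omega> (\<lambda>x. u x - (\<Sum>b\<in>B. c b *\<^sub>R b x)) b = 0"
    using insert.IH[OF BL insert.prems(2)] by blast
  obtain d where d: "\<forall>b\<in>B. l2_inner \<Omega> (\<lambda>x. a x - (\<Sum>b\<in>B. d b *\<^sub>R b x)) b = 0"
    using insert.IH[OF BL a] by blast
  define p where "p = (\<lambda>x. \<Sum>b\<in>B. c b *\<^sub>R b x)"
  define q where "q = (\<lambda>x. \<Sum>b\<in>B. d b *\<^sub>R b x)"
  have pL: "p \<in> L2_space \<Omega>" and qL: "q \<in> L2_space \<Omega>"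
    using BL by (auto simp: p_def q_def subset_iff)
  define a' where "a' = (\<lambda>x. a x - q x)"
  have a'L: "a' \<in> L2_space \<Omega>" using a qL by (simp add: a'_def)
  have inner_a': "l2_inner \<Omega> r a' = l2_inner \<Omega> r a - l2_inner \<Omega> r q" if "r \<in> L2_space \<Omega>" for r
    using that a qL by (simp add: a'_def)
  \<comment> \<open>division by zero gives \<open>m = 0\<close> when \<open>a'\<close> is null\<close>
  define m where "m = l2_inner \<Omega> (\<lambda>x. u x - p x) a' / l2_inner \<Omega> a' a'"
  have uL: "u \<in> L2_space \<Omega>" by fact
  have orth_span: "l2_inner \<Omega> r q = 0" if "\<forall>b\<in>B. l2_inner \<Omega> r b = 0" "r \<in> L2_space \<Omega>" for r
    unfolding q_def using that BL
    by (subst l2_inner_commute, subst l2_inner_sum_left) (auto simp: subset_iff l2_inner_commute[of _ _ r])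
  have cp: "\<forall>b\<in>B. l2_inner \<Omega> (\<lambda>x. u x - p x) b = 0" using c by (simp add: p_def)
  have dq: "\<forall>b\<in>B. l2_inner \<Omega> a' b = 0" using d by (simp add: q_def a'_def)
  let ?e = "\<lambda>b. if b = a then m else c b - m * d b"
  have eq: "(\<Sum>b\<in>insert a B. ?e b *\<^sub>R b x) = p x + m *\<^sub>R a' x" for x
  proof -
    have "(\<Sum>b\<in>B. ?e b *\<^sub>R b x) = (\<Sum>b\<in>B. c b *\<^sub>R b x - m *\<^sub>R (d b *\<^sub>R b x))"
      using insert.hyps by (intro sum.cong) (auto simp: algebra_simps)
    then show ?thesis
      using insert.hyps by (simp add: p_def q_def a'_def sum_subtractf scaleR_sum_right algebra_simps)
  qed
  have onB: "l2_inner \<Omega> (\<lambda>x. u x - (p x + m *\<^sub>R a' x)) b = 0" if "b \<in> B" for b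
  proof -
    have bL: "b \<in> L2_space \<Omega>" using that BL by blast
    have "l2_inner \<Omega> u b - l2_inner \<Omega> p b = 0"
      using cp that uL pL bL by auto
    then show ?thesis using dq that uL pL bL a'L by simp
  qed
  have "l2_inner \<Omega> (\<lambda>x. u x - (p x + m *\<^sub>R a' x)) a' = 0"
  proof (cases "l2_inner \<Omega> a' a' = 0")
    case True
    then have "l2_norm \<Omega> a' = 0" by (simp add: l2_norm_def)
    then have "\<bar>l2_inner \<Omega> (\<lambda>x. u x - (p x + m *\<^sub>R a' x)) a'\<bar> \<le> 0"
      using l2_Cauchy_Schwarz[of "\<lambda>x. u x - (p x + m *\<^sub>R a' x)" \<Omega> a'] uL pL a'L by simp
    then show ?thesis by simp
  next
    case False
    then have "m * l2_inner \<Omega> a' a' = l2_inner \<Omega> u a' - l2_inner \<Omega> p a'"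
      using uL pL a'L by (simp add: m_def)
    then show ?thesis using uL pL a'L by simp
  qed
  moreover have "l2_inner \<Omega> (\<lambda>x. u x - (p x + m *\<^sub>R a' x)) q = 0"
    by (rule orth_span) (use onB uL pL a'L in auto)
  moreover have "l2_inner \<Omega> (\<lambda>x. u x - (p x + m *\<^sub>R a' x)) a' =
      l2_inner \<Omega> (\<lambda>x. u x - (p x + m *\<^sub>R a' x)) a - l2_inner \<Omega> (\<lambda>x. u x - (p x + m *\<^sub>R a' x)) q"
    by (rule inner_a') (use uL pL a'L in simp)
  ultimately have "l2_inner \<Omega> (\<lambda>x. u x - (p x + m *\<^sub>R a' x)) a = 0" by linarith
  then show ?case
    using onB by (intro exI[of _ ?e]) (simp only: eq, auto)
qed

locale fe_subspace =
  fixes \<Omega> :: "(real^'d) set" and V Vh :: "('d::finite, 'm::finite) vfield set" and M k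
  assumes VL: "V \<subseteq> L2_space \<Omega>" and fe: "fe_space V M k Vh"
begin

lemma Vh_subset: "Vh \<subseteq> V" using fe by (simp add: fe_space_def)

lemma Vh_L2: "w \<in> Vh \<Longrightarrow> w \<in> L2_space \<Omega>" using Vh_subset VL by blast

lemma Vh_lincomb:
  assumes "u \<in> Vh" "v \<in> Vh"
  shows "(\<lambda>x. a *\<^sub>R u x + b *\<^sub>R v x) \<in> Vh"
proof -
  obtain B where Vh: "Vh = {v. \<exists>c. v = (\<lambda>x. \<Sum>b\<in>B. c b *\<^sub>R b x)}"
    using fe by (auto simp: fe_space_def)
  obtain c d where cd: "u = (\<lambda>x. \<Sum>b\<in>B. c b *\<^sub>R b x)" "v = (\<lambda>x. \<Sum>b\<in>B. d b *\<^sub>R b x)"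
    using assms by (auto simp: Vh)
  have "(\<lambda>x. a *\<^sub>R u x + b *\<^sub>R v x) = (\<lambda>x. \<Sum>i\<in>B. (a * c i + b * d i) *\<^sub>R i x)"
    by (simp add: cd scaleR_sum_right sum.distrib algebra_simps)
  then show ?thesis unfolding Vh by (intro CollectI exI[of _ "\<lambda>i. a * c i + b * d i"])
qed

lemma l2_projection:
  assumes u: "u \<in> L2_space \<Omega>"
  shows l2_projection_in: "l2_projection \<Omega> Vh u \<in> Vh"
    and l2_projection_orth: "w \<in> Vh \<Longrightarrow> l2_inner \<Omega> (\<lambda>x. u x - l2_projection \<Omega> Vh u x) w = 0"
proof -
  obtain B where B: "finite B" and Vh: "Vh = {v. \<exists>c. v = (\<lambda>x. \<Sum>b\<in>B. c b *\<^sub>R b x)}"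
    using fe by (auto simp: fe_space_def)
  have BL: "b \<in> L2_space \<Omega>" if "b \<in> B" for b
  proof -
    have "b = (\<lambda>x. \<Sum>i\<in>B. (if i = b then 1 else 0) *\<^sub>R i x)"
      using that B by (simp add: if_distrib[of "\<lambda>a. a *\<^sub>R _"] cong: if_cong)
    then have "b \<in> Vh"
      unfolding Vh by (intro CollectI exI[of _ "\<lambda>i. if i = b then 1 else 0"])
    then show ?thesis by (rule Vh_L2)
  qed
  obtain c where c: "\<forall>b\<in>B. l2_inner \<Omega> (\<lambda>x. u x - (\<Sum>b\<in>B. c b *\<^sub>R b x)) b = 0"
    using ex_l2_projection_span[OF B _ u] BL by blast
  define p where "p = (\<lambda>x. \<Sum>b\<in>B. c b *\<^sub>R b x)"
  have p: "p \<in> Vh" unfolding Vh p_def by blast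
  have "l2_inner \<Omega> (\<lambda>x. u x - p x) w = 0" if w: "w \<in> Vh" for w
  proof -
    obtain d where d: "w = (\<lambda>x. \<Sum>b\<in>B. d b *\<^sub>R b x)" using w by (auto simp: Vh)
    have "l2_inner \<Omega> w (\<lambda>x. u x - p x) = (\<Sum>b\<in>B. l2_inner \<Omega> (\<lambda>x. d b *\<^sub>R b x) (\<lambda>x. u x - p x))"
      unfolding d using BL u Vh_L2[OF p] by (intro l2_inner_sum_left) auto
    also have "\<dots> = 0"
      by (intro sum.neutral) (use c in \<open>simp add: p_def l2_inner_commute[of _ _ "\<lambda>x. u x - (\<Sum>b\<in>B. c b *\<^sub>R b x)"]\<close>)
    finally show ?thesis by (simp add: l2_inner_commute)
  qed
  then have "\<exists>p. p \<in> Vh \<and> (\<forall>w\<in>Vh. l2_inner \<Omega> (\<lambda>x. u x - p x) w = 0)" using p by blast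
  from someI_ex[OF this]
  show "l2_projection \<Omega> Vh u \<in> Vh" "w \<in> Vh \<Longrightarrow> l2_inner \<Omega> (\<lambda>x. u x - l2_projection \<Omega> Vh u x) w = 0"
    unfolding l2_projection_def by auto
qed

text \<open>Moving the projection onto the test field makes it commute with weak time derivatives.\<close>

lemma l2_projection_selfadjoint:
  assumes u: "u \<in> L2_space \<Omega>" and w: "w \<in> L2_space \<Omega>"
  shows "l2_inner \<Omega> (\<lambda>x. u x - l2_projection \<Omega> Vh u x) w = l2_inner \<Omega> u (\<lambda>x. w x - l2_projection \<Omega> Vh w x)"
proof -
  let ?p = "l2_projection \<Omega> Vh u" and ?q = "l2_projection \<Omega> Vh w"
  have p: "?p \<in> Vh" "?p \<in> L2_space \<Omega>" and q: "?q \<in> Vh" "?q \<in> L2_space \<Omega>"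
    using l2_projection_in[OF u] l2_projection_in[OF w] Vh_L2 by auto
  have "l2_inner \<Omega> (\<lambda>x. u x - ?p x) ?q = 0" "l2_inner \<Omega> (\<lambda>x. w x - ?q x) ?p = 0"
    using l2_projection_orth[OF u q(1)] l2_projection_orth[OF w p(1)] by auto
  then show ?thesis
    using u w p q by (simp add: l2_inner_commute[of \<Omega> _ ?p])
qed

end

section \<open>Energies of scalar functions of time\<close>

text \<open>If one side is not measurable then neither is the other, and both integrals have the default
  value 0.\<close>

lemma integral_cong_AE_lebesgue_on:
  fixes f g :: "'a::euclidean_space \<Rightarrow> real"
  assumes S: "S \<in> sets lebesgue" and ae: "AE x in lebesgue_on S. f x = g x"
  shows "integral\<^sup>L (lebesgue_on S) f = integral\<^sup>L (lebesgue_on S) g"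
proof (cases "f \<in> borel_measurable (lebesgue_on S)")
  case True
  then show ?thesis
    using borel_measurable_lebesgue_on_AE[OF S True ae] ae by (intro integral_cong_AE) auto
next
  case False
  then have "g \<notin> borel_measurable (lebesgue_on S)"
    using borel_measurable_lebesgue_on_AE[OF S _ AE_symmetric[OF ae]] by blast
  then have "\<not> integrable (lebesgue_on S) f" "\<not> integrable (lebesgue_on S) g"
    using False borel_measurable_integrable by blast+
  then show ?thesis by (simp add: not_integrable_integral_eq)
qed

text \<open>The time norms of the problem live on the open interval \<open>(0, T)\<close>, whereas the weak derivatives are
  integrated over closed subintervals. The closed interval is used throughout, so that intervals can be
  concatenated; the end points form a null set.\<close>

definition sq_integrable :: "real \<Rightarrow> (real \<Rightarrow> real) \<Rightarrow> bool" where
  "sq_integrable T s \<longleftrightarrow> (\<forall>t. 0 \<le> s t) \<and> integrable (lebesgue_on {0..T}) (\<lambda>t. (s t)\<^sup>2)"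

definition energy :: "(real \<Rightarrow> real) \<Rightarrow> real \<Rightarrow> real \<Rightarrow> real" where
  "energy s a b = (\<integral>t. (s t)\<^sup>2 \<partial>lebesgue_on {a..b})"

lemma AE_lebesgue_on_mono:
  fixes S :: "'a::euclidean_space set"
  assumes "AE t in lebesgue_on S. P t" "S' \<subseteq> S" "S \<in> sets lebesgue" "S' \<in> sets lebesgue"
  shows "AE t in lebesgue_on S'. P t"
  using assms by (auto simp: AE_restrict_space_iff elim!: eventually_mono)

lemma AE_lebesgue_on_open_interval_iff:
  "(AE t in lebesgue_on {0<..<T::real}. P t) \<longleftrightarrow> (AE t in lebesgue_on {0..T}. P t)"
proof
  assume l: "AE t in lebesgue_on {0<..<T::real}. P t"
  have "AE t in lebesgue. t \<notin> {0, T}"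
    by (rule AE_I'[of "{0, T}"]) auto
  with l show "AE t in lebesgue_on {0..T}. P t"
    by (auto simp: AE_restrict_space_iff elim!: eventually_elim2)
next
  assume "AE t in lebesgue_on {0..T}. P t"
  then show "AE t in lebesgue_on {0<..<T}. P t" by (rule AE_lebesgue_on_mono) auto
qed

lemma has_bochner_integral_open_interval_iff:
  fixes f :: "real \<Rightarrow> real"
  shows "has_bochner_integral (lebesgue_on {0<..<T}) f I \<longleftrightarrow> has_bochner_integral (lebesgue_on {0..T}) f I"
proof -
  have ae: "AE t in lebesgue. indicator {0<..<T} t *\<^sub>R f t = indicator {0..T} t *\<^sub>R f t"
    by (rule AE_I'[of "{0, T}"]) (auto simp: indicator_def)
  have m: "(\<lambda>t. indicator {0<..<T} t *\<^sub>R f t) \<in> borel_measurable lebesgue \<longleftrightarrow>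
      (\<lambda>t. indicator {0..T} t *\<^sub>R f t) \<in> borel_measurable lebesgue"
    using borel_measurable_AE[OF _ ae] borel_measurable_AE[OF _ AE_symmetric[OF ae]] by blast
  show ?thesis
    using m has_bochner_integral_cong_AE[OF _ _ ae]
    by (auto simp: has_bochner_integral_restrict_space dest: borel_measurable_has_bochner_integral)
qed

lemma sq_integrableI:
  assumes "\<And>t. 0 \<le> s t" "integrable (lebesgue_on {0<..<T}) (\<lambda>t. (s t)\<^sup>2)"
  shows "sq_integrable T s"
  using assms unfolding sq_integrable_def
  by (auto simp: integrable.simps has_bochner_integral_open_interval_iff)

lemma L2_time_norm_power2:
  assumes "sq_integrable T (\<lambda>t. N (f t))"
  shows "(L2_time_norm T N f)\<^sup>2 = energy (\<lambda>t. N (f t)) 0 T"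
proof -
  have "has_bochner_integral (lebesgue_on {0..T}) (\<lambda>t. (N (f t))\<^sup>2) (energy (\<lambda>t. N (f t)) 0 T)"
    using assms by (simp add: sq_integrable_def energy_def has_bochner_integral_integrable)
  then have "(\<integral>t. (N (f t))\<^sup>2 \<partial>lebesgue_on {0<..<T}) = energy (\<lambda>t. N (f t)) 0 T"
    using has_bochner_integral_open_interval_iff has_bochner_integral_integral_eq by blast
  then show ?thesis by (simp add: L2_time_norm_def energy_def)
qed

lemma energy_nonneg [simp]: "0 \<le> energy s a b"
  by (simp add: energy_def)

lemma energy_scale: "energy (\<lambda>t. c * s t) a b = c\<^sup>2 * energy s a b"
  by (simp add: energy_def power_mult_distrib)

lemma sq_integrable_scale: "sq_integrable T s \<Longrightarrow> 0 \<le> c \<Longrightarrow> sq_integrable T (\<lambda>t. c * s t)"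
  by (simp add: sq_integrable_def power_mult_distrib)

lemma energy_const: "a \<le> b \<Longrightarrow> energy (\<lambda>t. c) a b = c\<^sup>2 * (b - a)"
  by (simp add: energy_def measure_restrict_space mult.commute)

lemma sq_integrable_const: "0 \<le> c \<Longrightarrow> sq_integrable T (\<lambda>t. c)"
  by (simp add: sq_integrable_def integrable_restrict_space)

lemma energy_combine:
  assumes "sq_integrable T s" "0 \<le> a" "a \<le> c" "c \<le> b" "b \<le> T"
  shows "energy s a b = energy s a c + energy s c b"
  unfolding energy_def
  by (rule integral_combine) (use assms in \<open>auto simp: sq_integrable_def intro: Equivalence_Lebesgue_Henstock_Integration.integrable_subinterval\<close>)

text \<open>Cauchy--Schwarz against the constant 1, obtained from the nonnegative square of \<open>s - l\<close> with \<open>l\<close>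
  the mean value of \<open>s\<close>.\<close>

lemma integral_le_sqrt_energy:
  assumes s: "sq_integrable T s" and ab: "0 \<le> a" "a \<le> b" "b \<le> T"
  shows "integrable (lebesgue_on {a..b}) s"
    and "(\<integral>t. s t \<partial>lebesgue_on {a..b}) \<le> sqrt ((b - a) * energy s a b)"
proof -
  have i2: "integrable (lebesgue_on {a..b}) (\<lambda>t. (s t)\<^sup>2)"
    using s ab by (auto simp: sq_integrable_def intro: Equivalence_Lebesgue_Henstock_Integration.integrable_subinterval)
  have c: "integrable (lebesgue_on {a..b}) (\<lambda>t. c)" for c :: real
    by (simp add: integrable_restrict_space)
  have s0: "0 \<le> s t" for t using s by (simp add: sq_integrable_def)
  have m: "s \<in> borel_measurable (lebesgue_on {a..b})"
  proof -
    have "(\<lambda>t. sqrt ((s t)\<^sup>2)) \<in> borel_measurable (lebesgue_on {a..b})"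
      using borel_measurable_integrable[OF i2] by measurable
    then show ?thesis using s0 by simp
  qed
  show i1: "integrable (lebesgue_on {a..b}) s"
  proof (rule Bochner_Integration.integrable_bound)
    show "integrable (lebesgue_on {a..b}) (\<lambda>t. 1 + (s t)\<^sup>2)" using i2 c by simp
    show "AE t in lebesgue_on {a..b}. norm (s t) \<le> norm (1 + (s t)\<^sup>2)"
    proof (rule AE_I2)
      fix t
      have "0 \<le> (s t - 1/2)\<^sup>2" by simp
      then show "norm (s t) \<le> norm (1 + (s t)\<^sup>2)" using s0[of t] by (simp add: power2_eq_square algebra_simps)
    qed
  qed (rule m)
  define I where "I = (\<integral>t. s t \<partial>lebesgue_on {a..b})"
  have q: "0 \<le> energy s a b - 2 * l * I + l\<^sup>2 * (b - a)" for l
  proof -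
    have "0 \<le> (\<integral>t. (s t - l)\<^sup>2 \<partial>lebesgue_on {a..b})" by simp
    also have "(\<integral>t. (s t - l)\<^sup>2 \<partial>lebesgue_on {a..b}) = (\<integral>t. (s t)\<^sup>2 - 2 * l * s t + l\<^sup>2 \<partial>lebesgue_on {a..b})"
      by (simp add: power2_eq_square algebra_simps)
    also have "\<dots> = energy s a b - 2 * l * I + l\<^sup>2 * (b - a)"
      using i1 i2 c ab by (simp add: energy_def I_def measure_restrict_space mult.commute)
    finally show ?thesis .
  qed
  show "(\<integral>t. s t \<partial>lebesgue_on {a..b}) \<le> sqrt ((b - a) * energy s a b)"
  proof (cases "a = b")
    case True
    then show ?thesis
      using has_bochner_integral_integral_eq[OF has_bochner_integral_null[of "{b}" s]] by simp
  next
    case False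
    define l where "l = I / (b - a)"
    have m: "l * (b - a) = I" using False by (simp add: l_def)
    have "0 \<le> energy s a b - 2 * l * I + l * (l * (b - a))"
      using q[of l] by (simp add: power2_eq_square mult.assoc)
    then have "l * I \<le> energy s a b" unfolding m by (simp add: mult.commute)
    then have le: "(l * I) * (b - a) \<le> energy s a b * (b - a)"
      using ab by (intro mult_right_mono) auto
    have "I\<^sup>2 = (l * (b - a)) * I" unfolding m by (simp only: power2_eq_square)
    also have "\<dots> = (l * I) * (b - a)" by (simp only: mult_ac)
    also note le
    finally have "I\<^sup>2 \<le> (b - a) * energy s a b"
      by (simp only: mult.commute)
    then show ?thesis unfolding I_def[symmetric] by (rule real_le_rsqrt)
  qed
qed

text \<open>Otherwise the square would exceed its mean almost everywhere. The property \<open>P\<close> is meant to select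
  times at which almost everywhere information is valid.\<close>

lemma ex_below_mean:
  assumes s: "sq_integrable T s" and ab: "0 \<le> a" "a < b" "b \<le> T"
    and P: "AE t in lebesgue_on {0..T}. P t"
  shows "\<exists>t\<in>{a..b}. P t \<and> (b - a) * (s t)\<^sup>2 \<le> energy s a b"
proof (rule ccontr)
  assume n: "\<not> ?thesis"
  have i2: "integrable (lebesgue_on {a..b}) (\<lambda>t. (s t)\<^sup>2)"
    using s ab by (auto simp: sq_integrable_def intro: Equivalence_Lebesgue_Henstock_Integration.integrable_subinterval)
  have c: "integrable (lebesgue_on {a..b}) (\<lambda>t. c)" for c :: real
    by (simp add: integrable_restrict_space)
  define m where "m = energy s a b / (b - a)"
  have "AE t in lebesgue_on {a..b}. P t"
    by (rule AE_lebesgue_on_mono[OF P]) (use ab in auto)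
  then have gt: "AE t in lebesgue_on {a..b}. m < (s t)\<^sup>2"
    using AE_space by eventually_elim (use n ab in \<open>auto simp: m_def field_simps not_le\<close>)
  interpret finite_measure "lebesgue_on {a..b}"
    by (rule finite_measure_lebesgue_on) simp
  have em: "emeasure (lebesgue_on {a..b}) (space (lebesgue_on {a..b})) = ennreal (b - a)"
    using ab by (simp add: emeasure_restrict_space)
  have "(\<integral>t. m \<partial>lebesgue_on {a..b}) < (\<integral>t. (s t)\<^sup>2 \<partial>lebesgue_on {a..b})"
    by (rule integral_less_AE_space) (use i2 c gt em ab in auto)
  moreover have "(\<integral>t. m \<partial>lebesgue_on {a..b}) = m * (b - a)"
    using ab by (simp add: measure_restrict_space mult.commute)
  ultimately show False using ab by (simp add: m_def energy_def)
qed

lemma sum_energy: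
  assumes s: "sq_integrable T s" and \<tau>: "0 \<le> \<tau>" and N: "real N * \<tau> \<le> T"
  shows "(\<Sum>n=1..N. energy s (real (n - 1) * \<tau>) (real n * \<tau>)) \<le> energy s 0 T"
proof -
  have "(\<Sum>n=1..m. energy s (real (n - 1) * \<tau>) (real n * \<tau>)) = energy s 0 (real m * \<tau>)" if "m \<le> N" for m
    using that
  proof (induction m)
    case 0
    show ?case
      using has_bochner_integral_integral_eq[OF has_bochner_integral_null[of "{0::real}"]]
      by (simp add: energy_def)
  next
    case (Suc m)
    have "real (Suc m) * \<tau> \<le> real N * \<tau>" using Suc.prems \<tau> by (intro mult_right_mono) auto
    then have "energy s 0 (real (Suc m) * \<tau>) = energy s 0 (real m * \<tau>) + energy s (real m * \<tau>) (real (Suc m) * \<tau>)"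
      using \<tau> N by (intro energy_combine[OF s]) (auto intro: mult_right_mono)
    then show ?case using Suc by simp
  qed
  moreover have "energy s 0 T = energy s 0 (real N * \<tau>) + energy s (real N * \<tau>) T"
    using \<tau> N by (intro energy_combine[OF s]) auto
  ultimately show ?thesis by simp
qed

text \<open>The Cauchy--Schwarz inequality for the sum over the time steps produces the factor \<open>sqrt T\<close>.\<close>

lemma sum_sqrt_energy:
  assumes s: "sq_integrable T s" and \<tau>: "0 < \<tau>" and N: "real N * \<tau> \<le> T"
  shows "(\<Sum>n=1..N. sqrt (\<tau> * energy s (real (n - 1) * \<tau>) (real n * \<tau>))) \<le> sqrt T * sqrt (energy s 0 T)"
proof -
  let ?E = "\<lambda>n. energy s (real (n - 1) * \<tau>) (real n * \<tau>)"
  have "(\<Sum>n=1..N. sqrt \<tau> * sqrt (?E n))\<^sup>2 \<le> (\<Sum>n=1..N. (sqrt \<tau>)\<^sup>2) * (\<Sum>n=1..N. (sqrt (?E n))\<^sup>2)"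
    by (rule Cauchy_Schwarz_ineq_sum)
  also have "\<dots> = (real N * \<tau>) * (\<Sum>n=1..N. ?E n)" using \<tau> by simp
  also have "\<dots> \<le> T * energy s 0 T"
    using sum_energy[OF s _ N] \<tau> N
    by (intro mult_mono) (auto intro: sum_nonneg order_trans[OF _ N])
  finally have "(\<Sum>n=1..N. sqrt \<tau> * sqrt (?E n)) \<le> sqrt (T * energy s 0 T)"
    by (rule real_le_rsqrt)
  then show ?thesis by (simp add: real_sqrt_mult)
qed

section \<open>Weakly differentiable paths of fields\<close>

text \<open>The set of test fields is a parameter: a skew-symmetric operator can be moved from the path onto the
  test field only if the latter lies in the domain of the operator.\<close>

definition weak_time_derivative ::
    "(real^'d) set \<Rightarrow> ('d::finite, 'm::finite) vfield set \<Rightarrow> real \<Rightarrow>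
     (real \<Rightarrow> ('d, 'm) vfield) \<Rightarrow> (real \<Rightarrow> ('d, 'm) vfield) \<Rightarrow> bool" where
  "weak_time_derivative \<Omega> V T p q \<longleftrightarrow>
     (\<forall>t\<in>{0..T}. p t \<in> L2_space \<Omega>) \<and>
     (\<forall>a b. 0 \<le> a \<and> a \<le> b \<and> b \<le> T \<longrightarrow> (\<forall>v\<in>V.
        l2_inner \<Omega> (p b) v - l2_inner \<Omega> (p a) v = (\<integral>t. l2_inner \<Omega> (q t) v \<partial>lebesgue_on {a..b})))"

text \<open>A scalar majorant of the norm replaces the field itself in all time integrals. The majorants that
  occur are multiples of Sobolev norms, the norm itself and constants.\<close>

definition dominated ::
    "(real^'d) set \<Rightarrow> real \<Rightarrow> (real \<Rightarrow> ('d::finite, 'm::finite) vfield) \<Rightarrow> (real \<Rightarrow> real) \<Rightarrow> bool" where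
  "dominated \<Omega> T q s \<longleftrightarrow> sq_integrable T s \<and>
     (AE t in lebesgue_on {0..T}. q t \<in> L2_space \<Omega> \<and> l2_norm \<Omega> (q t) \<le> s t)"

locale test_space =
  fixes \<Omega> :: "(real^'d) set" and V :: "('d::finite, 'm::finite) vfield set" and T :: real
  assumes VL: "V \<subseteq> L2_space \<Omega>" and dense: "dense_in_L2 \<Omega> V"
begin

text \<open>By Cauchy--Schwarz this bounds the oscillation on \<open>[a, b]\<close> of a path whose weak derivative is
  dominated by \<open>s\<close>.\<close>

abbreviation osc :: "(real \<Rightarrow> real) \<Rightarrow> real \<Rightarrow> real \<Rightarrow> real" where
  "osc s a b \<equiv> sqrt ((b - a) * energy s a b)"

lemma inner_integral_le:
  assumes dom: "dominated \<Omega> T q s" and v: "v \<in> L2_space \<Omega>" and ab: "0 \<le> a" "a \<le> b" "b \<le> T"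
  shows "\<bar>\<integral>t. l2_inner \<Omega> (q t) v \<partial>lebesgue_on {a..b}\<bar> \<le> l2_norm \<Omega> v * osc s a b"
proof -
  have s: "sq_integrable T s" using dom by (simp add: dominated_def)
  have "AE t in lebesgue_on {a..b}. q t \<in> L2_space \<Omega> \<and> l2_norm \<Omega> (q t) \<le> s t"
    using dom unfolding dominated_def by (elim conjE, elim AE_lebesgue_on_mono) (use ab in auto)
  then have ae: "AE t in lebesgue_on {a..b}. \<bar>l2_inner \<Omega> (q t) v\<bar> \<le> l2_norm \<Omega> v * s t"
  proof eventually_elim
    case (elim t)
    then have "\<bar>l2_inner \<Omega> (q t) v\<bar> \<le> l2_norm \<Omega> (q t) * l2_norm \<Omega> v" using v by (intro l2_Cauchy_Schwarz) auto
    also have "\<dots> \<le> s t * l2_norm \<Omega> v" using elim by (intro mult_right_mono) auto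
    finally show ?case by (simp add: mult.commute)
  qed
  have i: "integrable (lebesgue_on {a..b}) (\<lambda>t. l2_norm \<Omega> v * s t)"
    using integral_le_sqrt_energy(1)[OF s ab] by simp
  have "\<bar>\<integral>t. l2_inner \<Omega> (q t) v \<partial>lebesgue_on {a..b}\<bar> \<le> (\<integral>t. \<bar>l2_inner \<Omega> (q t) v\<bar> \<partial>lebesgue_on {a..b})"
    by (rule integral_abs_bound)
  also have "\<dots> \<le> (\<integral>t. l2_norm \<Omega> v * s t \<partial>lebesgue_on {a..b})"
    by (rule integral_mono_lebesgue_on_AE[OF i ae]) (use s in \<open>auto simp: sq_integrable_def\<close>)
  also have "\<dots> = l2_norm \<Omega> v * (\<integral>t. s t \<partial>lebesgue_on {a..b})" by simp
  also have "\<dots> \<le> l2_norm \<Omega> v * osc s a b"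
    using integral_le_sqrt_energy(2)[OF s ab] by (intro mult_left_mono) auto
  finally show ?thesis .
qed

lemma increment_inner_le:
  assumes d: "weak_time_derivative \<Omega> V T p q" and dom: "dominated \<Omega> T q s" and v: "v \<in> V"
    and ab: "0 \<le> a" "a \<le> b" "b \<le> T"
  shows "\<bar>l2_inner \<Omega> (p b) v - l2_inner \<Omega> (p a) v\<bar> \<le> l2_norm \<Omega> v * osc s a b"
  using inner_integral_le[OF dom _ ab, of v] d v VL ab by (auto simp: weak_time_derivative_def)

lemma norm_le_by_testing:
  assumes "u \<in> L2_space \<Omega>" "0 \<le> c" "\<And>v. v \<in> V \<Longrightarrow> \<bar>l2_inner \<Omega> u v\<bar> \<le> l2_norm \<Omega> v * c"
  shows "l2_norm \<Omega> u \<le> c"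
proof (rule l2_norm_le_dense[OF dense VL assms(1,2)])
  fix v assume "v \<in> V"
  from assms(3)[OF this] show "l2_inner \<Omega> u v \<le> c * l2_norm \<Omega> v"
    unfolding mult.commute[of c] by linarith
qed

lemma weak_derivative_L2:
  "weak_time_derivative \<Omega> V T p q \<Longrightarrow> 0 \<le> t \<Longrightarrow> t \<le> T \<Longrightarrow> p t \<in> L2_space \<Omega>"
  by (simp add: weak_time_derivative_def)

lemma increment_norm_le:
  assumes d: "weak_time_derivative \<Omega> V T p q" and dom: "dominated \<Omega> T q s"
    and ab: "0 \<le> a" "a \<le> b" "b \<le> T"
  shows "l2_norm \<Omega> (\<lambda>x. p b x - p a x) \<le> osc s a b"
proof (rule norm_le_by_testing)
  have pL: "p a \<in> L2_space \<Omega>" "p b \<in> L2_space \<Omega>"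
    using weak_derivative_L2[OF d] ab by auto
  then show "(\<lambda>x. p b x - p a x) \<in> L2_space \<Omega>" by simp
  show "0 \<le> osc s a b" using ab by simp
  fix v assume v: "v \<in> V"
  then show "\<bar>l2_inner \<Omega> (\<lambda>x. p b x - p a x) v\<bar> \<le> l2_norm \<Omega> v * osc s a b"
    using increment_inner_le[OF d dom v ab] pL VL by (auto simp: subset_iff)
qed

lemma osc_mono:
  assumes "sq_integrable T s" "0 \<le> a'" "a' \<le> a" "a \<le> b" "b \<le> b'" "b' \<le> T"
  shows "osc s a b \<le> osc s a' b'"
proof -
  have "energy s a' b' = energy s a' a + (energy s a b + energy s b b')"
    using energy_combine[OF assms(1), of a' a b'] energy_combine[OF assms(1), of a b b'] assms by simp
  then have "energy s a b \<le> energy s a' b'" using energy_nonneg[of s a' a] energy_nonneg[of s b b'] by linarith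
  then have "(b - a) * energy s a b \<le> (b' - a') * energy s a' b'"
    using assms by (intro mult_mono) auto
  then show ?thesis by simp
qed

lemma increment_inner_le_osc:
  assumes d: "weak_time_derivative \<Omega> V T p q" and dom: "dominated \<Omega> T q s" and v: "v \<in> V"
    and ab: "0 \<le> a" "b \<le> T" and t: "t \<in> {a..b}" "t' \<in> {a..b}"
  shows "\<bar>l2_inner \<Omega> (p t) v - l2_inner \<Omega> (p t') v\<bar> \<le> l2_norm \<Omega> v * osc s a b"
proof -
  have s: "sq_integrable T s" using dom by (simp add: dominated_def)
  have *: "\<bar>l2_inner \<Omega> (p y) v - l2_inner \<Omega> (p x) v\<bar> \<le> l2_norm \<Omega> v * osc s a b"
    if "a \<le> x" "x \<le> y" "y \<le> b" for x y
  proof -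
    have "\<bar>l2_inner \<Omega> (p y) v - l2_inner \<Omega> (p x) v\<bar> \<le> l2_norm \<Omega> v * osc s x y"
      using that ab by (intro increment_inner_le[OF d dom v]) auto
    also have "\<dots> \<le> l2_norm \<Omega> v * osc s a b"
      using that ab by (intro mult_left_mono osc_mono[OF s]) auto
    finally show ?thesis .
  qed
  show ?thesis
    using *[of t t'] *[of t' t] t by (cases "t \<le> t'") (auto simp: abs_minus_commute)
qed

text \<open>The path is even Hoelder continuous with exponent 1/2. Continuity supplies the integrability that
  the expansions below need.\<close>

lemma inner_path_continuous:
  assumes d: "weak_time_derivative \<Omega> V T p q" and dom: "dominated \<Omega> T q s" and v: "v \<in> V"
  shows "continuous_on {0..T} (\<lambda>t. l2_inner \<Omega> (p t) v)"
proof -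
  have s: "sq_integrable T s" using dom by (simp add: dominated_def)
  define K where "K = l2_norm \<Omega> v * sqrt (energy s 0 T)"
  have *: "\<bar>l2_inner \<Omega> (p y) v - l2_inner \<Omega> (p x) v\<bar> \<le> K * sqrt (y - x)"
    if "0 \<le> x" "x \<le> y" "y \<le> T" for x y
  proof -
    have "energy s 0 T = energy s 0 x + (energy s x y + energy s y T)"
      using energy_combine[OF s, of 0 x T] energy_combine[OF s, of x y T] that by simp
    then have "energy s x y \<le> energy s 0 T"
      using energy_nonneg[of s 0 x] energy_nonneg[of s y T] by linarith
    then have "osc s x y \<le> sqrt ((y - x) * energy s 0 T)" using that by (intro real_sqrt_le_mono mult_left_mono) auto
    then have "l2_norm \<Omega> v * osc s x y \<le> l2_norm \<Omega> v * sqrt ((y - x) * energy s 0 T)"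
      by (intro mult_left_mono) auto
    also have "\<dots> = K * sqrt (y - x)" by (simp add: K_def real_sqrt_mult)
    finally show ?thesis using increment_inner_le[OF d dom v that] by linarith
  qed
  have **: "\<bar>l2_inner \<Omega> (p y) v - l2_inner \<Omega> (p x) v\<bar> \<le> K * sqrt \<bar>y - x\<bar>" if "x \<in> {0..T}" "y \<in> {0..T}" for x y
    using *[of x y] *[of y x] that by (cases "x \<le> y") (auto simp: abs_minus_commute)
  show ?thesis
    unfolding continuous_on_def
  proof
    fix t assume t: "t \<in> {0..T}"
    have "((\<lambda>y. K * sqrt \<bar>y - t\<bar>) \<longlongrightarrow> K * sqrt \<bar>t - t\<bar>) (at t within {0..T})"
      by (intro tendsto_intros)
    then have "((\<lambda>y. K * sqrt \<bar>y - t\<bar>) \<longlongrightarrow> 0) (at t within {0..T})" by simp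
    then have "((\<lambda>y. l2_inner \<Omega> (p y) v - l2_inner \<Omega> (p t) v) \<longlongrightarrow> 0) (at t within {0..T})"
      by (rule Lim_null_comparison[rotated]) (use ** t in \<open>auto simp: eventually_at_filter\<close>)
    then show "((\<lambda>y. l2_inner \<Omega> (p y) v) \<longlongrightarrow> l2_inner \<Omega> (p t) v) (at t within {0..T})"
      by (simp add: LIM_zero_iff)
  qed
qed

lemma integrable_inner_path:
  assumes d: "weak_time_derivative \<Omega> V T p q" and dom: "dominated \<Omega> T q s" and v: "v \<in> V"
    and ab: "0 \<le> a" "b \<le> T"
  shows "integrable (lebesgue_on {a..b}) (\<lambda>t. l2_inner \<Omega> (p t) v)"
  by (rule continuous_imp_integrable_real, rule continuous_on_subset[OF inner_path_continuous[OF d dom v]])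
    (use ab in auto)

lemma integral_const_interval:
  fixes c :: real
  shows "a \<le> b \<Longrightarrow> (\<integral>t. c \<partial>lebesgue_on {a..b}) = (b - a) * c"
  by (simp add: measure_restrict_space)

text \<open>The base point \<open>c\<close> of the expansion may be any point of a larger interval; second differences
  use the common end point of two intervals.\<close>

lemma taylor1_inner:
  assumes d: "weak_time_derivative \<Omega> V T p q" and d2: "weak_time_derivative \<Omega> V T q q2"
    and dom: "dominated \<Omega> T q2 s" and v: "v \<in> V"
    and ab: "0 \<le> A" "A \<le> a" "a \<le> b" "b \<le> B" "B \<le> T" and c: "c \<in> {A..B}"
  shows "\<bar>l2_inner \<Omega> (p b) v - l2_inner \<Omega> (p a) v - (b - a) * l2_inner \<Omega> (q c) v\<bar>
    \<le> (b - a) * (l2_norm \<Omega> v * osc s A B)"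
proof -
  let ?f = "\<lambda>t. l2_inner \<Omega> (q t) v" and ?c = "l2_inner \<Omega> (q c) v"
  have i: "integrable (lebesgue_on {a..b}) ?f"
    by (rule integrable_inner_path[OF d2 dom v]) (use ab in auto)
  have ic: "integrable (lebesgue_on {a..b}) (\<lambda>t. k)" for k :: real
    by (simp add: integrable_restrict_space)
  have "l2_inner \<Omega> (p b) v - l2_inner \<Omega> (p a) v = (\<integral>t. ?f t \<partial>lebesgue_on {a..b})"
    using d v ab by (simp add: weak_time_derivative_def)
  then have "l2_inner \<Omega> (p b) v - l2_inner \<Omega> (p a) v - (b - a) * ?c = (\<integral>t. ?f t - ?c \<partial>lebesgue_on {a..b})"
    unfolding Bochner_Integration.integral_diff[OF i ic] integral_const_interval[OF ab(3)] by simp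
  also have "\<bar>\<dots>\<bar> \<le> (\<integral>t. \<bar>?f t - ?c\<bar> \<partial>lebesgue_on {a..b})" by (rule integral_abs_bound)
  also have "\<dots> \<le> (\<integral>t. l2_norm \<Omega> v * osc s A B \<partial>lebesgue_on {a..b})"
    by (rule integral_mono[OF _ ic])
      (use i ic ab c in \<open>auto intro!: increment_inner_le_osc[OF d2 dom v]\<close>)
  also have "\<dots> = (b - a) * (l2_norm \<Omega> v * osc s A B)" by (rule integral_const_interval[OF ab(3)])
  finally show ?thesis .
qed

text \<open>Both increments are compared with \<open>\<tau>\<close> times the same value \<open>q b\<close>, which cancels.\<close>

lemma second_difference_le:
  assumes d: "weak_time_derivative \<Omega> V T p q" and d2: "weak_time_derivative \<Omega> V T q q2"
    and dom: "dominated \<Omega> T q2 s" and ab: "0 \<le> a" "a \<le> b" "c \<le> T" and eq: "b - a = \<tau>" "c - b = \<tau>"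
  shows "l2_norm \<Omega> (\<lambda>x. (p c x - p b x) - (p b x - p a x)) \<le> \<tau> * (osc s a b + osc s b c)"
proof (rule norm_le_by_testing)
  have \<tau>: "0 \<le> \<tau>" using ab eq by simp
  have pL: "p a \<in> L2_space \<Omega>" "p b \<in> L2_space \<Omega>" "p c \<in> L2_space \<Omega>"
    using weak_derivative_L2[OF d] ab eq \<tau> by auto
  then show "(\<lambda>x. (p c x - p b x) - (p b x - p a x)) \<in> L2_space \<Omega>" by (intro L2_space_diff)
  show "0 \<le> \<tau> * (osc s a b + osc s b c)" using \<tau> eq by simp
  fix v assume v: "v \<in> V"
  then have vL: "v \<in> L2_space \<Omega>" using VL by blast
  have "\<bar>l2_inner \<Omega> (p b) v - l2_inner \<Omega> (p a) v - \<tau> * l2_inner \<Omega> (q b) v\<bar> \<le> \<tau> * (l2_norm \<Omega> v * osc s a b)"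
    using taylor1_inner[OF d d2 dom v, of a a b b b] ab eq \<tau> by simp
  moreover have "\<bar>l2_inner \<Omega> (p c) v - l2_inner \<Omega> (p b) v - \<tau> * l2_inner \<Omega> (q b) v\<bar> \<le> \<tau> * (l2_norm \<Omega> v * osc s b c)"
    using taylor1_inner[OF d d2 dom v, of b b c c b] ab eq \<tau> by simp
  ultimately show "\<bar>l2_inner \<Omega> (\<lambda>x. (p c x - p b x) - (p b x - p a x)) v\<bar> \<le> l2_norm \<Omega> v * (\<tau> * (osc s a b + osc s b c))"
    using l2_inner_diff_left[OF L2_space_diff[OF pL(3,2)] L2_space_diff[OF pL(2,1)] vL]
      l2_inner_diff_left[OF pL(3,2) vL] l2_inner_diff_left[OF pL(2,1) vL]
    unfolding distrib_left mult.left_commute[of "l2_norm \<Omega> v"] by linarith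
qed

text \<open>Both \<open>\<integral>q\<close> and the mean of the end values are compared with those
  of the Taylor polynomial \<open>fa + (t - a) * ga\<close>, on which the trapezoidal rule is exact.\<close>

lemma trapezoid_error:
  assumes d: "weak_time_derivative \<Omega> V T p q" and d2: "weak_time_derivative \<Omega> V T q q2"
    and d3: "weak_time_derivative \<Omega> V T q2 q3" and dom2: "dominated \<Omega> T q2 s2"
    and dom: "dominated \<Omega> T q3 s" and ab: "0 \<le> a" "a \<le> b" "b \<le> T"
  shows "l2_norm \<Omega> (\<lambda>x. (p b x - p a x) - (b - a) *\<^sub>R ((1/2) *\<^sub>R q a x + (1/2) *\<^sub>R q b x))
    \<le> 3/2 * (b - a)\<^sup>2 * osc s a b"
proof (rule norm_le_by_testing)
  let ?\<tau> = "b - a"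
  have L: "p a \<in> L2_space \<Omega>" "p b \<in> L2_space \<Omega>" "q a \<in> L2_space \<Omega>" "q b \<in> L2_space \<Omega>"
    using weak_derivative_L2[OF d] weak_derivative_L2[OF d2] ab by auto
  then show "(\<lambda>x. (p b x - p a x) - (b - a) *\<^sub>R ((1/2) *\<^sub>R q a x + (1/2) *\<^sub>R q b x)) \<in> L2_space \<Omega>" by simp
  show "0 \<le> 3/2 * ?\<tau>\<^sup>2 * osc s a b" using ab by simp
  fix v assume v: "v \<in> V"
  then have vL: "v \<in> L2_space \<Omega>" using VL by blast
  let ?f = "\<lambda>t. l2_inner \<Omega> (q t) v"
  define fa ga where "fa = l2_inner \<Omega> (q a) v" and "ga = l2_inner \<Omega> (q2 a) v"
  define J where "J = l2_norm \<Omega> v * osc s a b"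
  have J0: "0 \<le> J" using ab by (simp add: J_def)
  have ft: "\<bar>?f t - fa - (t - a) * ga\<bar> \<le> ?\<tau> * J" if "t \<in> {a..b}" for t
  proof -
    have "\<bar>?f t - fa - (t - a) * ga\<bar> \<le> (t - a) * J"
      unfolding fa_def ga_def J_def using that ab by (intro taylor1_inner[OF d2 d3 dom v]) auto
    also have "\<dots> \<le> ?\<tau> * J" using that J0 by (intro mult_right_mono) auto
    finally show ?thesis .
  qed
  have i: "integrable (lebesgue_on {a..b}) ?f"
    by (rule integrable_inner_path[OF d2 dom2 v]) (use ab in auto)
  have ic: "integrable (lebesgue_on {a..b}) (\<lambda>t. k)" for k :: real
    by (simp add: integrable_restrict_space)
  have il: "integrable (lebesgue_on {a..b}) (\<lambda>t. fa + (t - a) * ga)"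
    by (intro continuous_imp_integrable_real continuous_intros)
  have "((\<lambda>t. fa + (t - a) * ga) has_integral ((fa * b + (b - a)\<^sup>2 / 2 * ga) - (fa * a + (a - a)\<^sup>2 / 2 * ga))) {a..b}"
    by (rule fundamental_theorem_of_calculus[OF ab(2)])
      (auto intro!: derivative_eq_intros simp flip: has_real_derivative_iff_has_vector_derivative)
  then have "integral {a..b} (\<lambda>t. fa + (t - a) * ga) = ?\<tau> * fa + ?\<tau>\<^sup>2 / 2 * ga"
    by (rule integral_unique[THEN trans]) (simp add: algebra_simps)
  then have lin: "(\<integral>t. fa + (t - a) * ga \<partial>lebesgue_on {a..b}) = ?\<tau> * fa + ?\<tau>\<^sup>2 / 2 * ga"
    by (subst lebesgue_integral_eq_integral[OF il]) auto
  have "l2_inner \<Omega> (p b) v - l2_inner \<Omega> (p a) v = (\<integral>t. ?f t \<partial>lebesgue_on {a..b})"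
    using d v ab by (simp add: weak_time_derivative_def)
  then have "l2_inner \<Omega> (p b) v - l2_inner \<Omega> (p a) v - (?\<tau> * fa + ?\<tau>\<^sup>2 / 2 * ga) =
      (\<integral>t. ?f t - (fa + (t - a) * ga) \<partial>lebesgue_on {a..b})"
    using Bochner_Integration.integral_diff[OF i il] lin by simp
  also have "\<bar>\<dots>\<bar> \<le> (\<integral>t. \<bar>?f t - (fa + (t - a) * ga)\<bar> \<partial>lebesgue_on {a..b})" by (rule integral_abs_bound)
  also have "\<dots> \<le> (\<integral>t. ?\<tau> * J \<partial>lebesgue_on {a..b})"
  proof (rule integral_mono[OF _ ic])
    show "integrable (lebesgue_on {a..b}) (\<lambda>t. \<bar>?f t - (fa + (t - a) * ga)\<bar>)"
      by (intro integrable_abs Bochner_Integration.integrable_diff i il)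
    show "\<bar>?f t - (fa + (t - a) * ga)\<bar> \<le> ?\<tau> * J" if "t \<in> space (lebesgue_on {a..b})" for t
      using ft[of t] that by (simp add: algebra_simps)
  qed
  also have "\<dots> = ?\<tau> * (?\<tau> * J)" by (rule integral_const_interval[OF ab(2)])
  finally have 1: "\<bar>l2_inner \<Omega> (p b) v - l2_inner \<Omega> (p a) v - (?\<tau> * fa + ?\<tau>\<^sup>2 / 2 * ga)\<bar> \<le> ?\<tau> * (?\<tau> * J)" .
  have 2: "\<bar>?\<tau> / 2 * (?f b - fa - ?\<tau> * ga)\<bar> \<le> ?\<tau> / 2 * (?\<tau> * J)"
    unfolding abs_mult using ft[of b] ab J0 by (intro mult_mono) auto
  have id: "P - \<tau> * (x / 2 + y / 2) = (P - (\<tau> * x + \<tau>\<^sup>2 / 2 * z)) - \<tau> / 2 * (y - x - \<tau> * z)"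
    for P \<tau> x y z :: real by (simp add: field_simps power2_eq_square)
  have "\<bar>l2_inner \<Omega> (p b) v - l2_inner \<Omega> (p a) v - ?\<tau> * (fa / 2 + ?f b / 2)\<bar>
      \<le> ?\<tau> * (?\<tau> * J) + ?\<tau> / 2 * (?\<tau> * J)"
    unfolding id[of _ _ _ _ ga] by (rule order_trans[OF abs_triangle_ineq4 add_mono[OF 1 2]])
  also have "\<dots> = l2_norm \<Omega> v * (3/2 * ?\<tau>\<^sup>2 * osc s a b)"
    by (simp add: J_def power2_eq_square)
  finally show "\<bar>l2_inner \<Omega> (\<lambda>x. (p b x - p a x) - (b - a) *\<^sub>R ((1/2) *\<^sub>R q a x + (1/2) *\<^sub>R q b x)) v\<bar>
      \<le> l2_norm \<Omega> v * (3/2 * ?\<tau>\<^sup>2 * osc s a b)"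
    using L vL by (simp add: fa_def algebra_simps)
qed

text \<open>There is a time in the interval at which \<open>s0\<close> does not exceed its mean square, and from there to
  \<open>c\<close> the path moves by at most \<open>osc s1 a b\<close>. Summed over the steps this bounds nodal values by time
  norms in \<open>L\<^sup>2\<close>, with no factor depending on \<open>T\<close>.\<close>

lemma sampled_norm_le:
  assumes d: "weak_time_derivative \<Omega> V T p q" and dom: "dominated \<Omega> T q s1" and domp: "dominated \<Omega> T p s0"
    and ab: "0 \<le> a" "a < b" "b \<le> T" and c: "c \<in> {a..b}"
  shows "(b - a) * (l2_norm \<Omega> (p c))\<^sup>2 \<le> 2 * (energy s0 a b + (b - a)\<^sup>2 * energy s1 a b)"
proof -
  have s0: "sq_integrable T s0" and s1: "sq_integrable T s1" using dom domp by (simp_all add: dominated_def)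
  have "AE t in lebesgue_on {0..T}. l2_norm \<Omega> (p t) \<le> s0 t"
    using domp by (auto simp: dominated_def elim!: eventually_mono)
  from ex_below_mean[OF s0 ab this]
  obtain t where t: "t \<in> {a..b}" "l2_norm \<Omega> (p t) \<le> s0 t" "(b - a) * (s0 t)\<^sup>2 \<le> energy s0 a b" by blast
  have L: "p c \<in> L2_space \<Omega>" "p t \<in> L2_space \<Omega>" using weak_derivative_L2[OF d] ab c t by auto
  have *: "l2_norm \<Omega> (\<lambda>x. p y x - p x' x) \<le> osc s1 a b" if "a \<le> x'" "x' \<le> y" "y \<le> b" for x' y
    using increment_norm_le[OF d dom, of x' y] order_trans[OF _ osc_mono[OF s1, of a x' y b]] that ab by auto
  have sw: "l2_norm \<Omega> (\<lambda>x. p c x - p t x) = l2_norm \<Omega> (\<lambda>x. p t x - p c x)"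
    using l2_norm_minus[of \<Omega> "\<lambda>x. p t x - p c x"] by simp
  have "l2_norm \<Omega> (\<lambda>x. p c x - p t x) \<le> osc s1 a b"
    using *[of t c] *[of c t] t c sw by (cases "t \<le> c") auto
  moreover have "l2_norm \<Omega> (p c) \<le> l2_norm \<Omega> (\<lambda>x. p c x - p t x) + l2_norm \<Omega> (p t)"
    using l2_norm_triangle[of "\<lambda>x. p c x - p t x" \<Omega> "p t"] L by simp
  ultimately have "l2_norm \<Omega> (p c) \<le> osc s1 a b + s0 t" using t by linarith
  then have "(l2_norm \<Omega> (p c))\<^sup>2 \<le> (osc s1 a b + s0 t)\<^sup>2" by (intro power_mono) auto
  also have "\<dots> \<le> 2 * ((osc s1 a b)\<^sup>2 + (s0 t)\<^sup>2)"
    using sum_squares_bound[of "osc s1 a b" "s0 t"] by (simp add: power2_sum)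
  also have "(osc s1 a b)\<^sup>2 = (b - a) * energy s1 a b" using ab by simp
  finally have "(b - a) * (l2_norm \<Omega> (p c))\<^sup>2 \<le> (b - a) * (2 * ((b - a) * energy s1 a b + (s0 t)\<^sup>2))"
    using ab by (intro mult_left_mono) auto
  then show ?thesis using t(3) by (simp add: power2_eq_square algebra_simps)
qed

text \<open>Arbitrarily close to \<open>t\<close> there is a time at which the bound holds, and the path is continuous. The
  nodes themselves may all belong to the exceptional null set.\<close>

lemma norm_le_everywhere:
  assumes d: "weak_time_derivative \<Omega> V T p q" and dom: "dominated \<Omega> T q s"
    and ae: "AE t in lebesgue_on {0..T}. l2_norm \<Omega> (p t) \<le> c" and c: "0 \<le> c"
    and t: "t \<in> {0..T}" and T: "0 < T"
  shows "l2_norm \<Omega> (p t) \<le> c"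
proof -
  have s: "sq_integrable T s" using dom by (simp add: dominated_def)
  have "l2_norm \<Omega> (p t) \<le> c + sqrt (e * energy s 0 T)" if e: "0 < e" for e
  proof -
    define a where "a = max 0 (t - e / 2)"
    define b where "b = min T (t + e / 2)"
    have ab: "0 \<le> a" "a < b" "b \<le> T" "t \<in> {a..b}" "b - a \<le> e" using t T e by (auto simp: a_def b_def)
    obtain u where u: "u \<in> {a..b}" "l2_norm \<Omega> (p u) \<le> c"
      using ex_below_mean[OF s ab(1-3) ae] by blast
    have L: "p u \<in> L2_space \<Omega>" "p t \<in> L2_space \<Omega>" using weak_derivative_L2[OF d] ab u by auto
    have *: "l2_norm \<Omega> (\<lambda>x. p y x - p x' x) \<le> osc s a b" if "a \<le> x'" "x' \<le> y" "y \<le> b" for x' y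
      using increment_norm_le[OF d dom, of x' y] order_trans[OF _ osc_mono[OF s, of a x' y b]] that ab by auto
    have sw: "l2_norm \<Omega> (\<lambda>x. p t x - p u x) = l2_norm \<Omega> (\<lambda>x. p u x - p t x)"
      using l2_norm_minus[of \<Omega> "\<lambda>x. p u x - p t x"] by simp
    have "l2_norm \<Omega> (\<lambda>x. p t x - p u x) \<le> osc s a b"
      using *[of t u] *[of u t] u ab sw by (cases "t \<le> u") auto
    moreover have "l2_norm \<Omega> (p t) \<le> l2_norm \<Omega> (\<lambda>x. p t x - p u x) + l2_norm \<Omega> (p u)"
      using l2_norm_triangle[of "\<lambda>x. p t x - p u x" \<Omega> "p u"] L by simp
    moreover have "osc s a b \<le> sqrt (e * energy s 0 T)"
    proof -
      have "energy s 0 T = energy s 0 a + (energy s a b + energy s b T)"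
        using energy_combine[OF s, of 0 a T] energy_combine[OF s, of a b T] ab by simp
      then have "energy s a b \<le> energy s 0 T"
        using energy_nonneg[of s 0 a] energy_nonneg[of s b T] by linarith
      then show ?thesis using ab by (intro real_sqrt_le_mono mult_mono) auto
    qed
    ultimately show ?thesis using u(2) by linarith
  qed
  then have ev: "eventually (\<lambda>e. l2_norm \<Omega> (p t) \<le> c + sqrt (e * energy s 0 T)) (at_right 0)"
    by (auto simp: eventually_at_right_less intro: eventually_at_rightI[of 0 1])
  have "((\<lambda>e. c + sqrt (e * energy s 0 T)) \<longlongrightarrow> c + sqrt (0 * energy s 0 T)) (at_right 0)"
    by (intro tendsto_intros)
  from tendsto_lowerbound[OF this ev] show ?thesis by simp
qed

end

section \<open>Stability of the discrete scheme\<close>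

text \<open>Absorbs a term that is linear in the residual \<open>v\<close>.\<close>

lemma l2_young:
  assumes "u \<in> L2_space \<Omega>" "v \<in> L2_space \<Omega>" "0 < \<delta>"
  shows "l2_inner \<Omega> u v - \<delta> * l2_inner \<Omega> v v \<le> (l2_norm \<Omega> u)\<^sup>2 / (4 * \<delta>)"
proof -
  have "0 \<le> l2_inner \<Omega> (\<lambda>x. u x - (2 * \<delta>) *\<^sub>R v x) (\<lambda>x. u x - (2 * \<delta>) *\<^sub>R v x)" by simp
  also have "\<dots> = l2_inner \<Omega> u u - 4 * \<delta> * l2_inner \<Omega> u v + 4 * \<delta>\<^sup>2 * l2_inner \<Omega> v v"
    using assms by (simp add: l2_inner_commute[of \<Omega> v u] power2_eq_square algebra_simps)
  finally have "0 \<le> l2_inner \<Omega> u u - 4 * \<delta> * l2_inner \<Omega> u v + 4 * \<delta>\<^sup>2 * l2_inner \<Omega> v v" .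
  then have "4 * \<delta> * (l2_inner \<Omega> u v - \<delta> * l2_inner \<Omega> v v) \<le> l2_inner \<Omega> u u"
    by (simp add: power2_eq_square right_diff_distrib mult.assoc)
  then show ?thesis
    using assms(3) by (simp add: l2_norm_power2 pos_le_divide_eq mult.commute)
qed

text \<open>
  Here \<open>x, g\<close> stand for the discrete error and its image under the
  operator, \<open>y, z\<close> for the projection error and its image, and primes for the previous time level.
  The images enter only through skew-symmetry relations between inner products, so that the operator may
  be linear merely up to null sets.

  The test field \<open>TW\<close> equals \<open>e + \<delta> A + \<delta>\<^sup>2 Dg\<close> with \<open>e\<close> the weighted mean of \<open>x\<close> and \<open>x'\<close>, and
  skew symmetry gives \<open>(A, e) = (D x, e)\<close> and \<open>(A, Dg) = (Mg, Dg)\<close>. For \<open>\<theta> \<ge> 1/2\<close> both dominate the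
  difference quotient of half the squared norm.
\<close>

lemma one_step_energy:
  fixes x x' g g' y y' z z' R :: "('d::finite, 'm::finite) vfield"
  assumes L: "x \<in> L2_space \<Omega>" "x' \<in> L2_space \<Omega>" "g \<in> L2_space \<Omega>" "g' \<in> L2_space \<Omega>"
      "y \<in> L2_space \<Omega>" "y' \<in> L2_space \<Omega>" "z \<in> L2_space \<Omega>" "z' \<in> L2_space \<Omega>" "R \<in> L2_space \<Omega>"
    and skew: "l2_inner \<Omega> x g = 0" "l2_inner \<Omega> x' g' = 0" "l2_inner \<Omega> x g' = - l2_inner \<Omega> x' g"
    and orth: "l2_inner \<Omega> y x = 0" "l2_inner \<Omega> y x' = 0" "l2_inner \<Omega> y' x = 0" "l2_inner \<Omega> y' x' = 0"
    and mixed: "l2_inner \<Omega> z x = - l2_inner \<Omega> y g" "l2_inner \<Omega> z x' = - l2_inner \<Omega> y g'"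
      "l2_inner \<Omega> z' x = - l2_inner \<Omega> y' g" "l2_inner \<Omega> z' x' = - l2_inner \<Omega> y' g'"
    and \<theta>: "1/2 \<le> \<theta>" and \<tau>: "0 < \<tau>" and \<delta>: "\<delta> = \<theta> * \<tau>"
  defines "A \<equiv> \<lambda>r. (1/\<tau>) *\<^sub>R (x r - x' r) + (\<theta> *\<^sub>R g r + (1 - \<theta>) *\<^sub>R g' r)"
    and "\<alpha> \<equiv> \<lambda>r. (1/\<tau>) *\<^sub>R (y r - y' r) + (\<theta> *\<^sub>R z r + (1 - \<theta>) *\<^sub>R z' r)"
    and "m \<equiv> \<lambda>r. \<theta> *\<^sub>R y r + (1 - \<theta>) *\<^sub>R y' r"
    and "TW \<equiv> \<lambda>r. (2 * \<theta>) *\<^sub>R (x r + \<delta> *\<^sub>R g r) + (1 - 2 * \<theta>) *\<^sub>R (x' r + \<delta> *\<^sub>R g' r)"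
  assumes scheme: "l2_inner \<Omega> A TW = l2_inner \<Omega> \<alpha> TW - l2_inner \<Omega> R TW"
  shows "(l2_inner \<Omega> x x + \<delta>\<^sup>2 * l2_inner \<Omega> g g) - (l2_inner \<Omega> x' x' + \<delta>\<^sup>2 * l2_inner \<Omega> g' g')
    \<le> \<tau> / (2 * \<delta>) * (l2_norm \<Omega> (\<lambda>r. \<delta> *\<^sub>R \<alpha> r - m r))\<^sup>2
      + 2 * \<delta>\<^sup>2 * (l2_inner \<Omega> \<alpha> g - l2_inner \<Omega> \<alpha> g') - 2 * \<tau> * l2_inner \<Omega> R TW"
proof -
  have \<delta>0: "0 < \<delta>" using \<delta> \<theta> \<tau> by simp
  define e where "e = (\<lambda>r. \<theta> *\<^sub>R x r + (1 - \<theta>) *\<^sub>R x' r)"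
  define Dg where "Dg = (\<lambda>r. (1/\<tau>) *\<^sub>R (g r - g' r))"
  have AL: "A \<in> L2_space \<Omega>" and \<alpha>L: "\<alpha> \<in> L2_space \<Omega>" and mL: "m \<in> L2_space \<Omega>"
    and eL: "e \<in> L2_space \<Omega>" and DgL: "Dg \<in> L2_space \<Omega>"
    using L by (simp_all add: A_def \<alpha>_def m_def e_def Dg_def)
  \<comment> \<open>\<open>\<delta> = \<theta> * \<tau>\<close> makes \<open>\<delta> / \<tau>\<close> equal to the weight \<open>\<theta>\<close> of the newer level\<close>
  have TW: "TW = (\<lambda>r. (e r + \<delta> *\<^sub>R A r) + \<delta>\<^sup>2 *\<^sub>R Dg r)"
  proof
    fix r
    have 1: "\<delta> *\<^sub>R A r = \<theta> *\<^sub>R (x r - x' r) + \<delta> *\<^sub>R (\<theta> *\<^sub>R g r + (1 - \<theta>) *\<^sub>R g' r)"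
      using \<tau> by (simp add: A_def \<delta> scaleR_add_right)
    have 2: "\<delta>\<^sup>2 *\<^sub>R Dg r = \<delta> *\<^sub>R (\<theta> *\<^sub>R (g r - g' r))"
      using \<tau> by (simp add: Dg_def \<delta> power2_eq_square)
    show "TW r = (e r + \<delta> *\<^sub>R A r) + \<delta>\<^sup>2 *\<^sub>R Dg r"
      unfolding TW_def e_def 1 2 vec_eq_iff vector_add_component vector_minus_component
        vector_scaleR_component real_scaleR_def
      by (intro allI) algebra
  qed
  have TWL: "TW \<in> L2_space \<Omega>" using L by (simp add: TW_def)
  have split: "l2_inner \<Omega> u TW = l2_inner \<Omega> u e + \<delta> * l2_inner \<Omega> u A + \<delta>\<^sup>2 * l2_inner \<Omega> u Dg"
    if "u \<in> L2_space \<Omega>" for u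
    using that AL eL DgL by (simp add: TW)
  have skew': "l2_inner \<Omega> g x = 0" "l2_inner \<Omega> g' x' = 0" "l2_inner \<Omega> g' x = - l2_inner \<Omega> x' g"
      "l2_inner \<Omega> g x' = l2_inner \<Omega> x' g"
    using skew by (simp_all add: l2_inner_commute)
  have Ae: "\<tau> * l2_inner \<Omega> A e = l2_inner \<Omega> (\<lambda>r. x r - x' r) e"
    using L \<tau> skew' by (simp add: A_def e_def algebra_simps)
  also have "\<dots> = (l2_inner \<Omega> x x - l2_inner \<Omega> x' x') / 2
      + (\<theta> - 1/2) * l2_inner \<Omega> (\<lambda>r. x r - x' r) (\<lambda>r. x r - x' r)"
    using L by (simp add: e_def l2_inner_commute[of \<Omega> x' x] field_simps)
  finally have Ae: "(l2_inner \<Omega> x x - l2_inner \<Omega> x' x') / 2 \<le> \<tau> * l2_inner \<Omega> A e"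
    using \<theta> by simp
  have "\<tau> * l2_inner \<Omega> A Dg = l2_inner \<Omega> (\<lambda>r. \<theta> *\<^sub>R g r + (1 - \<theta>) *\<^sub>R g' r) (\<lambda>r. g r - g' r)"
    using L \<tau> skew skew' by (simp add: A_def Dg_def algebra_simps add_divide_distrib diff_divide_distrib)
  also have "\<dots> = (l2_inner \<Omega> g g - l2_inner \<Omega> g' g') / 2
      + (\<theta> - 1/2) * l2_inner \<Omega> (\<lambda>r. g r - g' r) (\<lambda>r. g r - g' r)"
    using L by (simp add: l2_inner_commute[of \<Omega> g' g] field_simps)
  finally have AD: "(l2_inner \<Omega> g g - l2_inner \<Omega> g' g') / 2 \<le> \<tau> * l2_inner \<Omega> A Dg"
    using \<theta> by simp
  \<comment> \<open>the differences of \<open>y\<close> drop out by orthogonality, the rest by skew symmetry\<close>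
  have \<alpha>e: "l2_inner \<Omega> \<alpha> e = - l2_inner \<Omega> m A"
    using L orth mixed by (simp add: \<alpha>_def m_def A_def e_def algebra_simps)
  have \<alpha>D: "\<tau> * l2_inner \<Omega> \<alpha> Dg = l2_inner \<Omega> \<alpha> g - l2_inner \<Omega> \<alpha> g'"
    using L \<alpha>L \<tau> by (simp add: Dg_def)
  have young: "l2_inner \<Omega> (\<lambda>r. \<delta> *\<^sub>R \<alpha> r - m r) A - \<delta> * l2_inner \<Omega> A A
      \<le> (l2_norm \<Omega> (\<lambda>r. \<delta> *\<^sub>R \<alpha> r - m r))\<^sup>2 / (4 * \<delta>)"
    by (rule l2_young) (use \<alpha>L mL AL \<delta>0 in auto)
  have "2 * \<tau> * (l2_inner \<Omega> A e + \<delta> * l2_inner \<Omega> A A + \<delta>\<^sup>2 * l2_inner \<Omega> A Dg)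
      = 2 * \<tau> * (- l2_inner \<Omega> m A + \<delta> * l2_inner \<Omega> \<alpha> A + \<delta>\<^sup>2 * l2_inner \<Omega> \<alpha> Dg - l2_inner \<Omega> R TW)"
    using scheme split[OF AL] split[OF \<alpha>L] \<alpha>e by simp
  moreover have "\<delta>\<^sup>2 * ((l2_inner \<Omega> g g - l2_inner \<Omega> g' g') / 2) \<le> \<delta>\<^sup>2 * (\<tau> * l2_inner \<Omega> A Dg)"
    using AD by (intro mult_left_mono) auto
  moreover have "2 * \<tau> * (l2_inner \<Omega> (\<lambda>r. \<delta> *\<^sub>R \<alpha> r - m r) A - \<delta> * l2_inner \<Omega> A A)
      \<le> 2 * \<tau> * ((l2_norm \<Omega> (\<lambda>r. \<delta> *\<^sub>R \<alpha> r - m r))\<^sup>2 / (4 * \<delta>))"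
    using young \<tau> by (intro mult_left_mono) auto
  moreover have "l2_inner \<Omega> (\<lambda>r. \<delta> *\<^sub>R \<alpha> r - m r) A = \<delta> * l2_inner \<Omega> \<alpha> A - l2_inner \<Omega> m A"
    using \<alpha>L mL AL by simp
  moreover have "2 * \<delta>\<^sup>2 * (l2_inner \<Omega> \<alpha> g - l2_inner \<Omega> \<alpha> g') = 2 * \<tau> * (\<delta>\<^sup>2 * l2_inner \<Omega> \<alpha> Dg)"
    using \<alpha>D[symmetric] by simp
  moreover have "2 * \<tau> * (q / (4 * \<delta>)) = \<tau> / (2 * \<delta>) * q" for q by simp
  ultimately show ?thesis
    using Ae by (simp add: algebra_simps)
qed

lemma summation_by_parts:
  fixes c :: "nat \<Rightarrow> nat \<Rightarrow> real"
  shows "(\<Sum>n=1..Suc m. c n n - c n (n - 1)) = c (Suc m) (Suc m) - c 1 0 - (\<Sum>n=1..m. c (Suc n) n - c n n)"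
  by (induction m) auto

text \<open>Resolves the quadratic inequality for the largest discrete error.\<close>

lemma le_of_power2_le:
  fixes M :: real
  assumes "M\<^sup>2 \<le> Q + M * P" "0 \<le> M" "0 \<le> P" "0 \<le> Q"
  shows "M \<le> P + sqrt Q"
proof (rule ccontr)
  assume "\<not> M \<le> P + sqrt Q"
  then have M: "P + sqrt Q < M" by simp
  have "sqrt Q * sqrt Q \<le> M * sqrt Q" using M assms by (intro mult_right_mono) auto
  then have "Q + M * P \<le> M * (P + sqrt Q)" using assms by (simp add: algebra_simps)
  also have "\<dots> < M * M"
  proof (rule mult_strict_left_mono[OF M])
    show "0 < M" using M assms real_sqrt_ge_zero[of Q] by linarith
  qed
  finally show False using assms by (simp add: power2_eq_square)
qed

text \<open>
  The one-step estimates are summed. The term \<open>\<delta>\<^sup>2 (\<alpha>, g\<^sup>n - g\<^sup>n\<^sup>-\<^sup>1)\<close> has no counterpart on the left, since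
  differences of \<open>g\<close> are not controlled; summation by parts trades it for differences of \<open>\<alpha>\<close> against
  \<open>\<delta> g\<close>, which is at most the largest error \<open>M\<close>. All right-hand terms except \<open>Q\<close> are then linear in
  \<open>M\<close>. The boundary term at time 0 vanishes because the scheme starts from the projection.
\<close>

lemma discrete_stability:
  fixes x g y z R :: "nat \<Rightarrow> ('d::finite, 'm::finite) vfield"
  assumes L: "\<And>n. n \<le> N \<Longrightarrow> x n \<in> L2_space \<Omega>" "\<And>n. n \<le> N \<Longrightarrow> g n \<in> L2_space \<Omega>"
      "\<And>n. n \<le> N \<Longrightarrow> y n \<in> L2_space \<Omega>" "\<And>n. n \<le> N \<Longrightarrow> z n \<in> L2_space \<Omega>"
      "\<And>n. n \<in> {1..N} \<Longrightarrow> R n \<in> L2_space \<Omega>"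
    and skew: "\<And>i j. i \<le> N \<Longrightarrow> j \<le> N \<Longrightarrow> l2_inner \<Omega> (x i) (g j) = - l2_inner \<Omega> (x j) (g i)"
    and orth: "\<And>i j. i \<le> N \<Longrightarrow> j \<le> N \<Longrightarrow> l2_inner \<Omega> (y i) (x j) = 0"
    and mixed: "\<And>i j. i \<le> N \<Longrightarrow> j \<le> N \<Longrightarrow> l2_inner \<Omega> (z i) (x j) = - l2_inner \<Omega> (y i) (g j)"
    and \<theta>: "1/2 \<le> \<theta>" "\<theta> \<le> 1" and \<tau>: "0 < \<tau>" and \<delta>: "\<delta> = \<theta> * \<tau>"
    and init: "l2_norm \<Omega> (x 0) = 0" "l2_norm \<Omega> (g 0) = 0"
  defines "A \<equiv> \<lambda>n r. (1/\<tau>) *\<^sub>R (x n r - x (n - 1) r) + (\<theta> *\<^sub>R g n r + (1 - \<theta>) *\<^sub>R g (n - 1) r)"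
    and "\<alpha> \<equiv> \<lambda>n r. (1/\<tau>) *\<^sub>R (y n r - y (n - 1) r) + (\<theta> *\<^sub>R z n r + (1 - \<theta>) *\<^sub>R z (n - 1) r)"
    and "m \<equiv> \<lambda>n r. \<theta> *\<^sub>R y n r + (1 - \<theta>) *\<^sub>R y (n - 1) r"
    and "TW \<equiv> \<lambda>n r. (2 * \<theta>) *\<^sub>R (x n r + \<delta> *\<^sub>R g n r) + (1 - 2 * \<theta>) *\<^sub>R (x (n - 1) r + \<delta> *\<^sub>R g (n - 1) r)"
  assumes scheme: "\<And>n. n \<in> {1..N} \<Longrightarrow>
      l2_inner \<Omega> (A n) (TW n) = l2_inner \<Omega> (\<alpha> n) (TW n) - l2_inner \<Omega> (R n) (TW n)"
    and Amax: "\<And>n. n \<in> {1..N} \<Longrightarrow> l2_norm \<Omega> (\<alpha> n) \<le> K"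
    and Avar: "(\<Sum>n=1..N - 1. l2_norm \<Omega> (\<lambda>r. \<alpha> (Suc n) r - \<alpha> n r)) \<le> S"
    and Rsum: "(\<Sum>n=1..N. \<tau> * l2_norm \<Omega> (R n)) \<le> E"
    and Qsum: "(\<Sum>n=1..N. \<tau> / (2 * \<delta>) * (l2_norm \<Omega> (\<lambda>r. \<delta> *\<^sub>R \<alpha> n r - m n r))\<^sup>2) \<le> Q"
    and n: "n \<in> {1..N}"
  shows "l2_norm \<Omega> (\<lambda>r. x n r + \<delta> *\<^sub>R g n r) \<le> 2 * \<delta> * (K + S) + 6 * E + sqrt Q"
proof -
  have \<delta>0: "0 < \<delta>" using \<delta> \<theta> \<tau> by simp
  define a where "a = (\<lambda>n. l2_inner \<Omega> (x n) (x n) + \<delta>\<^sup>2 * l2_inner \<Omega> (g n) (g n))"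
  define t where "t = (\<lambda>n. l2_norm \<Omega> (\<lambda>r. x n r + \<delta> *\<^sub>R g n r))"
  define M where "M = Max (t ` {..N})"
  have tM: "t n \<le> M" if "n \<le> N" for n unfolding M_def using that by (intro Max_ge) auto
  have t0: "0 \<le> t n" for n by (simp add: t_def)
  have M0: "0 \<le> M" using tM[of 0] t0[of 0] by linarith
  have ta: "(t n)\<^sup>2 = a n" if "n \<le> N" for n
  proof -
    have "l2_inner \<Omega> (x n) (g n) = 0" using skew[OF that that] by simp
    then have "l2_inner \<Omega> (\<lambda>r. x n r + \<delta> *\<^sub>R g n r) (\<lambda>r. x n r + \<delta> *\<^sub>R g n r)
        = l2_inner \<Omega> (x n) (x n) + \<delta> * (\<delta> * l2_inner \<Omega> (g n) (g n))"
      using L(1,2)[OF that] by (simp add: l2_inner_commute[of \<Omega> "g n" "x n"])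
    then show ?thesis by (simp only: t_def a_def l2_norm_power2 power2_eq_square[of \<delta>] mult.assoc)
  qed
  have \<alpha>L: "\<alpha> n \<in> L2_space \<Omega>" if "n \<in> {1..N}" for n
    unfolding \<alpha>_def using L that by auto
  have gM: "\<delta> * l2_norm \<Omega> (g n) \<le> M" if "n \<le> N" for n
  proof -
    have "(\<delta> * l2_norm \<Omega> (g n))\<^sup>2 \<le> (t n)\<^sup>2"
      unfolding ta[OF that] by (simp add: a_def power_mult_distrib l2_norm_power2)
    then have "\<delta> * l2_norm \<Omega> (g n) \<le> t n" by (rule power2_le_imp_le) (rule t0)
    then show ?thesis using tM[OF that] by linarith
  qed
  \<comment> \<open>the coefficients \<open>2 * \<theta>\<close> and \<open>1 - 2 * \<theta>\<close> have absolute values at most 2 and 1\<close>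
  have TWM: "l2_norm \<Omega> (TW n) \<le> 3 * M" if "n \<in> {1..N}" for n
  proof -
    have "l2_norm \<Omega> (TW n) \<le> \<bar>2 * \<theta>\<bar> * t n + \<bar>1 - 2 * \<theta>\<bar> * t (n - 1)"
      unfolding TW_def t_def using L that by (intro l2_norm_lincomb_le) auto
    also have "\<dots> \<le> 2 * M + 1 * M"
      using \<theta> that tM t0 M0 by (intro add_mono mult_mono) auto
    finally show ?thesis by simp
  qed
  have step: "a n - a (n - 1) \<le> \<tau> / (2 * \<delta>) * (l2_norm \<Omega> (\<lambda>r. \<delta> *\<^sub>R \<alpha> n r - m n r))\<^sup>2
      + 2 * \<delta>\<^sup>2 * (l2_inner \<Omega> (\<alpha> n) (g n) - l2_inner \<Omega> (\<alpha> n) (g (n - 1))) + 2 * \<tau> * (l2_norm \<Omega> (R n) * (3 * M))"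
    if n: "n \<in> {1..N}" for n
  proof -
    have nN: "n \<le> N" "n - 1 \<le> N" using n by auto
    have sk: "l2_inner \<Omega> (x n) (g n) = 0" using skew[OF nN(1) nN(1)] by linarith
    have sk': "l2_inner \<Omega> (x (n - 1)) (g (n - 1)) = 0" using skew[OF nN(2) nN(2)] by linarith
    have "a n - a (n - 1) \<le> \<tau> / (2 * \<delta>) * (l2_norm \<Omega> (\<lambda>r. \<delta> *\<^sub>R \<alpha> n r - m n r))\<^sup>2
      + 2 * \<delta>\<^sup>2 * (l2_inner \<Omega> (\<alpha> n) (g n) - l2_inner \<Omega> (\<alpha> n) (g (n - 1))) - 2 * \<tau> * l2_inner \<Omega> (R n) (TW n)"
      unfolding a_def \<alpha>_def m_def TW_def
      by (rule one_step_energy[OF L(1)[OF nN(1)] L(1)[OF nN(2)] L(2)[OF nN(1)] L(2)[OF nN(2)]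
            L(3)[OF nN(1)] L(3)[OF nN(2)] L(4)[OF nN(1)] L(4)[OF nN(2)] L(5)[OF n] sk sk' skew[OF nN]
            orth[OF nN(1) nN(1)] orth[OF nN(1) nN(2)] orth[OF nN(2) nN(1)] orth[OF nN(2) nN(2)]
            mixed[OF nN(1) nN(1)] mixed[OF nN(1) nN(2)] mixed[OF nN(2) nN(1)] mixed[OF nN(2) nN(2)]
            \<theta>(1) \<tau> \<delta> scheme[OF n, unfolded A_def \<alpha>_def TW_def]])
    moreover have "\<bar>l2_inner \<Omega> (R n) (TW n)\<bar> \<le> l2_norm \<Omega> (R n) * (3 * M)"
    proof -
      have "\<bar>l2_inner \<Omega> (R n) (TW n)\<bar> \<le> l2_norm \<Omega> (R n) * l2_norm \<Omega> (TW n)"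
        using L n nN by (intro l2_Cauchy_Schwarz) (auto simp: TW_def)
      also have "\<dots> \<le> l2_norm \<Omega> (R n) * (3 * M)"
        using TWM[OF n] by (intro mult_left_mono) auto
      finally show ?thesis .
    qed
    then have "- (2 * \<tau> * l2_inner \<Omega> (R n) (TW n)) \<le> 2 * \<tau> * (l2_norm \<Omega> (R n) * (3 * M))"
      using mult_left_mono[of "- l2_inner \<Omega> (R n) (TW n)" "l2_norm \<Omega> (R n) * (3 * M)" "2 * \<tau>"] \<tau>
      by linarith
    ultimately show ?thesis by linarith
  qed
  have a0: "a 0 = 0" using init by (simp add: a_def flip: l2_norm_power2)
  have bound: "a k \<le> Q + M * (2 * \<delta> * (K + S) + 6 * E)" if k: "k \<in> {1..N}" for k
  proof -
    obtain j where j: "k = Suc j" using k by (cases k) auto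
    let ?c = "\<lambda>n i. l2_inner \<Omega> (\<alpha> n) (g i)"
    have "a k - a 0 = (\<Sum>n=1..k. a n - a (n - 1))"
      by (induction k) auto
    also have "\<dots> \<le> (\<Sum>n=1..k. \<tau> / (2 * \<delta>) * (l2_norm \<Omega> (\<lambda>r. \<delta> *\<^sub>R \<alpha> n r - m n r))\<^sup>2
        + 2 * \<delta>\<^sup>2 * (?c n n - ?c n (n - 1)) + 2 * \<tau> * (l2_norm \<Omega> (R n) * (3 * M)))"
      using k by (intro sum_mono step) auto
    also have "\<dots> = (\<Sum>n=1..k. \<tau> / (2 * \<delta>) * (l2_norm \<Omega> (\<lambda>r. \<delta> *\<^sub>R \<alpha> n r - m n r))\<^sup>2)
        + 2 * \<delta>\<^sup>2 * (\<Sum>n=1..k. ?c n n - ?c n (n - 1)) + 6 * M * (\<Sum>n=1..k. \<tau> * l2_norm \<Omega> (R n))"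
      by (simp add: sum.distrib sum_distrib_left mult_ac)
    finally have 1: "a k \<le> \<dots>" using a0 by simp
    have "(\<Sum>n=1..k. \<tau> / (2 * \<delta>) * (l2_norm \<Omega> (\<lambda>r. \<delta> *\<^sub>R \<alpha> n r - m n r))\<^sup>2) \<le> Q"
      by (rule order_trans[OF sum_mono2 Qsum]) (use k \<tau> \<delta>0 in auto)
    moreover have "6 * M * (\<Sum>n=1..k. \<tau> * l2_norm \<Omega> (R n)) \<le> 6 * M * E"
      by (rule mult_left_mono[OF order_trans[OF sum_mono2 Rsum]]) (use k \<tau> M0 in auto)
    moreover have "\<delta> * (\<Sum>n=1..k. ?c n n - ?c n (n - 1)) \<le> M * (K + S)"
    proof -
      have cs: "\<bar>\<delta> * l2_inner \<Omega> u (g i)\<bar> \<le> l2_norm \<Omega> u * M" if "u \<in> L2_space \<Omega>" "i \<le> N" for u i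
      proof -
        have "\<bar>\<delta> * l2_inner \<Omega> u (g i)\<bar> \<le> \<delta> * (l2_norm \<Omega> u * l2_norm \<Omega> (g i))"
          unfolding abs_mult using \<delta>0 l2_Cauchy_Schwarz[OF that(1) L(2)[OF that(2)]]
          by (simp add: mult_left_mono)
        also have "\<dots> = l2_norm \<Omega> u * (\<delta> * l2_norm \<Omega> (g i))" by simp
        also have "\<dots> \<le> l2_norm \<Omega> u * M" using gM[OF that(2)] by (intro mult_left_mono) auto
        finally show ?thesis .
      qed
      have c0: "?c 1 0 = 0"
        using l2_Cauchy_Schwarz[OF \<alpha>L L(2), of 1 0] k init by simp
      have "\<delta> * (\<Sum>n=1..k. ?c n n - ?c n (n - 1)) =
          \<delta> * ?c k k + (\<Sum>n=1..j. - (\<delta> * l2_inner \<Omega> (\<lambda>r. \<alpha> (Suc n) r - \<alpha> n r) (g n)))"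
      proof -
        have "l2_inner \<Omega> (\<lambda>r. \<alpha> (Suc n) r - \<alpha> n r) (g n) = ?c (Suc n) n - ?c n n" if "n \<in> {1..j}" for n
          using \<alpha>L[of n] \<alpha>L[of "Suc n"] L(2)[of n] that k j by simp
        then have "(\<Sum>n=1..j. l2_inner \<Omega> (\<lambda>r. \<alpha> (Suc n) r - \<alpha> n r) (g n)) = (\<Sum>n=1..j. ?c (Suc n) n - ?c n n)"
          by (rule sum.cong[OF refl])
        moreover have "(\<Sum>n=1..k. ?c n n - ?c n (n - 1)) = ?c k k - ?c 1 0 - (\<Sum>n=1..j. ?c (Suc n) n - ?c n n)"
          unfolding j by (rule summation_by_parts[of ?c j])
        ultimately have "(\<Sum>n=1..k. ?c n n - ?c n (n - 1)) =
            ?c k k - (\<Sum>n=1..j. l2_inner \<Omega> (\<lambda>r. \<alpha> (Suc n) r - \<alpha> n r) (g n))"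
          unfolding c0 by linarith
        then show ?thesis
          by (simp only: sum_negf sum_distrib_left[symmetric] right_diff_distrib add_uminus_conv_diff)
      qed
      also have "\<dots> \<le> l2_norm \<Omega> (\<alpha> k) * M + (\<Sum>n=1..j. l2_norm \<Omega> (\<lambda>r. \<alpha> (Suc n) r - \<alpha> n r) * M)"
      proof (intro add_mono sum_mono)
        show "\<delta> * ?c k k \<le> l2_norm \<Omega> (\<alpha> k) * M" using cs[OF \<alpha>L[OF k], of k] k by (auto simp: abs_le_iff)
        fix n assume "n \<in> {1..j}"
        then have n: "n \<in> {1..N}" "Suc n \<in> {1..N}" "n \<le> N" using k j by auto
        show "- (\<delta> * l2_inner \<Omega> (\<lambda>r. \<alpha> (Suc n) r - \<alpha> n r) (g n)) \<le> l2_norm \<Omega> (\<lambda>r. \<alpha> (Suc n) r - \<alpha> n r) * M"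
          using cs[OF L2_space_diff[OF \<alpha>L[OF n(2)] \<alpha>L[OF n(1)]] n(3)] by (simp add: abs_le_iff)
      qed
      also have "\<dots> = M * (l2_norm \<Omega> (\<alpha> k) + (\<Sum>n=1..j. l2_norm \<Omega> (\<lambda>r. \<alpha> (Suc n) r - \<alpha> n r)))"
        by (simp add: algebra_simps sum_distrib_left)
      also have "\<dots> \<le> M * (K + S)"
        by (intro mult_left_mono add_mono Amax[OF k] M0 order_trans[OF sum_mono2 Avar]) (use k j in auto)
      finally show ?thesis .
    qed
    then have "2 * \<delta> * (\<delta> * (\<Sum>n=1..k. ?c n n - ?c n (n - 1))) \<le> 2 * \<delta> * (M * (K + S))"
      using \<delta>0 by (intro mult_left_mono) auto
    ultimately show ?thesis using 1 by (simp add: power2_eq_square algebra_simps)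
  qed
  have K0: "0 \<le> K" using Amax[OF n] l2_norm_nonneg[of \<Omega> "\<alpha> n"] by linarith
  have S0: "0 \<le> S" by (rule order_trans[OF sum_nonneg Avar]) simp
  have E0: "0 \<le> E" by (rule order_trans[OF sum_nonneg Rsum]) (use \<tau> in simp)
  have Q0: "0 \<le> Q" by (rule order_trans[OF sum_nonneg Qsum]) (use \<tau> \<delta>0 in simp)
  let ?P = "2 * \<delta> * (K + S) + 6 * E"
  have P0: "0 \<le> ?P" using K0 S0 E0 \<delta>0 by simp
  have "M \<in> t ` {..N}" unfolding M_def by (intro Max_in) auto
  then obtain k where k: "k \<le> N" "M = t k" by auto
  have "M\<^sup>2 \<le> Q + M * ?P"
  proof (cases "k = 0")
    case True
    then show ?thesis using ta[of 0] a0 k M0 P0 Q0 by simp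
  next
    case False
    then show ?thesis using bound[of k] ta[OF k(1)] k by simp
  qed
  then have "M \<le> ?P + sqrt Q" using M0 P0 Q0 by (rule le_of_power2_le)
  then show ?thesis using tM[of n] n by (simp add: t_def)
qed

section \<open>Time norms of the exact solution\<close>

lemma sobolev_norm_nonneg [simp]: "0 \<le> sobolev_norm \<Omega> r u"
proof -
  have "0 \<le> gagliardo s w z" for s and w :: "('a, 'b) vfield" and z
    by (cases z) (simp add: gagliardo_def)
  then have "0 \<le> (\<integral>z. gagliardo s w z \<partial>M)" for s M and w :: "('a, 'b) vfield"
    by (rule Bochner_Integration.integral_nonneg)
  then show ?thesis
    unfolding sobolev_norm_def by (intro real_sqrt_ge_zero add_nonneg_nonneg sum_nonneg) (auto intro!: sum_nonneg)
qed

lemma L2_time_norm_nonneg [simp]: "0 \<le> L2_time_norm T \<nu>X f"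
  by (simp add: L2_time_norm_def)

lemma in_L2_time_sq_integrable:
  assumes "in_L2_time T X N f" "\<And>u. 0 \<le> N u"
  shows "sq_integrable T (\<lambda>t. N (f t))"
  using assms by (intro sq_integrableI) (auto simp: in_L2_time_def)

text \<open>The essential supremum over a nonempty interval of a nonnegative function is neither \<open>-\<infinity>\<close> nor, by
  assumption, \<open>\<infinity>\<close>, so passing to a real number loses nothing.\<close>

lemma in_Linf_time_AE_le:
  assumes f: "in_Linf_time T X N f" and N: "\<And>u. 0 \<le> N u" and T: "0 < T"
  shows "AE t in lebesgue_on {0..T}. N (f t) \<le> Linf_time_norm T N f"
    and "0 \<le> Linf_time_norm T N f"
proof -
  let ?e = "esssup (lebesgue_on {0<..<T}) (\<lambda>t. ereal (N (f t)))"
  have ae: "AE t in lebesgue_on {0..T}. ereal (N (f t)) \<le> ?e"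
    using esssup_AE[of "\<lambda>t. ereal (N (f t))" "lebesgue_on {0<..<T}"]
    unfolding AE_lebesgue_on_open_interval_iff .
  obtain t where "ereal (N (f t)) \<le> ?e"
    using ex_below_mean[OF sq_integrable_const[of 0 T] order_refl T order_refl ae] by auto
  then have e0: "0 \<le> ?e" using N[of "f t"] by (meson ereal_less_eq(5) order_trans)
  moreover have "?e < \<infinity>" using f by (simp add: in_Linf_time_def)
  ultimately have e: "ereal (Linf_time_norm T N f) = ?e"
    unfolding Linf_time_norm_def by (intro ereal_real') auto
  show "AE t in lebesgue_on {0..T}. N (f t) \<le> Linf_time_norm T N f"
    using ae unfolding e[symmetric] by simp
  show "0 \<le> Linf_time_norm T N f" using e0 unfolding e[symmetric] by simp
qed

lemma has_time_derivative_weak: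
  assumes "has_time_derivative \<Omega> T f g" "V \<subseteq> L2_space \<Omega>"
  shows "weak_time_derivative \<Omega> V T f g"
  using assms unfolding has_time_derivative_def weak_time_derivative_def by blast

lemma sum_shift_le:
  fixes f :: "nat \<Rightarrow> real"
  assumes "\<And>n. 0 \<le> f n"
  shows "(\<Sum>n=1..N - 1. f n + f (Suc n)) \<le> 2 * (\<Sum>n=1..N. f n)"
proof -
  have "(\<Sum>n=1..N - 1. f n) \<le> (\<Sum>n=1..N. f n)" by (rule sum_mono2) (use assms in auto)
  moreover have "(\<Sum>n=1..N - 1. f (Suc n)) = (\<Sum>n\<in>Suc ` {1..N - 1}. f n)"
    by (subst sum.reindex) (simp_all add: o_def)
  moreover have "(\<Sum>n\<in>Suc ` {1..N - 1}. f n) \<le> (\<Sum>n=1..N. f n)"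
    by (rule sum_mono2) (use assms in auto)
  ultimately show ?thesis by (simp add: sum.distrib)
qed

section \<open>Elementary estimates for the error terms\<close>

text \<open>With \<open>u = sqrt \<delta> * p1\<close> and \<open>v = p0 / sqrt \<delta>\<close> every summand is at most a multiple of \<open>u\<^sup>2\<close> or \<open>v\<^sup>2\<close>, because
  \<open>\<delta> p0\<^sup>2 \<le> v\<^sup>2\<close> for \<open>\<delta> \<le> 1\<close>. The numbers \<open>p0, p1\<close> stand for \<open>h\<^sup>r, h\<^sup>r\<^sup>-\<^sup>1\<close> and \<open>n\<close> for the full norm of \<open>U\<close>.\<close>

lemma stability_term_le:
  fixes \<delta> c p0 p1 S0 S1 n :: real
  assumes \<delta>: "0 < \<delta>" "\<delta> \<le> 1" and "0 \<le> c" "0 \<le> p0" "0 \<le> p1" "0 \<le> S0" "0 \<le> S1" "S0 + S1 \<le> n"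
  shows "sqrt (3/2 * (\<delta> * (c * p0)\<^sup>2 * S1\<^sup>2 + (2 * \<delta> * (c * p1)\<^sup>2 + 2 / \<delta> * (c * p0)\<^sup>2) * (S0\<^sup>2 + 4 * S1\<^sup>2)))
    \<le> 4 * c * (sqrt \<delta> * p1 + p0 / sqrt \<delta>) * n"
proof -
  define u v where "u = sqrt \<delta> * p1" and "v = p0 / sqrt \<delta>"
  have uv: "0 \<le> u" "0 \<le> v" using assms by (simp_all add: u_def v_def)
  have u2: "\<delta> * p1\<^sup>2 = u\<^sup>2" and v2: "p0\<^sup>2 / \<delta> = v\<^sup>2"
    using \<delta> by (simp_all add: u_def v_def power_mult_distrib power_divide)
  have "\<delta> * p0\<^sup>2 \<le> p0\<^sup>2 / \<delta>"
  proof -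
    have "\<delta> * p0\<^sup>2 \<le> 1 * p0\<^sup>2" using \<delta> by (intro mult_right_mono) auto
    also have "1 * p0\<^sup>2 \<le> p0\<^sup>2 / \<delta>" using \<delta> by (simp add: pos_le_divide_eq mult_left_le)
    finally show ?thesis .
  qed
  then have w: "\<delta> * p0\<^sup>2 \<le> v\<^sup>2" by (simp only: v2)
  have n: "0 \<le> n" "S1 \<le> n" using assms by auto
  have "S1\<^sup>2 \<le> n\<^sup>2" using n assms by (intro power_mono) auto
  have "(S0 + S1)\<^sup>2 \<le> n\<^sup>2" using assms by (intro power_mono) auto
  moreover have "0 \<le> S0 * S1" using assms by simp
  ultimately have S: "S0\<^sup>2 + 4 * S1\<^sup>2 \<le> 4 * n\<^sup>2" using zero_le_power2[of S0] unfolding power2_sum by linarith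
  have "3/2 * (\<delta> * (c * p0)\<^sup>2 * S1\<^sup>2 + (2 * \<delta> * (c * p1)\<^sup>2 + 2 / \<delta> * (c * p0)\<^sup>2) * (S0\<^sup>2 + 4 * S1\<^sup>2))
      = 3/2 * (c\<^sup>2 * ((\<delta> * p0\<^sup>2) * S1\<^sup>2 + (2 * (\<delta> * p1\<^sup>2) + 2 * (p0\<^sup>2 / \<delta>)) * (S0\<^sup>2 + 4 * S1\<^sup>2)))"
    by (simp add: power_mult_distrib algebra_simps add_divide_distrib)
  also have "\<dots> \<le> 3/2 * (c\<^sup>2 * (v\<^sup>2 * n\<^sup>2 + (2 * u\<^sup>2 + 2 * v\<^sup>2) * (4 * n\<^sup>2)))"
    unfolding u2 v2 using w S \<open>S1\<^sup>2 \<le> n\<^sup>2\<close> by (intro mult_left_mono add_mono mult_mono) auto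
  also have "\<dots> \<le> (4 * c * (u + v) * n)\<^sup>2"
  proof -
    have "3/2 * (v\<^sup>2 + 8 * u\<^sup>2 + 8 * v\<^sup>2) \<le> 16 * (u + v)\<^sup>2"
    proof -
      have "16 * (u + v)\<^sup>2 - 3/2 * (v\<^sup>2 + 8 * u\<^sup>2 + 8 * v\<^sup>2) = 5/2 * v\<^sup>2 + 4 * u\<^sup>2 + 32 * (u * v)"
        by (simp add: power2_eq_square algebra_simps)
      moreover have "0 \<le> 5/2 * v\<^sup>2 + 4 * u\<^sup>2 + 32 * (u * v)" using uv by simp
      ultimately show ?thesis by linarith
    qed
    then have "(c\<^sup>2 * n\<^sup>2) * (3/2 * (v\<^sup>2 + 8 * u\<^sup>2 + 8 * v\<^sup>2)) \<le> (c\<^sup>2 * n\<^sup>2) * (16 * (u + v)\<^sup>2)"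
      by (intro mult_left_mono) auto
    moreover have "3/2 * (c\<^sup>2 * (v\<^sup>2 * n\<^sup>2 + (2 * u\<^sup>2 + 2 * v\<^sup>2) * (4 * n\<^sup>2)))
        = (c\<^sup>2 * n\<^sup>2) * (3/2 * (v\<^sup>2 + 8 * u\<^sup>2 + 8 * v\<^sup>2))" by (simp add: algebra_simps)
    moreover have "(4 * c * (u + v) * n)\<^sup>2 = (c\<^sup>2 * n\<^sup>2) * (16 * (u + v)\<^sup>2)" by (simp add: power_mult_distrib)
    ultimately show ?thesis by (simp only:)
  qed
  finally have "sqrt (3/2 * (\<delta> * (c * p0)\<^sup>2 * S1\<^sup>2 + (2 * \<delta> * (c * p1)\<^sup>2 + 2 / \<delta> * (c * p0)\<^sup>2) * (S0\<^sup>2 + 4 * S1\<^sup>2)))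
      \<le> sqrt ((4 * c * (u + v) * n)\<^sup>2)"
    by (rule real_sqrt_le_mono)
  then show ?thesis using assms uv n by (simp add: u_def v_def)
qed

text \<open>Contributions of order \<open>h\<^sup>r\<close> are of order \<open>d h\<^sup>r\<^sup>-\<^sup>1\<close> here. They occur with a factor \<open>sqrt T\<close> and could not
  be hidden in \<open>\<delta>\<^sup>-\<^sup>1\<^sup>/\<^sup>2 h\<^sup>r\<close>.\<close>

lemma variation_term_le:
  fixes \<delta> c p0 p1 S1 S2 L0 L1 n d T' :: real
  assumes \<delta>: "0 < \<delta>" "\<delta> \<le> 1" and c: "0 \<le> c" and p: "0 \<le> p0" "0 \<le> p1" "p0 \<le> d * p1" and d: "0 \<le> d" and T': "0 \<le> T'"
    and S: "0 \<le> S1" "0 \<le> S2" "S1 \<le> n" "S2 \<le> n" and L: "0 \<le> L0" "0 \<le> L1" "L0 \<le> n" "L1 \<le> n"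
  shows "2 * \<delta> * ((c * p0 * L1 + c * p1 * L0) + 2 * T' * (c * p0 * S2 + c * p1 * S1))
    \<le> 4 * c * (d + 1) * ((1 + T') * sqrt \<delta> * p1 * n)"
proof -
  have n: "0 \<le> n" using S by simp
  have *: "c * p0 * a + c * p1 * b \<le> c * (d + 1) * p1 * n" if "0 \<le> a" "a \<le> n" "0 \<le> b" "b \<le> n" for a b
  proof -
    have "c * p0 * a \<le> c * (d * p1) * n" using that c p d by (intro mult_mono) auto
    moreover have "c * p1 * b \<le> c * p1 * n" using that c p by (intro mult_left_mono) auto
    ultimately show ?thesis by (simp add: algebra_simps)
  qed
  let ?X = "c * (d + 1) * p1 * n"
  have X: "0 \<le> ?X" using c d p n by simp
  have \<delta>s: "\<delta> \<le> sqrt \<delta>" using \<delta> by (intro real_le_rsqrt) (simp add: power2_eq_square mult_left_le)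
  have "(c * p0 * L1 + c * p1 * L0) + 2 * T' * (c * p0 * S2 + c * p1 * S1) \<le> ?X + 2 * T' * ?X"
    using T' by (intro add_mono mult_left_mono * L S) auto
  also have "\<dots> \<le> 2 * (1 + T') * ?X" using X by (simp add: algebra_simps)
  finally have "2 * \<delta> * ((c * p0 * L1 + c * p1 * L0) + 2 * T' * (c * p0 * S2 + c * p1 * S1)) \<le> 2 * \<delta> * (2 * (1 + T') * ?X)"
    using \<delta> by (intro mult_left_mono) auto
  also have "\<dots> \<le> 2 * sqrt \<delta> * (2 * (1 + T') * ?X)"
    using \<delta>s X T' by (intro mult_right_mono) auto
  also have "\<dots> = 4 * c * (d + 1) * ((1 + T') * sqrt \<delta> * p1 * n)" by algebra
  finally show ?thesis .
qed

section \<open>Projection and consistency errors at the nodes\<close>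

text \<open>All data of one run of the scheme. The number \<open>d\<close> bounds the mesh size independently of the mesh.\<close>

locale theta_scheme =
  fixes \<Omega> :: "(real^'d) set" and V :: "('d::finite, 'm::finite) vfield set"
    and G :: "('d, 'm) vfield \<Rightarrow> ('d, 'm) vfield" and M k Vh
    and T r Capp h d \<theta> \<tau> \<delta> :: real and N :: nat
    and F :: "real \<Rightarrow> ('d, 'm) vfield" and U0 :: "('d, 'm) vfield"
    and dU :: "nat \<Rightarrow> real \<Rightarrow> ('d, 'm) vfield" and Uh :: "nat \<Rightarrow> ('d, 'm) vfield"
  assumes \<Omega>: "\<Omega> \<in> sets lebesgue"
    and V: "V \<subseteq> L2_space \<Omega>" "field_subspace V" "dense_in_L2 \<Omega> V"
    and G: "linear_into_L2 \<Omega> V G" "skew_symmetric \<Omega> V G"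
    and Vh: "fe_space V M k Vh"
    and T: "0 < T" and h: "0 < h" "h \<le> d"
    and \<theta>: "1/2 \<le> \<theta>" "\<theta> \<le> 1" and \<tau>: "0 < \<tau>" and \<delta>: "\<delta> = \<theta> * \<tau>" "\<delta> \<le> 1"
    and N: "real N * \<tau> \<le> T"
    and dU: "\<And>j. j < 4 \<Longrightarrow> has_time_derivative \<Omega> T (dU j) (dU (Suc j))"
    and sol: "exact_solution \<Omega> V G T F U0 (dU 0) (dU 1)"
    and reg: "finite_norms \<Omega> T r dU"
    and approx: "\<And>j. j \<le> 2 \<Longrightarrow> AE t in lebesgue_on {0<..<T}. dU j t \<in> V \<and>
        l2_norm \<Omega> (\<lambda>x. dU j t x - l2_projection \<Omega> Vh (dU j t) x) +
        h * l2_norm \<Omega> (G (\<lambda>x. dU j t x - l2_projection \<Omega> Vh (dU j t) x))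
        \<le> Capp * (h powr r * sobolev_norm \<Omega> r (dU j t))"
    and Uh: "\<And>n. n \<le> N \<Longrightarrow> Uh n \<in> Vh"
    and Uh0: "AE x in lebesgue_on \<Omega>. Uh 0 x = l2_projection \<Omega> Vh (dU 0 0) x"
    and scheme: "\<And>n W. n \<in> {1..N} \<Longrightarrow> W \<in> Vh \<Longrightarrow>
        l2_inner \<Omega> (A_tau G \<tau> \<theta> Uh n) (T_delta G \<delta> W) =
        l2_inner \<Omega> (M_theta \<theta> (\<lambda>i. F (real i * \<tau>)) n) (T_delta G \<delta> W)"
begin

sublocale fe_subspace \<Omega> V Vh M k
  by unfold_locales (use V Vh in auto)

sublocale test_space \<Omega> V T
  by unfold_locales (use V in auto)

lemma V_L2: "v \<in> V \<Longrightarrow> v \<in> L2_space \<Omega>" using V(1) by blast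

lemma V_lincomb: "u \<in> V \<Longrightarrow> v \<in> V \<Longrightarrow> (\<lambda>x. a *\<^sub>R u x + b *\<^sub>R v x) \<in> V"
  using V(2) by (simp add: field_subspace_def)

lemma V_diff: "u \<in> V \<Longrightarrow> v \<in> V \<Longrightarrow> (\<lambda>x. u x - v x) \<in> V"
  using V_lincomb[of u v 1 "-1"] by simp

lemma G_L2: "v \<in> V \<Longrightarrow> G v \<in> L2_space \<Omega>"
  using G(1) by (simp add: linear_into_L2_def)

lemma G_lincomb: "u \<in> V \<Longrightarrow> v \<in> V \<Longrightarrow>
    AE x in lebesgue_on \<Omega>. G (\<lambda>y. a *\<^sub>R u y + b *\<^sub>R v y) x = a *\<^sub>R G u x + b *\<^sub>R G v x"
  using G(1) by (simp add: linear_into_L2_def)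

lemma G_skew: "u \<in> V \<Longrightarrow> v \<in> V \<Longrightarrow> l2_inner \<Omega> (G u) v = - l2_inner \<Omega> u (G v)"
  using G(2) by (simp add: skew_symmetric_def)

text \<open>Skew symmetry and density make the operator well defined on classes modulo null sets. It is
  needed at time 0, where the discrete error vanishes only almost everywhere.\<close>

lemma G_null:
  assumes u: "u \<in> V" and 0: "l2_norm \<Omega> u = 0"
  shows "l2_norm \<Omega> (G u) = 0"
proof -
  have "l2_norm \<Omega> (G u) \<le> 0"
  proof (rule norm_le_by_testing[OF G_L2[OF u]])
    fix v assume v: "v \<in> V"
    show "\<bar>l2_inner \<Omega> (G u) v\<bar> \<le> l2_norm \<Omega> v * 0"
      using l2_Cauchy_Schwarz[OF V_L2[OF u] G_L2[OF v]] 0 by (simp add: G_skew[OF u v])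
  qed simp
  then show ?thesis using l2_norm_nonneg[of \<Omega> "G u"] by linarith
qed

definition sob :: "nat \<Rightarrow> real \<Rightarrow> real" where "sob j t = sobolev_norm \<Omega> r (dU j t)"

definition eta :: "nat \<Rightarrow> real \<Rightarrow> ('d, 'm) vfield" where
  "eta j t = (\<lambda>x. dU j t x - l2_projection \<Omega> Vh (dU j t) x)"

text \<open>The approximation constants for a field and for its image under the operator.\<close>

abbreviation P0 :: real where "P0 \<equiv> \<bar>Capp\<bar> * h powr r"
abbreviation P1 :: real where "P1 \<equiv> \<bar>Capp\<bar> * h powr (r - 1)"

lemma P0_eq: "P0 = h * P1"
  using h by (simp add: powr_diff)

lemma sob_sq_integrable: "j \<le> 2 \<Longrightarrow> sq_integrable T (sob j)"
  using reg in_L2_time_sq_integrable[of T _ "sobolev_norm \<Omega> r" "dU j"]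
  unfolding finite_norms_def sob_def[abs_def] by auto

lemma dU_L2: "j \<le> 3 \<Longrightarrow> t \<in> {0..T} \<Longrightarrow> dU j t \<in> L2_space \<Omega>"
  using dU[of j] by (simp add: has_time_derivative_def)

lemma eta_L2: "j \<le> 3 \<Longrightarrow> t \<in> {0..T} \<Longrightarrow> eta j t \<in> L2_space \<Omega>"
  unfolding eta_def using dU_L2 l2_projection_in Vh_L2 by auto

lemma U_V: "t \<in> {0..T} \<Longrightarrow> dU 0 t \<in> V"
  using sol by (simp add: exact_solution_def)

lemma eta_V: "dU j t \<in> V \<Longrightarrow> eta j t \<in> V"
  unfolding eta_def using V_diff l2_projection_in V_L2 Vh_subset by blast

lemma approx_eta:
  assumes j: "j \<le> 2"
  shows "AE t in lebesgue_on {0..T}. t \<in> {0..T} \<and> dU j t \<in> V \<and>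
    l2_norm \<Omega> (eta j t) \<le> P0 * sob j t \<and> l2_norm \<Omega> (G (eta j t)) \<le> P1 * sob j t"
  using approx[OF j] AE_space unfolding AE_lebesgue_on_open_interval_iff
proof eventually_elim
  case (elim t)
  have s: "0 \<le> h powr r * sob j t" by (simp add: sob_def)
  have "l2_norm \<Omega> (eta j t) + h * l2_norm \<Omega> (G (eta j t)) \<le> Capp * (h powr r * sob j t)"
    using elim by (simp add: eta_def sob_def)
  also have "\<dots> \<le> \<bar>Capp\<bar> * (h powr r * sob j t)" by (rule mult_right_mono[OF abs_ge_self s])
  finally have le: "l2_norm \<Omega> (eta j t) + h * l2_norm \<Omega> (G (eta j t)) \<le> P0 * sob j t" by simp
  have "0 \<le> h * l2_norm \<Omega> (G (eta j t))" using h by simp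
  then have 1: "l2_norm \<Omega> (eta j t) \<le> P0 * sob j t" using le by linarith
  have "h * l2_norm \<Omega> (G (eta j t)) \<le> P0 * sob j t"
    using le l2_norm_nonneg[of \<Omega> "eta j t"] by linarith
  also have "\<dots> = h * (P1 * sob j t)" by (simp only: P0_eq mult.assoc)
  finally have "h * l2_norm \<Omega> (G (eta j t)) \<le> h * (P1 * sob j t)" .
  then have "l2_norm \<Omega> (G (eta j t)) \<le> P1 * sob j t" using h(1) by (simp only: mult_le_cancel_left_pos)
  with 1 elim show ?case by simp
qed

lemma eta_dominated:
  assumes j: "j \<le> 2"
  shows "dominated \<Omega> T (eta j) (\<lambda>t. P0 * sob j t)"
  unfolding dominated_def
proof
  show "sq_integrable T (\<lambda>t. P0 * sob j t)" by (rule sq_integrable_scale[OF sob_sq_integrable[OF j]]) simp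
  show "AE t in lebesgue_on {0..T}. eta j t \<in> L2_space \<Omega> \<and> l2_norm \<Omega> (eta j t) \<le> P0 * sob j t"
    using approx_eta[OF j] by eventually_elim (use eta_L2[of j] j in auto)
qed

lemma G_eta_dominated:
  assumes j: "j \<le> 2"
  shows "dominated \<Omega> T (\<lambda>t. G (eta j t)) (\<lambda>t. P1 * sob j t)"
  unfolding dominated_def
proof
  show "sq_integrable T (\<lambda>t. P1 * sob j t)" by (rule sq_integrable_scale[OF sob_sq_integrable[OF j]]) simp
  show "AE t in lebesgue_on {0..T}. G (eta j t) \<in> L2_space \<Omega> \<and> l2_norm \<Omega> (G (eta j t)) \<le> P1 * sob j t"
    using approx_eta[OF j] by eventually_elim (use eta_V G_L2 in auto)
qed

text \<open>By self-adjointness, testing \<open>eta j\<close> with \<open>v\<close> means testing \<open>dU j\<close> with \<open>v - \<Pi>\<^sub>h v\<close>. All square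
  integrable test fields are kept because the derivative of \<open>G (eta 0)\<close> is found by testing with \<open>G v\<close>,
  which need not lie in \<open>V\<close>.\<close>

lemma eta_weak_derivative:
  assumes j: "j \<le> 2"
  shows "weak_time_derivative \<Omega> (L2_space \<Omega>) T (eta j) (eta (Suc j))"
  unfolding weak_time_derivative_def
proof (intro conjI ballI allI impI)
  show "eta j t \<in> L2_space \<Omega>" if "t \<in> {0..T}" for t using eta_L2 j that by auto
  fix a b and v :: "('d, 'm) vfield"
  assume ab: "0 \<le> a \<and> a \<le> b \<and> b \<le> T" and v: "v \<in> L2_space \<Omega>"
  let ?v = "\<lambda>x. v x - l2_projection \<Omega> Vh v x"
  have vL: "?v \<in> L2_space \<Omega>" using v l2_projection_in Vh_L2 by auto
  have *: "l2_inner \<Omega> (eta i t) v = l2_inner \<Omega> (dU i t) ?v" if "i \<le> 3" "t \<in> {0..T}" for i t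
    unfolding eta_def by (rule l2_projection_selfadjoint) (use dU_L2 that v in auto)
  have "l2_inner \<Omega> (eta j b) v - l2_inner \<Omega> (eta j a) v = (\<integral>t. l2_inner \<Omega> (dU (Suc j) t) ?v \<partial>lebesgue_on {a..b})"
    using dU[of j] j ab vL by (simp add: * has_time_derivative_def)
  also have "\<dots> = (\<integral>t. l2_inner \<Omega> (eta (Suc j) t) v \<partial>lebesgue_on {a..b})"
    using j ab by (intro Bochner_Integration.integral_cong) (auto simp: *)
  finally show "l2_inner \<Omega> (eta j b) v - l2_inner \<Omega> (eta j a) v = (\<integral>t. l2_inner \<Omega> (eta (Suc j) t) v \<partial>lebesgue_on {a..b})" .
qed

lemma eta_weak: "j \<le> 2 \<Longrightarrow> weak_time_derivative \<Omega> V T (eta j) (eta (Suc j))"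
  using eta_weak_derivative V(1) unfolding weak_time_derivative_def by blast

lemma eta_weak_0: "weak_time_derivative \<Omega> V T (eta 0) (eta 1)"
  and eta_weak_1: "weak_time_derivative \<Omega> V T (eta 1) (eta 2)"
  using eta_weak[of 0] eta_weak[of 1] by (simp_all add: numeral_2_eq_2)

text \<open>Skew symmetry moves the operator onto the test field before and after differentiating.\<close>

lemma G_eta_weak: "weak_time_derivative \<Omega> V T (\<lambda>t. G (eta 0 t)) (\<lambda>t. G (eta 1 t))"
  unfolding weak_time_derivative_def
proof (intro conjI ballI allI impI)
  show "G (eta 0 t) \<in> L2_space \<Omega>" if "t \<in> {0..T}" for t using G_L2 eta_V U_V that by auto
  fix a b v
  assume ab: "0 \<le> a \<and> a \<le> b \<and> b \<le> T" and v: "v \<in> V"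
  have "l2_inner \<Omega> (eta 0 b) (G v) - l2_inner \<Omega> (eta 0 a) (G v) = (\<integral>t. l2_inner \<Omega> (eta 1 t) (G v) \<partial>lebesgue_on {a..b})"
    using eta_weak_derivative[of 0] ab G_L2[OF v] by (simp add: weak_time_derivative_def)
  moreover have "(\<integral>t. - l2_inner \<Omega> (eta 1 t) (G v) \<partial>lebesgue_on {a..b}) = (\<integral>t. l2_inner \<Omega> (G (eta 1 t)) v \<partial>lebesgue_on {a..b})"
  proof (rule integral_cong_AE_lebesgue_on)
    have "AE t in lebesgue_on {0..T}. dU 1 t \<in> V"
      using approx_eta[of 1] by (auto elim!: eventually_mono)
    then have "AE t in lebesgue_on {a..b}. dU 1 t \<in> V"
      by (rule AE_lebesgue_on_mono) (use ab in auto)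
    then show "AE t in lebesgue_on {a..b}. - l2_inner \<Omega> (eta 1 t) (G v) = l2_inner \<Omega> (G (eta 1 t)) v"
      by eventually_elim (simp add: G_skew[OF eta_V v])
  qed simp
  ultimately show "l2_inner \<Omega> (G (eta 0 b)) v - l2_inner \<Omega> (G (eta 0 a)) v = (\<integral>t. l2_inner \<Omega> (G (eta 1 t)) v \<partial>lebesgue_on {a..b})"
    using ab by (simp add: G_skew[OF eta_V[OF U_V] v])
qed

definition node :: "nat \<Rightarrow> real" where "node n = real n * \<tau>"

lemma node_in: "n \<le> N \<Longrightarrow> node n \<in> {0..T}"
  using \<tau> order_trans[OF mult_right_mono[of "real n" "real N" \<tau>] N] by (auto simp: node_def)

lemma node_diff: "n \<in> {1..N} \<Longrightarrow> node n - node (n - 1) = \<tau>"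
  by (simp add: node_def algebra_simps)

lemma node_pred:
  assumes "n \<in> {1..N}"
  shows "0 \<le> node (n - 1)" "node (n - 1) < node n" "node (n - 1) \<le> node n" "node n \<le> T"
  using assms \<tau> node_in[of n] node_diff[OF assms] by (auto simp: node_def)

definition step_osc :: "(real \<Rightarrow> real) \<Rightarrow> nat \<Rightarrow> real" where
  "step_osc s n = sqrt (\<tau> * energy s (node (n - 1)) (node n))"

lemma step_osc_nonneg [simp]: "0 \<le> step_osc s n"
  using \<tau> by (simp add: step_osc_def)

lemma osc_node: "n \<in> {1..N} \<Longrightarrow> osc s (node (n - 1)) (node n) = step_osc s n"
  by (simp only: node_diff step_osc_def)

lemma step_osc_scale: "0 \<le> c \<Longrightarrow> step_osc (\<lambda>t. c * s t) n = c * step_osc s n"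
  unfolding step_osc_def energy_scale by (simp add: real_sqrt_mult)

text \<open>The letters of \<open>discrete_stability\<close>: the projection error at the nodes and its image.\<close>

abbreviation y :: "nat \<Rightarrow> ('d, 'm) vfield" where "y n \<equiv> eta 0 (node n)"
abbreviation z :: "nat \<Rightarrow> ('d, 'm) vfield" where "z n \<equiv> G (y n)"

lemma y_V: "n \<le> N \<Longrightarrow> y n \<in> V" using eta_V U_V node_in by auto
lemma y_L2: "n \<le> N \<Longrightarrow> y n \<in> L2_space \<Omega>" using y_V V_L2 by auto
lemma z_L2: "n \<le> N \<Longrightarrow> z n \<in> L2_space \<Omega>" using y_V G_L2 by auto

abbreviation L :: "nat \<Rightarrow> real" where "L j \<equiv> Linf_time_norm T (sobolev_norm \<Omega> r) (dU j)"
abbreviation S :: "nat \<Rightarrow> real" where "S j \<equiv> L2_time_norm T (sobolev_norm \<Omega> r) (dU j)"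

lemma L_bound: "j \<le> 1 \<Longrightarrow> AE t in lebesgue_on {0..T}. sob j t \<le> L j"
  and L_nonneg: "j \<le> 1 \<Longrightarrow> 0 \<le> L j"
  using reg T in_Linf_time_AE_le[of T _ "sobolev_norm \<Omega> r" "dU j"]
  unfolding finite_norms_def sob_def by auto

lemma S_energy: "j \<le> 2 \<Longrightarrow> energy (sob j) 0 T = (S j)\<^sup>2"
  using L2_time_norm_power2[of T "sobolev_norm \<Omega> r" "dU j"] sob_sq_integrable[of j]
  by (simp add: sob_def[abs_def])

lemma sum_step_osc_sob: "j \<le> 2 \<Longrightarrow> (\<Sum>n=1..N. step_osc (sob j) n) \<le> sqrt T * S j"
  using sum_sqrt_energy[OF sob_sq_integrable \<tau> N, of j] S_energy[of j] by (simp add: step_osc_def node_def)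

lemma y_increment:
  assumes n: "n \<in> {1..N}"
  shows "l2_norm \<Omega> (\<lambda>x. y n x - y (n - 1) x) \<le> P0 * step_osc (sob 1) n"
proof -
  have "l2_norm \<Omega> (\<lambda>x. y n x - y (n - 1) x) \<le> osc (\<lambda>t. P0 * sob 1 t) (node (n - 1)) (node n)"
    by (rule increment_norm_le[OF eta_weak_0 eta_dominated node_pred(1,3,4)[OF n]]) simp
  then show ?thesis unfolding osc_node[OF n] by (simp only: step_osc_scale mult_nonneg_nonneg abs_ge_zero powr_ge_zero)
qed

text \<open>A version with the maximum in time, for the boundary term of the summation by parts. It is the same
  estimate with a constant majorant.\<close>

lemma y_increment_max:
  assumes n: "n \<in> {1..N}"
  shows "l2_norm \<Omega> (\<lambda>x. y n x - y (n - 1) x) \<le> \<tau> * (P0 * L 1)"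
proof -
  have "AE t in lebesgue_on {0..T}. eta 1 t \<in> L2_space \<Omega> \<and> l2_norm \<Omega> (eta 1 t) \<le> P0 * L 1"
    using approx_eta[OF one_le_numeral] L_bound[OF order_refl]
  proof eventually_elim
    case (elim t)
    then have "P0 * sob 1 t \<le> P0 * L 1" by (intro mult_left_mono) auto
    then show ?case using elim eta_L2[of 1 t] by auto
  qed
  then have "dominated \<Omega> T (eta 1) (\<lambda>t. P0 * L 1)"
    unfolding dominated_def using L_nonneg[OF order_refl] sq_integrable_const[of "P0 * L 1" T] by simp
  from increment_norm_le[OF eta_weak_0 this node_pred(1,3,4)[OF n]]
  have "l2_norm \<Omega> (\<lambda>x. y n x - y (n - 1) x) \<le> sqrt (\<tau> * ((P0 * L 1)\<^sup>2 * \<tau>))"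
    unfolding energy_const[OF node_pred(3)[OF n]] node_diff[OF n] .
  also have "\<tau> * ((P0 * L 1)\<^sup>2 * \<tau>) = (\<tau> * (P0 * L 1))\<^sup>2" by (simp add: power2_eq_square)
  also have "sqrt \<dots> = \<tau> * (P0 * L 1)"
    using \<tau> L_nonneg[OF order_refl] by (intro real_sqrt_unique) auto
  finally show ?thesis .
qed

lemma z_increment:
  assumes n: "n \<in> {1..N}"
  shows "l2_norm \<Omega> (\<lambda>x. z n x - z (n - 1) x) \<le> P1 * step_osc (sob 1) n"
proof -
  have "l2_norm \<Omega> (\<lambda>x. z n x - z (n - 1) x) \<le> osc (\<lambda>t. P1 * sob 1 t) (node (n - 1)) (node n)"
    by (rule increment_norm_le[OF G_eta_weak G_eta_dominated node_pred(1,3,4)[OF n]]) simp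
  then show ?thesis unfolding osc_node[OF n] by (simp only: step_osc_scale mult_nonneg_nonneg abs_ge_zero powr_ge_zero)
qed

lemma y_second_difference:
  assumes n: "n \<in> {1..N}" "Suc n \<in> {1..N}"
  shows "l2_norm \<Omega> (\<lambda>x. (y (Suc n) x - y n x) - (y n x - y (n - 1) x))
    \<le> \<tau> * (P0 * step_osc (sob 2) n + P0 * step_osc (sob 2) (Suc n))"
proof -
  have "l2_norm \<Omega> (\<lambda>x. (y (Suc n) x - y n x) - (y n x - y (n - 1) x)) \<le>
     \<tau> * (osc (\<lambda>t. P0 * sob 2 t) (node (n - 1)) (node n) + osc (\<lambda>t. P0 * sob 2 t) (node n) (node (Suc n)))"
    by (rule second_difference_le[OF eta_weak_0 eta_weak_1 eta_dominated[OF order_refl]])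
      (use node_pred[OF n(1)] node_pred[OF n(2)] node_diff[OF n(1)] node_diff[OF n(2)] in auto)
  then show ?thesis
    using osc_node[OF n(1), of "\<lambda>t. P0 * sob 2 t"] osc_node[OF n(2), of "\<lambda>t. P0 * sob 2 t"]
    by (simp add: step_osc_scale)
qed

lemma y_sampled:
  assumes n: "n \<in> {1..N}" and i: "i \<in> {n - 1, n}"
  shows "\<tau> * (l2_norm \<Omega> (y i))\<^sup>2 \<le>
    2 * P0\<^sup>2 * (energy (sob 0) (node (n - 1)) (node n) + \<tau>\<^sup>2 * energy (sob 1) (node (n - 1)) (node n))"
proof -
  have i': "node i \<in> {node (n - 1)..node n}" using i node_pred(3)[OF n] by auto
  show ?thesis
    using sampled_norm_le[OF eta_weak_0 eta_dominated[OF one_le_numeral] eta_dominated[OF zero_le] node_pred(1,2,4)[OF n] i']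
    unfolding node_diff[OF n] energy_scale by (simp only: distrib_left mult_ac)
qed

lemma z_sampled:
  assumes n: "n \<in> {1..N}" and i: "i \<in> {n - 1, n}"
  shows "\<tau> * (l2_norm \<Omega> (z i))\<^sup>2 \<le>
    2 * P1\<^sup>2 * (energy (sob 0) (node (n - 1)) (node n) + \<tau>\<^sup>2 * energy (sob 1) (node (n - 1)) (node n))"
proof -
  have i': "node i \<in> {node (n - 1)..node n}" using i node_pred(3)[OF n] by auto
  show ?thesis
    using sampled_norm_le[OF G_eta_weak G_eta_dominated[OF one_le_numeral] G_eta_dominated[OF zero_le] node_pred(1,2,4)[OF n] i']
    unfolding node_diff[OF n] energy_scale by (simp only: distrib_left mult_ac)
qed

lemma y_max: assumes n: "n \<le> N" shows "l2_norm \<Omega> (y n) \<le> P0 * L 0"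
proof (rule norm_le_everywhere[OF eta_weak_0 eta_dominated[OF one_le_numeral] _ _ node_in[OF n] T])
  show "AE t in lebesgue_on {0..T}. l2_norm \<Omega> (eta 0 t) \<le> P0 * L 0"
    using approx_eta[OF zero_le] L_bound[OF zero_le]
  proof eventually_elim
    case (elim t)
    then have "P0 * sob 0 t \<le> P0 * L 0" by (intro mult_left_mono) auto
    then show ?case using elim by auto
  qed
qed (use L_nonneg[of 0] in auto)

lemma z_max: assumes n: "n \<le> N" shows "l2_norm \<Omega> (z n) \<le> P1 * L 0"
proof (rule norm_le_everywhere[OF G_eta_weak G_eta_dominated[OF one_le_numeral] _ _ node_in[OF n] T])
  show "AE t in lebesgue_on {0..T}. l2_norm \<Omega> (G (eta 0 t)) \<le> P1 * L 0"
    using approx_eta[OF zero_le] L_bound[OF zero_le]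
  proof eventually_elim
    case (elim t)
    then have "P1 * sob 0 t \<le> P1 * L 0" by (intro mult_left_mono) auto
    then show ?case using elim by auto
  qed
qed (use L_nonneg[of 0] in auto)

text \<open>The consistency error in time: the trapezoidal error plus the deviation of \<open>\<theta>\<close> from 1/2.\<close>

definition R :: "nat \<Rightarrow> ('d, 'm) vfield" where
  "R n = (\<lambda>x. (1/\<tau>) *\<^sub>R (dU 0 (node n) x - dU 0 (node (n - 1)) x)
    - (\<theta> *\<^sub>R dU 1 (node n) x + (1 - \<theta>) *\<^sub>R dU 1 (node (n - 1)) x))"

abbreviation norm_dU :: "nat \<Rightarrow> real \<Rightarrow> real" where "norm_dU j t \<equiv> l2_norm \<Omega> (dU j t)"
abbreviation Z :: "nat \<Rightarrow> real" where "Z j \<equiv> L2_time_norm T (l2_norm \<Omega>) (dU j)"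

lemma dU_node_L2: "j \<le> 3 \<Longrightarrow> n \<le> N \<Longrightarrow> dU j (node n) \<in> L2_space \<Omega>"
  using dU_L2 node_in by blast

lemma R_L2: "n \<in> {1..N} \<Longrightarrow> R n \<in> L2_space \<Omega>"
  unfolding R_def by (intro L2_space_diff L2_space_add L2_space_scaleR dU_node_L2) auto

lemma norm_dU_sq_integrable: "j \<in> {2, 3} \<Longrightarrow> sq_integrable T (norm_dU j)"
  using reg in_L2_time_sq_integrable[of T _ "l2_norm \<Omega>" "dU j"] by (auto simp: finite_norms_def)

lemma dU_dominated:
  assumes j: "j \<in> {2, 3}"
  shows "dominated \<Omega> T (dU j) (norm_dU j)"
  unfolding dominated_def
proof
  show "sq_integrable T (norm_dU j)" by (rule norm_dU_sq_integrable[OF j])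
  show "AE t in lebesgue_on {0..T}. dU j t \<in> L2_space \<Omega> \<and> norm_dU j t \<le> norm_dU j t"
    by (rule AE_I2) (use dU_L2 j in auto)
qed

lemma dU_weak:
  "weak_time_derivative \<Omega> V T (dU 0) (dU 1)"
  "weak_time_derivative \<Omega> V T (dU 1) (dU 2)"
  "weak_time_derivative \<Omega> V T (dU 2) (dU 3)"
  using has_time_derivative_weak[OF dU[of 0] V(1)] has_time_derivative_weak[OF dU[of 1] V(1)]
    has_time_derivative_weak[OF dU[of 2] V(1)]
  by (simp_all add: numeral_2_eq_2 numeral_3_eq_3)

lemma sum_step_osc_norm:
  assumes j: "j \<in> {2, 3}"
  shows "(\<Sum>n=1..N. step_osc (norm_dU j) n) \<le> sqrt T * Z j"
proof -
  have "energy (norm_dU j) 0 T = (Z j)\<^sup>2" by (rule L2_time_norm_power2[OF norm_dU_sq_integrable[OF j], symmetric])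
  then show ?thesis using sum_sqrt_energy[OF norm_dU_sq_integrable[OF j] \<tau> N] by (simp add: step_osc_def node_def)
qed

lemma R_bound:
  assumes n: "n \<in> {1..N}"
  shows "l2_norm \<Omega> (R n) \<le> \<bar>\<theta> - 1/2\<bar> * step_osc (norm_dU 2) n + 3/2 * \<tau> * step_osc (norm_dU 3) n"
proof -
  let ?a = "node (n - 1)" and ?b = "node n"
  define q where "q = (\<lambda>x. (dU 0 ?b x - dU 0 ?a x) - \<tau> *\<^sub>R ((1/2) *\<^sub>R dU 1 ?a x + (1/2) *\<^sub>R dU 1 ?b x))"
  define p where "p = (\<lambda>x. dU 1 ?b x - dU 1 ?a x)"
  have nN: "n \<le> N" "n - 1 \<le> N" using n by auto
  have L: "q \<in> L2_space \<Omega>" "p \<in> L2_space \<Omega>"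
    unfolding q_def p_def using dU_node_L2[of _ n] dU_node_L2[of _ "n - 1"] nN by simp_all
  have q: "l2_norm \<Omega> q \<le> 3/2 * \<tau>\<^sup>2 * step_osc (norm_dU 3) n"
    using trapezoid_error[OF dU_weak dU_dominated dU_dominated node_pred(1,3,4)[OF n]]
    unfolding node_diff[OF n] q_def by (simp add: step_osc_def)
  have p: "l2_norm \<Omega> p \<le> step_osc (norm_dU 2) n"
    using increment_norm_le[OF dU_weak(2) dU_dominated node_pred(1,3,4)[OF n]]
    unfolding node_diff[OF n] p_def by (simp add: step_osc_def)
  have eq: "R n = (\<lambda>x. (1/\<tau>) *\<^sub>R q x + (1/2 - \<theta>) *\<^sub>R p x)"
    unfolding R_def q_def p_def vec_eq_iff fun_eq_iff vector_add_component vector_minus_component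
      vector_scaleR_component real_scaleR_def
    using \<tau> by (intro allI) (simp add: field_simps)
  have "l2_norm \<Omega> (R n) \<le> \<bar>1/\<tau>\<bar> * l2_norm \<Omega> q + \<bar>1/2 - \<theta>\<bar> * l2_norm \<Omega> p"
    unfolding eq by (rule l2_norm_lincomb_le[OF L])
  also have "\<dots> \<le> (1/\<tau>) * (3/2 * \<tau>\<^sup>2 * step_osc (norm_dU 3) n) + \<bar>1/2 - \<theta>\<bar> * step_osc (norm_dU 2) n"
    using q p \<tau> by (intro add_mono mult_mono) auto
  also have "\<dots> = \<bar>\<theta> - 1/2\<bar> * step_osc (norm_dU 2) n + 3/2 * \<tau> * step_osc (norm_dU 3) n"
    using \<tau> by (simp add: power2_eq_square abs_minus_commute)
  finally show ?thesis .
qed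

text \<open>Together with \<open>K\<close>, \<open>Svar\<close> and \<open>Q\<close> below, the four bounds on which \<open>discrete_stability\<close> depends.\<close>

abbreviation E :: real where "E \<equiv> sqrt T * (\<bar>\<theta> - 1/2\<bar> * \<tau> * Z 2 + 3/2 * \<tau>\<^sup>2 * Z 3)"

lemma R_sum: "(\<Sum>n=1..N. \<tau> * l2_norm \<Omega> (R n)) \<le> E"
proof -
  have "(\<Sum>n=1..N. \<tau> * l2_norm \<Omega> (R n)) \<le>
      (\<Sum>n=1..N. \<tau> * (\<bar>\<theta> - 1/2\<bar> * step_osc (norm_dU 2) n + 3/2 * \<tau> * step_osc (norm_dU 3) n))"
    using \<tau> by (intro sum_mono mult_left_mono R_bound) auto
  also have "\<dots> = (\<bar>\<theta> - 1/2\<bar> * \<tau>) * (\<Sum>n=1..N. step_osc (norm_dU 2) n) + (3/2 * \<tau>\<^sup>2) * (\<Sum>n=1..N. step_osc (norm_dU 3) n)"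
    by (simp add: sum_distrib_left sum.distrib distrib_left power2_eq_square mult_ac)
  also have "\<dots> \<le> (\<bar>\<theta> - 1/2\<bar> * \<tau>) * (sqrt T * Z 2) + (3/2 * \<tau>\<^sup>2) * (sqrt T * Z 3)"
    using \<tau> by (intro add_mono mult_left_mono sum_step_osc_norm) auto
  finally show ?thesis by (simp add: algebra_simps)
qed

definition \<alpha> :: "nat \<Rightarrow> ('d, 'm) vfield" where
  "\<alpha> n = (\<lambda>x. (1/\<tau>) *\<^sub>R (y n x - y (n - 1) x) + (\<theta> *\<^sub>R z n x + (1 - \<theta>) *\<^sub>R z (n - 1) x))"

definition y_mean :: "nat \<Rightarrow> ('d, 'm) vfield" where
  "y_mean n = (\<lambda>x. \<theta> *\<^sub>R y n x + (1 - \<theta>) *\<^sub>R y (n - 1) x)"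

definition z_mean :: "nat \<Rightarrow> ('d, 'm) vfield" where
  "z_mean n = (\<lambda>x. \<theta> *\<^sub>R z n x + (1 - \<theta>) *\<^sub>R z (n - 1) x)"

lemma theta_mean_le:
  assumes "u \<in> L2_space \<Omega>" "v \<in> L2_space \<Omega>" "l2_norm \<Omega> u \<le> c" "l2_norm \<Omega> v \<le> c"
  shows "l2_norm \<Omega> (\<lambda>x. \<theta> *\<^sub>R u x + (1 - \<theta>) *\<^sub>R v x) \<le> c"
proof -
  have "l2_norm \<Omega> (\<lambda>x. \<theta> *\<^sub>R u x + (1 - \<theta>) *\<^sub>R v x) \<le> \<theta> * l2_norm \<Omega> u + (1 - \<theta>) * l2_norm \<Omega> v"
    using l2_norm_lincomb_le[OF assms(1,2), of \<theta> "1 - \<theta>"] \<theta> by simp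
  also have "\<dots> \<le> \<theta> * c + (1 - \<theta>) * c" using assms \<theta> by (intro add_mono mult_left_mono) auto
  finally show ?thesis by (simp add: algebra_simps)
qed

abbreviation K :: real where "K \<equiv> P0 * L 1 + P1 * L 0"

lemma \<alpha>_max:
  assumes n: "n \<in> {1..N}"
  shows "l2_norm \<Omega> (\<alpha> n) \<le> K"
proof -
  have nN: "n \<le> N" "n - 1 \<le> N" using n by auto
  have "l2_norm \<Omega> (\<alpha> n) \<le> l2_norm \<Omega> (\<lambda>x. (1/\<tau>) *\<^sub>R (y n x - y (n - 1) x)) + l2_norm \<Omega> (z_mean n)"
    unfolding \<alpha>_def z_mean_def using nN y_L2 z_L2 by (intro l2_norm_triangle) auto
  also have "l2_norm \<Omega> (\<lambda>x. (1/\<tau>) *\<^sub>R (y n x - y (n - 1) x)) \<le> (1/\<tau>) * (\<tau> * (P0 * L 1))"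
    unfolding l2_norm_scaleR using \<tau> y_increment_max[OF n] by (intro mult_mono) auto
  also have "l2_norm \<Omega> (z_mean n) \<le> P1 * L 0"
    unfolding z_mean_def using nN z_L2 z_max by (intro theta_mean_le) auto
  finally show ?thesis using \<tau> by simp
qed

abbreviation Svar :: real where "Svar \<equiv> 2 * sqrt T * (P0 * S 2 + P1 * S 1)"

lemma \<alpha>_variation: "(\<Sum>n=1..N - 1. l2_norm \<Omega> (\<lambda>x. \<alpha> (Suc n) x - \<alpha> n x)) \<le> Svar"
proof -
  let ?f = "\<lambda>n. P0 * step_osc (sob 2) n + P1 * step_osc (sob 1) n"
  have f0: "0 \<le> ?f n" for n by simp
  have "l2_norm \<Omega> (\<lambda>x. \<alpha> (Suc n) x - \<alpha> n x) \<le> ?f n + ?f (Suc n)" if "n \<in> {1..N - 1}" for n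
  proof -
    have n: "n \<in> {1..N}" "Suc n \<in> {1..N}" "n \<le> N" "Suc n \<le> N" "n - 1 \<le> N" using that by auto
    define D where "D = (\<lambda>x. (y (Suc n) x - y n x) - (y n x - y (n - 1) x))"
    define p where "p = (\<lambda>x. z (Suc n) x - z n x)"
    define q where "q = (\<lambda>x. z n x - z (n - 1) x)"
    have DL: "D \<in> L2_space \<Omega>" unfolding D_def using y_L2 n by (intro L2_space_diff) auto
    have pL: "p \<in> L2_space \<Omega>" and qL: "q \<in> L2_space \<Omega>" unfolding p_def q_def using z_L2 n by simp_all
    have eq: "(\<lambda>x. \<alpha> (Suc n) x - \<alpha> n x) = (\<lambda>x. (1/\<tau>) *\<^sub>R D x + (\<theta> *\<^sub>R p x + (1 - \<theta>) *\<^sub>R q x))"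
      unfolding \<alpha>_def D_def p_def q_def diff_Suc_1 by (simp add: algebra_simps)
    have "l2_norm \<Omega> (\<lambda>x. \<alpha> (Suc n) x - \<alpha> n x) \<le> l2_norm \<Omega> (\<lambda>x. (1/\<tau>) *\<^sub>R D x) + l2_norm \<Omega> (\<lambda>x. \<theta> *\<^sub>R p x + (1 - \<theta>) *\<^sub>R q x)"
      unfolding eq using DL pL qL by (intro l2_norm_triangle) auto
    also have "l2_norm \<Omega> (\<lambda>x. (1/\<tau>) *\<^sub>R D x) \<le> (1/\<tau>) * (\<tau> * (P0 * step_osc (sob 2) n + P0 * step_osc (sob 2) (Suc n)))"
      unfolding l2_norm_scaleR D_def using \<tau> y_second_difference[OF n(1,2)] by (intro mult_mono) auto
    also have "l2_norm \<Omega> (\<lambda>x. \<theta> *\<^sub>R p x + (1 - \<theta>) *\<^sub>R q x) \<le> P1 * step_osc (sob 1) n + P1 * step_osc (sob 1) (Suc n)"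
    proof (rule theta_mean_le[OF pL qL])
      show "l2_norm \<Omega> p \<le> P1 * step_osc (sob 1) n + P1 * step_osc (sob 1) (Suc n)"
        unfolding p_def using z_increment[OF n(2)] by (auto intro: add_increasing)
      show "l2_norm \<Omega> q \<le> P1 * step_osc (sob 1) n + P1 * step_osc (sob 1) (Suc n)"
        unfolding q_def using z_increment[OF n(1)] by (auto intro: add_increasing2)
    qed
    finally show ?thesis using \<tau> by simp
  qed
  then have "(\<Sum>n=1..N - 1. l2_norm \<Omega> (\<lambda>x. \<alpha> (Suc n) x - \<alpha> n x)) \<le> (\<Sum>n=1..N - 1. ?f n + ?f (Suc n))"
    by (rule sum_mono)
  also have "\<dots> \<le> 2 * (\<Sum>n=1..N. ?f n)" by (rule sum_shift_le) (rule f0)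
  also have "\<dots> = 2 * (P0 * (\<Sum>n=1..N. step_osc (sob 2) n) + P1 * (\<Sum>n=1..N. step_osc (sob 1) n))"
    by (simp only: sum.distrib sum_distrib_left)
  also have "\<dots> \<le> 2 * (P0 * (sqrt T * S 2) + P1 * (sqrt T * S 1))"
    by (intro mult_left_mono add_mono sum_step_osc_sob) auto
  finally show ?thesis by (simp add: algebra_simps)
qed

abbreviation Q :: real where
  "Q \<equiv> 3/2 * (\<delta> * P0\<^sup>2 * (S 1)\<^sup>2 + (2 * \<delta> * P1\<^sup>2 + 2 / \<delta> * P0\<^sup>2) * ((S 0)\<^sup>2 + 4 * (S 1)\<^sup>2))"

lemma \<delta>_pos: "0 < \<delta>" using \<delta> \<theta> \<tau> by simp

lemma \<tau>_le_2: "\<tau> \<le> 2"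
proof -
  have "1/2 * \<tau> \<le> \<theta> * \<tau>" using \<theta> \<tau> by (intro mult_right_mono) auto
  then show ?thesis using \<delta> by simp
qed

text \<open>The weight \<open>1 / \<delta>\<close> leaves a factor \<open>\<delta>\<close> in front of the squares from \<open>\<alpha>\<close> and \<open>1 / \<delta>\<close> in front of
  those from the mean of \<open>y\<close>. Nodal values are bounded by \<open>sampled_norm_le\<close>, so the sums over the steps
  are energies over \<open>[0, T]\<close> without a further factor \<open>T\<close>; the number 4 bounds \<open>\<tau>\<^sup>2\<close>.\<close>

lemma Q_sum: "(\<Sum>n=1..N. \<tau> / (2 * \<delta>) * (l2_norm \<Omega> (\<lambda>x. \<delta> *\<^sub>R \<alpha> n x - y_mean n x))\<^sup>2) \<le> Q"
proof -
  let ?e = "\<lambda>j n. energy (sob j) (node (n - 1)) (node n)"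
  let ?b = "\<lambda>n. 3/2 * (\<delta> * P0\<^sup>2 * ?e 1 n + (2 * \<delta> * P1\<^sup>2 + 2 / \<delta> * P0\<^sup>2) * (?e 0 n + 4 * ?e 1 n))"
  have step: "\<tau> / (2 * \<delta>) * (l2_norm \<Omega> (\<lambda>x. \<delta> *\<^sub>R \<alpha> n x - y_mean n x))\<^sup>2 \<le> ?b n" if n: "n \<in> {1..N}" for n
  proof -
    have nN: "n \<le> N" "n - 1 \<le> N" using n by auto
    have \<tau>2: "\<tau>\<^sup>2 \<le> 4" using power_mono[OF \<tau>_le_2, of 2] \<tau> by simp
    define D where "D = (\<lambda>x. y n x - y (n - 1) x)"
    have L: "D \<in> L2_space \<Omega>" "z_mean n \<in> L2_space \<Omega>" "y_mean n \<in> L2_space \<Omega>"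
      unfolding D_def z_mean_def y_mean_def using y_L2 z_L2 nN by simp_all
    define a b c where "a = \<theta> * l2_norm \<Omega> D" and "b = \<delta> * l2_norm \<Omega> (z_mean n)" and "c = l2_norm \<Omega> (y_mean n)"
    have eq: "(\<lambda>x. \<delta> *\<^sub>R \<alpha> n x - y_mean n x) = (\<lambda>x. (\<theta> *\<^sub>R D x + \<delta> *\<^sub>R z_mean n x) - y_mean n x)"
      unfolding \<alpha>_def D_def z_mean_def using \<tau> by (simp add: \<delta>(1) scaleR_add_right)
    have "l2_norm \<Omega> (\<lambda>x. \<delta> *\<^sub>R \<alpha> n x - y_mean n x) \<le> l2_norm \<Omega> (\<lambda>x. \<theta> *\<^sub>R D x + \<delta> *\<^sub>R z_mean n x) + c"
      unfolding eq c_def using L by (intro l2_norm_triangle_diff) auto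
    also have "l2_norm \<Omega> (\<lambda>x. \<theta> *\<^sub>R D x + \<delta> *\<^sub>R z_mean n x) \<le> a + b"
      using l2_norm_lincomb_le[OF L(1,2), of \<theta> \<delta>] \<theta> \<delta>_pos by (simp add: a_def b_def)
    finally have "(l2_norm \<Omega> (\<lambda>x. \<delta> *\<^sub>R \<alpha> n x - y_mean n x))\<^sup>2 \<le> (a + b + c)\<^sup>2"
      by (intro power_mono) auto
    also have "\<dots> \<le> 3 * (a\<^sup>2 + b\<^sup>2 + c\<^sup>2)"
      using sum_squares_bound[of a b] sum_squares_bound[of a c] sum_squares_bound[of b c]
      by (simp add: power2_eq_square algebra_simps)
    finally have le: "\<tau> / (2 * \<delta>) * (l2_norm \<Omega> (\<lambda>x. \<delta> *\<^sub>R \<alpha> n x - y_mean n x))\<^sup>2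
        \<le> \<tau> / (2 * \<delta>) * (3 * (a\<^sup>2 + b\<^sup>2 + c\<^sup>2))"
      using \<tau> \<delta>_pos by (intro mult_left_mono) auto
    have mean: "\<tau> * (l2_norm \<Omega> (\<lambda>x. \<theta> *\<^sub>R u x + (1 - \<theta>) *\<^sub>R v x))\<^sup>2 \<le> B"
      if "u \<in> L2_space \<Omega>" "v \<in> L2_space \<Omega>" "\<tau> * (l2_norm \<Omega> u)\<^sup>2 \<le> B" "\<tau> * (l2_norm \<Omega> v)\<^sup>2 \<le> B"
      for u v :: "('d, 'm) vfield" and B
    proof -
      have "l2_norm \<Omega> u \<le> sqrt (B / \<tau>)" "l2_norm \<Omega> v \<le> sqrt (B / \<tau>)"
        using that \<tau> by (auto intro!: real_le_rsqrt simp: field_simps)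
      from theta_mean_le[OF that(1,2) this]
      have "(l2_norm \<Omega> (\<lambda>x. \<theta> *\<^sub>R u x + (1 - \<theta>) *\<^sub>R v x))\<^sup>2 \<le> (sqrt (B / \<tau>))\<^sup>2" by (intro power_mono) auto
      moreover have "0 \<le> B" using that(3) \<tau> by (auto intro: order_trans[rotated])
      ultimately show ?thesis using \<tau> by (simp add: field_simps)
    qed
    have step_osc2: "(step_osc (sob 1) n)\<^sup>2 = \<tau> * ?e 1 n" using \<tau> by (simp add: step_osc_def)
    have "a\<^sup>2 = \<theta>\<^sup>2 * (l2_norm \<Omega> D)\<^sup>2" by (simp add: a_def power_mult_distrib)
    also have "\<dots> \<le> \<theta>\<^sup>2 * (P0 * step_osc (sob 1) n)\<^sup>2"
      unfolding D_def using y_increment[OF n] by (intro mult_left_mono power_mono) auto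
    also have "\<dots> = \<theta> * (\<delta> * (P0\<^sup>2 * ?e 1 n))"
      unfolding power_mult_distrib[of _ "step_osc (sob 1) n"] step_osc2 by (simp add: \<delta>(1) power2_eq_square)
    finally have "\<tau> * a\<^sup>2 \<le> \<tau> * (\<theta> * (\<delta> * (P0\<^sup>2 * ?e 1 n)))" using \<tau> by (intro mult_left_mono) auto
    then have a: "\<tau> * a\<^sup>2 \<le> \<delta> * (\<delta> * (P0\<^sup>2 * ?e 1 n))" by (simp add: \<delta>(1) mult_ac)
    have z4: "\<tau> * (l2_norm \<Omega> (z i))\<^sup>2 \<le> 2 * P1\<^sup>2 * (?e 0 n + 4 * ?e 1 n)"
      and y4: "\<tau> * (l2_norm \<Omega> (y i))\<^sup>2 \<le> 2 * P0\<^sup>2 * (?e 0 n + 4 * ?e 1 n)" if "i \<in> {n - 1, n}" for i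
      using z_sampled[OF n that] y_sampled[OF n that] \<tau>2
      by (auto intro!: order_trans[OF _ mult_left_mono[OF add_left_mono[OF mult_right_mono[OF \<tau>2]]]])
    have "\<tau> * (l2_norm \<Omega> (z_mean n))\<^sup>2 \<le> 2 * P1\<^sup>2 * (?e 0 n + 4 * ?e 1 n)"
      unfolding z_mean_def using z_L2 nN z4 by (intro mean) auto
    then have "\<delta>\<^sup>2 * (\<tau> * (l2_norm \<Omega> (z_mean n))\<^sup>2) \<le> \<delta>\<^sup>2 * (2 * P1\<^sup>2 * (?e 0 n + 4 * ?e 1 n))"
      by (intro mult_left_mono) auto
    then have b: "\<tau> * b\<^sup>2 \<le> \<delta>\<^sup>2 * (2 * P1\<^sup>2 * (?e 0 n + 4 * ?e 1 n))"
      by (simp add: b_def power_mult_distrib mult_ac)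
    have c: "\<tau> * c\<^sup>2 \<le> 2 * P0\<^sup>2 * (?e 0 n + 4 * ?e 1 n)"
      unfolding c_def y_mean_def using y_L2 nN y4 by (intro mean) auto
    have "\<tau> / (2 * \<delta>) * (3 * (a\<^sup>2 + b\<^sup>2 + c\<^sup>2)) = 3 / (2 * \<delta>) * (\<tau> * a\<^sup>2 + \<tau> * b\<^sup>2 + \<tau> * c\<^sup>2)"
      by (simp add: algebra_simps)
    also have "\<dots> \<le> 3 / (2 * \<delta>) * (\<delta> * (\<delta> * (P0\<^sup>2 * ?e 1 n)) + \<delta>\<^sup>2 * (2 * P1\<^sup>2 * (?e 0 n + 4 * ?e 1 n))
        + 2 * P0\<^sup>2 * (?e 0 n + 4 * ?e 1 n))"
      using a b c \<delta>_pos by (intro mult_left_mono add_mono) auto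
    also have "\<dots> = ?b n"
    proof -
      have "3 / (2 * \<delta>) * (\<delta> * (\<delta> * u) + \<delta>\<^sup>2 * (2 * v * w) + 2 * t * w) = 3/2 * (\<delta> * u + (2 * \<delta> * v + 2 / \<delta> * t) * w)"
        for u v w t :: real
        using \<delta>_pos by (simp add: field_simps power2_eq_square)
      then show ?thesis by (simp only: mult.assoc)
    qed
    finally show ?thesis using le by linarith
  qed
  have e: "(\<Sum>n=1..N. ?e j n) \<le> (S j)\<^sup>2" if "j \<le> 2" for j
    using sum_energy[OF sob_sq_integrable[OF that] _ N] \<tau> S_energy[OF that] by (simp add: node_def)
  have "(\<Sum>n=1..N. \<tau> / (2 * \<delta>) * (l2_norm \<Omega> (\<lambda>x. \<delta> *\<^sub>R \<alpha> n x - y_mean n x))\<^sup>2) \<le> (\<Sum>n=1..N. ?b n)"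
    by (intro sum_mono step)
  also have "\<dots> = 3/2 * (\<delta> * P0\<^sup>2 * (\<Sum>n=1..N. ?e 1 n) + (2 * \<delta> * P1\<^sup>2 + 2 / \<delta> * P0\<^sup>2) * ((\<Sum>n=1..N. ?e 0 n) + 4 * (\<Sum>n=1..N. ?e 1 n)))"
    by (simp only: sum.distrib sum_distrib_left[symmetric])
  also have "\<dots> \<le> Q"
    using \<delta>_pos e[of 0] e[of 1] by (intro mult_left_mono add_mono) auto
  finally show ?thesis .
qed

section \<open>The error equation and the error estimate\<close>

definition proj :: "nat \<Rightarrow> ('d, 'm) vfield" where "proj n = l2_projection \<Omega> Vh (dU 0 (node n))"
definition e :: "nat \<Rightarrow> ('d, 'm) vfield" where "e n = (\<lambda>x. Uh n x - proj n x)"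
abbreviation g :: "nat \<Rightarrow> ('d, 'm) vfield" where "g n \<equiv> G (e n)"

lemma proj_Vh: "n \<le> N \<Longrightarrow> proj n \<in> Vh"
  unfolding proj_def by (rule l2_projection_in[OF dU_node_L2]) auto

lemma e_Vh: "n \<le> N \<Longrightarrow> e n \<in> Vh"
  using Vh_lincomb[OF Uh proj_Vh, of n n 1 "-1"] by (simp add: e_def)

lemma Vh_V: "w \<in> Vh \<Longrightarrow> w \<in> V" using Vh_subset by blast

lemma e_L2: "n \<le> N \<Longrightarrow> e n \<in> L2_space \<Omega>" using e_Vh Vh_L2 by auto
lemma g_L2: "n \<le> N \<Longrightarrow> g n \<in> L2_space \<Omega>" using e_Vh Vh_V G_L2 by auto
lemma proj_L2: "n \<le> N \<Longrightarrow> proj n \<in> L2_space \<Omega>" using proj_Vh Vh_L2 by auto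
lemma G_proj_L2: "n \<le> N \<Longrightarrow> G (proj n) \<in> L2_space \<Omega>" using proj_Vh Vh_V G_L2 by auto

lemma y_orth: "n \<le> N \<Longrightarrow> w \<in> Vh \<Longrightarrow> l2_inner \<Omega> (y n) w = 0"
  unfolding eta_def by (rule l2_projection_orth[OF dU_node_L2]) auto

lemma e_0: "l2_norm \<Omega> (e 0) = 0" "l2_norm \<Omega> (g 0) = 0"
proof -
  have "AE x in lebesgue_on \<Omega>. (0::real^'m) = e 0 x"
    using Uh0 by eventually_elim (simp add: e_def proj_def node_def)
  from l2_norm_cong_AE[OF \<Omega> _ this] show 0: "l2_norm \<Omega> (e 0) = 0" by simp
  show "l2_norm \<Omega> (g 0) = 0" by (rule G_null[OF Vh_V[OF e_Vh] 0]) simp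
qed

lemma G_Uh: "n \<le> N \<Longrightarrow> AE x in lebesgue_on \<Omega>. G (Uh n) x = g n x + G (proj n) x"
  using G_lincomb[OF Vh_V[OF e_Vh] Vh_V[OF proj_Vh], of n n 1 1] by (simp add: e_def)

lemma G_U: "n \<le> N \<Longrightarrow> AE x in lebesgue_on \<Omega>. G (dU 0 (node n)) x = z n x + G (proj n) x"
  using G_lincomb[OF y_V Vh_V[OF proj_Vh], of n n 1 1] by (simp add: eta_def proj_def)

definition A :: "nat \<Rightarrow> ('d, 'm) vfield" where
  "A n = (\<lambda>x. (1/\<tau>) *\<^sub>R (e n x - e (n - 1) x) + (\<theta> *\<^sub>R g n x + (1 - \<theta>) *\<^sub>R g (n - 1) x))"

definition TW :: "nat \<Rightarrow> ('d, 'm) vfield" where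
  "TW n = (\<lambda>x. (2 * \<theta>) *\<^sub>R (e n x + \<delta> *\<^sub>R g n x) + (1 - 2 * \<theta>) *\<^sub>R (e (n - 1) x + \<delta> *\<^sub>R g (n - 1) x))"

text \<open>The projected exact solution contributes the same field \<open>B\<close> to both sides of the scheme and cancels.
  Splitting \<open>U\<close> and \<open>U\<^sub>h\<close> this way keeps the operator on elements of \<open>V\<close>, where it is linear up to null
  sets.\<close>

lemma error_equation:
  assumes n: "n \<in> {1..N}"
  shows "l2_inner \<Omega> (A n) (TW n) = l2_inner \<Omega> (\<alpha> n) (TW n) - l2_inner \<Omega> (R n) (TW n)"
proof -
  have nN: "n \<le> N" "n - 1 \<le> N" using n by auto
  define B where "B = (\<lambda>x. (1/\<tau>) *\<^sub>R (proj n x - proj (n - 1) x) + (\<theta> *\<^sub>R G (proj n) x + (1 - \<theta>) *\<^sub>R G (proj (n - 1)) x))"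
  have AL: "A n \<in> L2_space \<Omega>" unfolding A_def
    using e_L2[OF nN(1)] e_L2[OF nN(2)] g_L2[OF nN(1)] g_L2[OF nN(2)] by (intro L2_space_diff L2_space_add L2_space_scaleR)
  have \<alpha>L: "\<alpha> n \<in> L2_space \<Omega>" unfolding \<alpha>_def
    using y_L2[OF nN(1)] y_L2[OF nN(2)] z_L2[OF nN(1)] z_L2[OF nN(2)] by (intro L2_space_diff L2_space_add L2_space_scaleR)
  have BL: "B \<in> L2_space \<Omega>" unfolding B_def
    using proj_L2[OF nN(1)] proj_L2[OF nN(2)] G_proj_L2[OF nN(1)] G_proj_L2[OF nN(2)] by (intro L2_space_diff L2_space_add L2_space_scaleR)
  have TWL: "TW n \<in> L2_space \<Omega>" unfolding TW_def
    using e_L2[OF nN(1)] e_L2[OF nN(2)] g_L2[OF nN(1)] g_L2[OF nN(2)] by (intro L2_space_diff L2_space_add L2_space_scaleR)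
  have RL: "R n \<in> L2_space \<Omega>" by (rule R_L2[OF n])
  have A: "AE x in lebesgue_on \<Omega>. A n x + B x = A_tau G \<tau> \<theta> Uh n x"
  proof -
    have "AE x in lebesgue_on \<Omega>. G (M_theta \<theta> Uh n) x = \<theta> *\<^sub>R G (Uh n) x + (1 - \<theta>) *\<^sub>R G (Uh (n - 1)) x"
      unfolding M_theta_def by (rule G_lincomb[OF Vh_V[OF Uh[OF nN(1)]] Vh_V[OF Uh[OF nN(2)]]])
    with G_Uh[OF nN(1)] G_Uh[OF nN(2)] show ?thesis
      by eventually_elim (simp add: A_tau_def D_minus_def A_def B_def e_def scaleR_add_right scaleR_diff_right)
  qed
  have F: "AE x in lebesgue_on \<Omega>. (\<alpha> n x - R n x) + B x = M_theta \<theta> (\<lambda>i. F (real i * \<tau>)) n x"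
  proof -
    have "AE x in lebesgue_on \<Omega>. dU 1 (node i) x + G (dU 0 (node i)) x = F (node i) x" if "i \<le> N" for i
      using sol node_in[OF that] by (simp add: exact_solution_def)
    from this[OF nN(1)] this[OF nN(2)] G_U[OF nN(1)] G_U[OF nN(2)] show ?thesis
    proof eventually_elim
      case (elim x)
      have y: "y i x = dU 0 (node i) x - proj i x" for i by (simp add: eta_def proj_def)
      show ?case
        unfolding M_theta_def node_def[symmetric] elim(1,2)[symmetric] elim(3,4) \<alpha>_def R_def B_def y
        by (simp add: scaleR_add_right scaleR_diff_right)
    qed
  qed
  define W where "W = (\<lambda>x. (2 * \<theta>) *\<^sub>R e n x + (1 - 2 * \<theta>) *\<^sub>R e (n - 1) x)"
  have W: "W \<in> Vh" unfolding W_def by (rule Vh_lincomb[OF e_Vh[OF nN(1)] e_Vh[OF nN(2)]])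
  have TW: "AE x in lebesgue_on \<Omega>. TW n x = T_delta G \<delta> W x"
    using G_lincomb[OF Vh_V[OF e_Vh[OF nN(1)]] Vh_V[OF e_Vh[OF nN(2)]], of "2 * \<theta>" "1 - 2 * \<theta>", folded W_def]
    by eventually_elim (simp add: T_delta_def TW_def W_def[THEN fun_cong] scaleR_add_right mult.commute)
  have TdL: "T_delta G \<delta> W \<in> L2_space \<Omega>" by (rule L2_space_cong_AE[OF \<Omega> TWL TW])
  have "l2_inner \<Omega> (\<lambda>x. A n x + B x) (T_delta G \<delta> W) = l2_inner \<Omega> (\<lambda>x. (\<alpha> n x - R n x) + B x) (T_delta G \<delta> W)"
    using scheme[OF n W] l2_inner_cong_AE[OF \<Omega> _ TdL A] l2_inner_cong_AE[OF \<Omega> _ TdL F] AL BL \<alpha>L RL by simp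
  then have "l2_inner \<Omega> (A n) (T_delta G \<delta> W) = l2_inner \<Omega> (\<alpha> n) (T_delta G \<delta> W) - l2_inner \<Omega> (R n) (T_delta G \<delta> W)"
    using AL BL \<alpha>L RL TdL by simp
  then show ?thesis
    unfolding l2_inner_commute[of \<Omega> _ "T_delta G \<delta> W"]
    by (simp add: l2_inner_cong_AE[OF \<Omega> TWL _ TW] AL \<alpha>L RL l2_inner_commute[of \<Omega> _ "TW n"])
qed

lemma projected_error_bound:
  assumes n: "n \<in> {1..N}"
  shows "l2_norm \<Omega> (\<lambda>x. e n x + \<delta> *\<^sub>R g n x) \<le> 2 * \<delta> * (K + Svar) + 6 * E + sqrt Q"
proof -
  have skew: "l2_inner \<Omega> (e i) (g j) = - l2_inner \<Omega> (e j) (g i)" if "i \<le> N" "j \<le> N" for i j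
    using G_skew[OF Vh_V[OF e_Vh[OF that(2)]] Vh_V[OF e_Vh[OF that(1)]]] by (simp add: l2_inner_commute)
  have orth: "l2_inner \<Omega> (y i) (e j) = 0" if "i \<le> N" "j \<le> N" for i j using y_orth e_Vh that by auto
  have mixed: "l2_inner \<Omega> (z i) (e j) = - l2_inner \<Omega> (y i) (g j)" if "i \<le> N" "j \<le> N" for i j
    by (rule G_skew[OF y_V[OF that(1)] Vh_V[OF e_Vh[OF that(2)]]])
  show ?thesis
    by (rule discrete_stability[OF e_L2 g_L2 y_L2 z_L2 R_L2 skew orth mixed \<theta> \<tau> \<delta>(1) e_0
          error_equation[unfolded A_def TW_def \<alpha>_def] \<alpha>_max[unfolded \<alpha>_def]
          \<alpha>_variation[unfolded \<alpha>_def] R_sum Q_sum[unfolded \<alpha>_def y_mean_def] n])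
qed

lemma error_bound:
  assumes n: "n \<in> {1..N}"
  shows "l2_norm \<Omega> (T_delta G \<delta> (\<lambda>x. Uh n x - dU 0 (real n * \<tau>) x))
    \<le> P0 * L 0 + \<delta> * (P1 * L 0) + (2 * \<delta> * (K + Svar) + 6 * E + sqrt Q)"
proof -
  have nN: "n \<le> N" using n by simp
  let ?u = "\<lambda>x. e n x + \<delta> *\<^sub>R g n x" and ?v = "\<lambda>x. y n x + \<delta> *\<^sub>R z n x"
  have L: "?u \<in> L2_space \<Omega>" "?v \<in> L2_space \<Omega>" using e_L2 g_L2 y_L2 z_L2 nN by simp_all
  have eq: "(\<lambda>x. Uh n x - dU 0 (real n * \<tau>) x) = (\<lambda>x. 1 *\<^sub>R e n x + (-1) *\<^sub>R y n x)"
    by (simp add: e_def eta_def proj_def node_def)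
  have "AE x in lebesgue_on \<Omega>. ?u x - ?v x = T_delta G \<delta> (\<lambda>x. Uh n x - dU 0 (real n * \<tau>) x) x"
    unfolding eq using G_lincomb[OF Vh_V[OF e_Vh[OF nN]] y_V[OF nN], of 1 "-1"]
    by eventually_elim (simp add: T_delta_def scaleR_diff_right)
  then have "l2_norm \<Omega> (T_delta G \<delta> (\<lambda>x. Uh n x - dU 0 (real n * \<tau>) x)) = l2_norm \<Omega> (\<lambda>x. ?u x - ?v x)"
    by (rule l2_norm_cong_AE[OF \<Omega> L2_space_diff[OF L]])
  also have "\<dots> \<le> l2_norm \<Omega> ?u + l2_norm \<Omega> ?v" by (rule l2_norm_triangle_diff[OF L])
  also have "l2_norm \<Omega> ?v \<le> l2_norm \<Omega> (y n) + l2_norm \<Omega> (\<lambda>x. \<delta> *\<^sub>R z n x)"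
    using y_L2 z_L2 nN by (intro l2_norm_triangle) auto
  also have "l2_norm \<Omega> (\<lambda>x. \<delta> *\<^sub>R z n x) = \<delta> * l2_norm \<Omega> (z n)" using \<delta>_pos by (simp add: l2_norm_scaleR)
  finally have "l2_norm \<Omega> (T_delta G \<delta> (\<lambda>x. Uh n x - dU 0 (real n * \<tau>) x))
      \<le> l2_norm \<Omega> ?u + (l2_norm \<Omega> (y n) + \<delta> * l2_norm \<Omega> (z n))" by simp
  moreover have "\<delta> * l2_norm \<Omega> (z n) \<le> \<delta> * (P1 * L 0)"
    using z_max[OF nN] \<delta>_pos by (intro mult_left_mono) auto
  ultimately show ?thesis
    using projected_error_bound[OF n] y_max[OF nN] by linarith
qed

text \<open>The number \<open>\<kappa>\<close> converts the consistency error into the order \<open>\<nu>\<close>.\<close>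

lemma error_estimate:
  assumes n: "n \<in> {1..N}" and \<kappa>: "0 \<le> \<kappa>" "\<bar>\<theta> - 1/2\<bar> * \<tau> + 3/2 * \<tau>\<^sup>2 \<le> \<kappa> * \<tau> ^ \<nu>"
  shows "l2_norm \<Omega> (T_delta G \<delta> (\<lambda>x. Uh n x - dU 0 (real n * \<tau>) x)) \<le>
    (1 + \<bar>Capp\<bar> + 4 * \<bar>Capp\<bar> * (d + 1) + 4 * \<bar>Capp\<bar> + 6 * \<kappa>) *
      ((h powr r + \<delta> * h powr (r - 1)) * L 0
        + ((1 + T powr (1/2)) * \<delta> powr (1/2) * h powr (r - 1) + \<delta> powr (-1/2) * h powr r) * norm_N2 \<Omega> T r dU
        + (1 + T powr (1/2)) * \<tau> ^ \<nu> * C_sharp \<Omega> T dU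
        + \<tau> powr (1/2) * (h powr r + \<tau> * h powr (r - 1)) * S 1
        + \<tau> powr (1/2) * h powr (r - 1) * S 0
        + \<tau> powr (real \<nu> + 1/2) * C_sharp \<Omega> T dU)"
proof -
  define c p0 p1 Nn Cs where "c = \<bar>Capp\<bar>" and "p0 = h powr r" and "p1 = h powr (r - 1)"
    and "Nn = norm_N2 \<Omega> T r dU" and "Cs = C_sharp \<Omega> T dU"
  have c: "0 \<le> c" and p: "0 \<le> p0" "0 \<le> p1" by (simp_all add: c_def p0_def p1_def)
  have d: "0 \<le> d" using h by simp
  have "p0 = h * p1" using h by (simp add: p0_def p1_def powr_diff)
  then have p01: "p0 \<le> d * p1" using h p by (simp add: mult_right_mono)
  have Lnn: "0 \<le> L 0" "0 \<le> L 1" using L_nonneg[of 0] L_nonneg[of 1] by simp_all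
  have Nn: "Nn = S 0 + S 1 + S 2 + L 0 + L 1"
    by (simp add: Nn_def norm_N2_def numeral_2_eq_2)
  have Snn: "0 \<le> S j" for j by simp
  have Zinf: "0 \<le> Linf_time_norm T (l2_norm \<Omega>) (dU j)" if "j \<in> {2, 3}" for j
    using reg that by (intro in_Linf_time_AE_le(2)[OF _ l2_norm_nonneg T]) (auto simp: finite_norms_def)
  have Cs: "Z 2 \<le> Cs" "Z 3 \<le> Cs" "0 \<le> Cs"
    using Zinf[of 2] Zinf[of 3] L2_time_norm_nonneg[of T "l2_norm \<Omega>" "dU 2"]
      L2_time_norm_nonneg[of T "l2_norm \<Omega>" "dU 3"] L2_time_norm_nonneg[of T "l2_norm \<Omega>" "dU 4"]
    by (simp_all add: Cs_def C_sharp_def)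
  have half: "T powr (1/2) = sqrt T" "\<delta> powr (1/2) = sqrt \<delta>" "\<delta> powr (-1/2) = 1 / sqrt \<delta>"
    using T \<delta>_pos powr_minus[of \<delta> "1/2"] by (simp_all add: powr_half_sqrt inverse_eq_divide)
  define X1 X2 X3 where "X1 = (p0 + \<delta> * p1) * L 0"
    and "X2 = ((1 + sqrt T) * sqrt \<delta> * p1 + 1 / sqrt \<delta> * p0) * Nn"
    and "X3 = (1 + sqrt T) * \<tau> ^ \<nu> * Cs"
  have X: "0 \<le> X1" "0 \<le> X2" "0 \<le> X3"
    using p Lnn Snn[of 0] Snn[of 1] Snn[of 2] Cs \<delta>_pos T \<tau> unfolding X1_def X2_def X3_def Nn
    by (auto intro!: mult_nonneg_nonneg add_nonneg_nonneg)
  have t1: "P0 * L 0 + \<delta> * (P1 * L 0) = c * X1" by (simp add: X1_def c_def p0_def p1_def algebra_simps)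
  have "2 * \<delta> * (K + Svar) \<le> 4 * c * (d + 1) * ((1 + sqrt T) * sqrt \<delta> * p1 * Nn)"
    unfolding c_def[symmetric] p0_def[symmetric] p1_def[symmetric]
    by (rule variation_term_le) (use \<delta>_pos \<delta> c p p01 d T Snn Lnn in \<open>auto simp: Nn add_nonneg_nonneg\<close>)
  also have "\<dots> \<le> 4 * c * (d + 1) * X2"
    unfolding X2_def using c d p \<delta>_pos Lnn Snn by (intro mult_left_mono) (auto simp: Nn distrib_right add_nonneg_nonneg)
  finally have t2: "2 * \<delta> * (K + Svar) \<le> 4 * c * (d + 1) * X2" .
  have "sqrt Q \<le> 4 * c * (sqrt \<delta> * p1 + p0 / sqrt \<delta>) * Nn"
    unfolding c_def[symmetric] p0_def[symmetric] p1_def[symmetric]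
    by (rule stability_term_le) (use \<delta>_pos \<delta> c p Snn Lnn in \<open>auto simp: Nn\<close>)
  also have "\<dots> = 4 * c * ((sqrt \<delta> * p1 + 1 / sqrt \<delta> * p0) * Nn)" by simp
  also have "\<dots> \<le> 4 * c * X2"
    unfolding X2_def using c p T \<delta>_pos Lnn Snn
    by (intro mult_left_mono mult_right_mono add_mono order_refl) (auto simp: Nn distrib_right add_nonneg_nonneg)
  finally have t3: "sqrt Q \<le> 4 * c * X2" .
  have "\<bar>\<theta> - 1/2\<bar> * \<tau> * Z 2 + 3/2 * \<tau>\<^sup>2 * Z 3 \<le> \<bar>\<theta> - 1/2\<bar> * \<tau> * Cs + 3/2 * \<tau>\<^sup>2 * Cs"
    using Cs \<tau> by (intro add_mono mult_left_mono) auto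
  also have "\<dots> = (\<bar>\<theta> - 1/2\<bar> * \<tau> + 3/2 * \<tau>\<^sup>2) * Cs" by (simp add: algebra_simps)
  also have "\<dots> \<le> \<kappa> * \<tau> ^ \<nu> * Cs" using \<kappa>(2) Cs(3) by (rule mult_right_mono)
  finally have "E \<le> sqrt T * (\<kappa> * \<tau> ^ \<nu> * Cs)" using T by (intro mult_left_mono) auto
  also have "\<dots> \<le> (1 + sqrt T) * (\<kappa> * \<tau> ^ \<nu> * Cs)" using \<kappa> \<tau> Cs by (intro mult_right_mono) auto
  also have "\<dots> = \<kappa> * X3" by (simp add: X3_def)
  finally have t4: "E \<le> \<kappa> * X3" .
  define Y where "Y = \<tau> powr (1/2) * (p0 + \<tau> * p1) * S 1 + \<tau> powr (1/2) * p1 * S 0 + \<tau> powr (real \<nu> + 1/2) * Cs"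
  have Y: "0 \<le> Y" using p Snn \<tau> Cs by (auto simp: Y_def intro!: add_nonneg_nonneg mult_nonneg_nonneg)
  let ?C = "1 + c + 4 * c * (d + 1) + 4 * c + 6 * \<kappa>"
  have "0 \<le> 4 * c * (d + 1)" using c d by simp
  then have coeff: "c \<le> ?C" "4 * c * (d + 1) + 4 * c \<le> ?C" "6 * \<kappa> \<le> ?C" "0 \<le> ?C"
    using c \<kappa>(1) by linarith+
  have "l2_norm \<Omega> (T_delta G \<delta> (\<lambda>x. Uh n x - dU 0 (real n * \<tau>) x)) \<le>
      c * X1 + 4 * c * (d + 1) * X2 + 4 * c * X2 + 6 * (\<kappa> * X3)"
    using error_bound[OF n] t1 t2 t3 t4 by linarith
  also have "\<dots> = c * X1 + (4  * c * (d + 1) + 4 * c) * X2 + 6 * \<kappa> * X3" by (simp add: algebra_simps)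
  also have "\<dots> \<le> ?C * X1 + ?C * X2 + ?C * X3"
    by (intro add_mono mult_right_mono coeff X)
  also have "\<dots> \<le> ?C * X1 + ?C * X2 + ?C * X3 + ?C * Y"
    using mult_nonneg_nonneg[OF coeff(4) Y] by simp
  also have "\<dots> = ?C * (X1 + X2 + X3 + Y)" by (simp only: distrib_left)
  finally show ?thesis
    unfolding X1_def X2_def X3_def Y_def half c_def p0_def p1_def Nn_def Cs_def by (simp only: add.assoc)
qed

end

text \<open>A cell contains a ball and lies in the closure of the bounded domain. Positivity is what allows
  division by \<open>h\<close>.\<close>

lemma mesh_size_bounds:
  assumes \<Omega>: "lipschitz_domain \<Omega>" and M: "is_mesh \<Omega> M"
  shows "0 < mesh_size M" "mesh_size M \<le> diameter (closure \<Omega>)"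
proof -
  have b: "bounded (closure \<Omega>)" and ne: "\<Omega> \<noteq> {}" using \<Omega> by (auto simp: lipschitz_domain_def)
  have fin: "finite M" and un: "\<Union>M = closure \<Omega>" using M by (simp_all add: is_mesh_def)
  have "M \<noteq> {}" using un ne by (metis Sup_empty closure_eq_empty)
  then obtain K where K: "K \<in> M" by blast
  have KU: "K' \<subseteq> closure \<Omega>" if "K' \<in> M" for K' using un that by blast
  have "interior K \<noteq> {}" using M K by (simp add: is_mesh_def lipschitz_domain_def)
  then obtain x \<rho> where \<rho>: "0 < \<rho>" "ball x \<rho> \<subseteq> K" by (auto simp: mem_interior)
  have "diameter (ball x \<rho>) \<le> diameter K"
    by (rule diameter_subset[OF \<rho>(2) bounded_subset[OF b KU[OF K]]])
  then have "0 < diameter K" using \<rho> by simp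
  also have "diameter K \<le> mesh_size M" unfolding mesh_size_def using fin K by (intro Max_ge) auto
  finally show "0 < mesh_size M" .
  show "mesh_size M \<le> diameter (closure \<Omega>)"
    unfolding mesh_size_def using fin \<open>M \<noteq> {}\<close> diameter_subset[OF KU b] by (intro Max.boundedI) auto
qed

theorem corollary4p2:
  fixes \<Omega> :: "(real^'d) set"
    and V :: "('d::finite, 'm::finite) vfield set"
    and G :: "('d::finite, 'm::finite) vfield \<Rightarrow> ('d::finite, 'm::finite) vfield"
    and k \<nu> :: nat
    and s r \<sigma> Capp :: real
    and R :: "(real \<times> real) set"
  assumes "lipschitz_domain \<Omega>"
    and "field_subspace V" and "V \<subseteq> sobolev_space \<Omega> 1" and "dense_in_L2 \<Omega> V"
    and "first_order_operator \<Omega> V G" and "linear_into_L2 \<Omega> V G" and "skew_symmetric \<Omega> V G"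
    and "1 \<le> s" and "r = min s (real k + 1)"
    and "(\<nu> = 1 \<and> (\<exists>\<theta>0>1/2. R = {(\<theta>, \<tau>). \<theta> = \<theta>0})) \<or>
         (\<nu> = 2 \<and> R = {(\<theta>, \<tau>). \<theta> = 1/2}) \<or>
         (\<nu> = 2 \<and> (\<exists>K\<ge>0. R = {(\<theta>, \<tau>). \<bar>\<theta> - 1/2\<bar> \<le> K * \<tau>}))"
  shows "\<exists>C>0. \<forall>\<theta> \<tau> \<delta> T M h Vh N U0 F U dU Uh.
     (\<theta>, \<tau>) \<in> R \<and> 1/2 \<le> \<theta> \<and> \<theta> \<le> 1 \<and> 0 < \<tau> \<and> \<delta> = \<theta> * \<tau> \<and> 0 < \<delta> \<and> \<delta> \<le> 1 \<and>
     0 < T \<and> 1 \<le> N \<and> real N * \<tau> \<le> T \<and>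
     is_mesh \<Omega> M \<and> shape_regular \<sigma> M \<and> h = mesh_size M \<and> fe_space V M k Vh \<and>
     dU 0 = U \<and> (\<forall>j<4. has_time_derivative \<Omega> T (dU j) (dU (Suc j))) \<and>
     exact_solution \<Omega> V G T F U0 U (dU 1) \<and>
     finite_norms \<Omega> T r dU \<and>
     (\<forall>j\<le>2. AE t in lebesgue_on {0<..<T}. dU j t \<in> V \<and>
        l2_norm \<Omega> (\<lambda>x. dU j t x - l2_projection \<Omega> Vh (dU j t) x) +
        h * l2_norm \<Omega> (G (\<lambda>x. dU j t x - l2_projection \<Omega> Vh (dU j t) x))
        \<le> Capp * (h powr r * sobolev_norm \<Omega> r (dU j t))) \<and>
     (\<forall>n\<le>N. Uh n \<in> Vh) \<and>
     (AE x in lebesgue_on \<Omega>. Uh 0 x = l2_projection \<Omega> Vh (U 0) x) \<and>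
     (\<forall>n\<in>{1..N}. \<forall>W\<in>Vh.
        l2_inner \<Omega> (A_tau G \<tau> \<theta> Uh n) (T_delta G \<delta> W) =
        l2_inner \<Omega> (M_theta \<theta> (\<lambda>i. F (real i * \<tau>)) n) (T_delta G \<delta> W))
     \<longrightarrow>
     (MAX n\<in>{1..N}. l2_norm \<Omega> (T_delta G \<delta> (\<lambda>x. Uh n x - U (real n * \<tau>) x))) \<le>
       C * ((h powr r + \<delta> * h powr (r - 1)) * Linf_time_norm T (sobolev_norm \<Omega> r) U
          + ((1 + T powr (1/2)) * \<delta> powr (1/2) * h powr (r - 1) + \<delta> powr (-1/2) * h powr r)
              * norm_N2 \<Omega> T r dU
          + (1 + T powr (1/2)) * \<tau> ^ \<nu> * C_sharp \<Omega> T dU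
          + \<tau> powr (1/2) * (h powr r + \<tau> * h powr (r - 1))
              * L2_time_norm T (sobolev_norm \<Omega> r) (dU 1)
          + \<tau> powr (1/2) * h powr (r - 1) * L2_time_norm T (sobolev_norm \<Omega> r) U
          + \<tau> powr (real \<nu> + 1/2) * C_sharp \<Omega> T dU)"
proof -
  note \<Omega> = assms(1) and V = assms(2-4) and G = assms(6,7) and reg = assms(10)
  have open\<Omega>: "\<Omega> \<in> sets lebesgue" using \<Omega> by (auto simp: lipschitz_domain_def)
  have VL: "V \<subseteq> L2_space \<Omega>" using V(2) by (auto simp: sobolev_space_def)
  \<comment> \<open>order 1: \<open>\<tau> \<le> 2\<close> turns \<open>\<tau>\<^sup>2\<close> into \<open>2 * \<tau>\<close>; order 2: \<open>\<theta> - 1/2\<close> itself is of order \<open>\<tau>\<close>\<close>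
  have "\<exists>\<kappa>\<ge>0. \<forall>\<theta> \<tau>. (\<theta>, \<tau>) \<in> R \<and> 1/2 \<le> \<theta> \<and> \<theta> \<le> 1 \<and> 0 < \<tau> \<and> \<theta> * \<tau> \<le> 1 \<longrightarrow>
      \<bar>\<theta> - 1/2\<bar> * \<tau> + 3/2 * \<tau>\<^sup>2 \<le> \<kappa> * \<tau> ^ \<nu>"
  proof -
    consider (first) "\<nu> = 1" | (second) K where "\<nu> = 2" "0 \<le> K" "\<And>\<theta> \<tau>. (\<theta>, \<tau>) \<in> R \<Longrightarrow> \<bar>\<theta> - 1/2\<bar> \<le> K * \<tau>"
      using reg by (auto intro: that(2)[of 0])
    then show ?thesis
    proof cases
      case first
      have "\<bar>\<theta> - 1/2\<bar> * \<tau> + 3/2 * \<tau>\<^sup>2 \<le> 4 * \<tau> ^ \<nu>" if "1/2 \<le> \<theta>" "\<theta> \<le> 1" "0 < \<tau>" "\<theta> * \<tau> \<le> 1" for \<theta> \<tau> :: real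
      proof -
        have "1/2 * \<tau> \<le> \<theta> * \<tau>" using that by (intro mult_right_mono) auto
        then have "1/2 * \<tau> \<le> 1" using that(4) by linarith
        then have "\<tau> \<le> 2" by simp
        then have "\<tau>\<^sup>2 \<le> 2 * \<tau>" using that by (simp add: power2_eq_square)
        moreover have "\<bar>\<theta> - 1/2\<bar> * \<tau> \<le> 1/2 * \<tau>" using that by (intro mult_right_mono) auto
        ultimately show ?thesis unfolding first power_one_right using that(3) by linarith
      qed
      then show ?thesis by (intro exI[of _ 4]) auto
    next
      case second
      have K: "\<bar>\<theta> - 1/2\<bar> * \<tau> + 3/2 * \<tau>\<^sup>2 \<le> (K + 3/2) * \<tau> ^ \<nu>" if "(\<theta>, \<tau>) \<in> R" "0 < \<tau>" for \<theta> \<tau> :: real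
        using mult_right_mono[OF second(3)[OF that(1)], of \<tau>] that second(1)
        by (simp add: power2_eq_square algebra_simps)
      show ?thesis
        by (intro exI[of _ "K + 3/2"] conjI) (use second(2) in simp, use K in blast)
    qed
  qed
  then obtain \<kappa> where \<kappa>: "0 \<le> \<kappa>" and consistency: "\<And>\<theta> \<tau>. (\<theta>, \<tau>) \<in> R \<Longrightarrow> 1/2 \<le> \<theta> \<Longrightarrow> \<theta> \<le> 1 \<Longrightarrow> 0 < \<tau> \<Longrightarrow> \<theta> * \<tau> \<le> 1 \<Longrightarrow>
      \<bar>\<theta> - 1/2\<bar> * \<tau> + 3/2 * \<tau>\<^sup>2 \<le> \<kappa> * \<tau> ^ \<nu>"
    by blast
  define d where "d = diameter (closure \<Omega>)"
  have d: "0 \<le> d" unfolding d_def by (rule diameter_ge_0) (use \<Omega> in \<open>auto simp: lipschitz_domain_def\<close>)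
  let ?C = "1 + \<bar>Capp\<bar> + 4 * \<bar>Capp\<bar> * (d + 1) + 4 * \<bar>Capp\<bar> + 6 * \<kappa>"
  show ?thesis
  proof (intro exI[of _ ?C] conjI allI impI, goal_cases)
    case 1
    show ?case using d \<kappa> by (intro add_pos_nonneg) auto
  next
    case (2 \<theta> \<tau> \<delta> T M h Vh N U0 F U dU Uh)
    then have U: "U = dU 0" and \<delta>: "\<delta> = \<theta> * \<tau>" and N1: "1 \<le> N" and h: "0 < h" "h \<le> d"
      using mesh_size_bounds[OF \<Omega>] by (auto simp: d_def)
    have approx: "\<forall>j\<le>2. AE t in lebesgue_on {0<..<T}. dU j t \<in> V \<and>
        l2_norm \<Omega> (\<lambda>x. dU j t x - l2_projection \<Omega> Vh (dU j t) x) +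
        h * l2_norm \<Omega> (G (\<lambda>x. dU j t x - l2_projection \<Omega> Vh (dU j t) x))
        \<le> Capp * (h powr r * sobolev_norm \<Omega> r (dU j t))"
      and scheme: "\<forall>n\<in>{1..N}. \<forall>W\<in>Vh.
        l2_inner \<Omega> (A_tau G \<tau> \<theta> Uh n) (T_delta G \<delta> W) =
        l2_inner \<Omega> (M_theta \<theta> (\<lambda>i. F (real i * \<tau>)) n) (T_delta G \<delta> W)"
      using 2 by blast+
    have rest: "1/2 \<le> \<theta>" "\<theta> \<le> 1" "0 < \<tau>" "\<delta> \<le> 1" "0 < T" "real N * \<tau> \<le> T" "fe_space V M k Vh"
      "\<forall>j<4. has_time_derivative \<Omega> T (dU j) (dU (Suc j))" "exact_solution \<Omega> V G T F U0 (dU 0) (dU 1)"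
      "finite_norms \<Omega> T r dU" "\<forall>n\<le>N. Uh n \<in> Vh" "AE x in lebesgue_on \<Omega>. Uh 0 x = l2_projection \<Omega> Vh (dU 0 0) x"
      using 2 unfolding U by blast+
    interpret theta_scheme \<Omega> V G M k Vh T r Capp h d \<theta> \<tau> \<delta> N F U0 dU Uh
      by unfold_locales (fact open\<Omega> VL V(1,3) G h \<delta> rest | rule rest(8)[rule_format] rest(11)[rule_format]
        approx[rule_format] scheme[rule_format], assumption+)+
    have "\<bar>\<theta> - 1/2\<bar> * \<tau> + 3/2 * \<tau>\<^sup>2 \<le> \<kappa> * \<tau> ^ \<nu>"
      by (rule consistency) (use 2 in auto)
    note bound = error_estimate[OF _ \<kappa> this]
    show ?case
      unfolding U by (rule Max.boundedI) (use N1 in simp, use N1 in simp, use bound in blast)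
  qed
qed

end
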